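(* Let $G$ be a 2-generated GBS group represented by a reduced labelled graph $\Gamma$ homeomorphic to a lollipop (possibly a circle), with labels $q_i,r_i,x_j,y_j$ and products $Q,X,Y$ as described in the context. Then there is an epimorphism from $G$ onto $BS(QX,QY)$ if and only if $q_i\wedge r_j=1$ for all $0\le i<j<k$, and at least one of the following holds: \begin{itemize} \item $X$ and $QY$ are coprime; \item $Y$ and $QX$ are coprime; \item $Q$ and $r_k$ are coprime, and there exists $i_0\in\{0,\dots,\ell-1\}$ such that, whenever a prime $p$ divides both $QX$ and $QY$, it divides no $x_i$ with $i>i_0$ and no $y_j$ with $j\le i_0$. \end{itemize}
   Context: For nonzero integers $m,n$, $BS(m,n)=\langle a,t\mid ta^mt^{-1}=a^n\rangle$; $m\wedge n>0$ denotes the greatest common divisor. A generalized Baumslag-Solitar (GBS) group is a finitely generated group acting on a tree (without inversions) with all vertex and edge stabilizers infinite cyclic. A group is 2-generated if it can be generated by two elements. A labelled graph is a finite graph $\Gamma$ in which each oriented edge $e$ carries a label $\lambda_e$, a nonzero integer (the label of $e$ near its origin $o(e)$). A connected labelled graph represents the GBS group which is the fundamental group of the graph of groups with all vertex and edge groups $\mathbb{Z}$, where the inclusion from the edge group of $e$ into the vertex group of $o(e)$ is multiplication by $\lambda_e$. $\Gamma$ is reduced if every edge $e$ with $\lambda_e=\pm1$ is a loop. Lollipop: an arc with vertices $v_0,\dots,v_k$ ($k\ge1$) and edges $v_iv_{i+1}$ ($0\le i\le k-1$) with label $q_i$ near $v_i$ and $r_{i+1}$ near $v_{i+1}$, attached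 at $v_k=w_0$ to a circle with vertices $w_0,w_1,\dots,w_{\ell-1}$ ($\ell\ge1$, $w_\ell=w_0$) and edges $w_jw_{j+1}$ ($0\le j\le\ell-1$) with label $x_j$ near $w_j$ and $y_{j+1}$ near $w_{j+1}$ (a loop with labels $x_0,y_1$ if $\ell=1$). Put $Q=\prod_{i=0}^{k-1}q_i$, $X=\prod_{j=0}^{\ell-1}x_j$, $Y=\prod_{j=1}^{\ell}y_j$. A circle is viewed as a lollipop with no arc ($k=0$), with $Q=1$; the condition that $q_i\wedge r_j=1$ for $i<j<k$ and the condition that $Q$ and $r_k$ be coprime are then vacuous. Plateaus: for $p$ prime, a $p$-plateau is a nonempty connected subgraph $P\subset\Gamma$ such that, for every oriented edge $e$ whose origin belongs to $P$, the label $\lambda_e$ is divisible by $p$ if and only if $e$ is not contained in $P$. A plateau is a $p$-plateau for some prime $p$. Convention: when $\Gamma$ is a circle (representing a 2-generated group), there is a vertex belonging to every plateau, and the numbering of vertices is always chosen so that $w_0$ belongs to every plateau. *)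

theory Defs
  imports
    "HOL-Algebra.Generated_Groups"
    "HOL-Computational_Algebra.Primes"
    "Graph_Theory.Bidirected_Digraph"
    "Graph_Theory.Digraph_Component"
begin

section \<open>Groups given by generators and relations\<close>

text \<open>A letter \<open>(s, True)\<close> stands for the generator \<open>s\<close>, and \<open>(s, False)\<close> for its inverse.\<close>

type_synonym 's word = "('s \<times> bool) list"

definition words :: "'s set \<Rightarrow> 's word set" where
  "words S = lists (S \<times> UNIV)"

definition gen_pow :: "'s \<Rightarrow> int \<Rightarrow> 's word" where
  "gen_pow s n = replicate (nat \<bar>n\<bar>) (s, n \<ge> 0)"

text \<open>A pair \<open>(a, b) \<in> R\<close> encodes the relation \<open>a = b\<close>.\<close>

inductive word_eq :: "'s set \<Rightarrow> ('s word \<times> 's word) set \<Rightarrow> 's word \<Rightarrow> 's word \<Rightarrow> bool"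
  for S R where
  refl: "w \<in> words S \<Longrightarrow> word_eq S R w w"
| sym: "word_eq S R v w \<Longrightarrow> word_eq S R w v"
| trans: "word_eq S R u v \<Longrightarrow> word_eq S R v w \<Longrightarrow> word_eq S R u w"
| cancel: "u \<in> words S \<Longrightarrow> v \<in> words S \<Longrightarrow> s \<in> S \<Longrightarrow>
    word_eq S R (u @ [(s, b), (s, \<not> b)] @ v) (u @ v)"
| relation: "u \<in> words S \<Longrightarrow> v \<in> words S \<Longrightarrow> (a, b) \<in> R \<Longrightarrow> a \<in> words S \<Longrightarrow> b \<in> words S \<Longrightarrow>
    word_eq S R (u @ a @ v) (u @ b @ v)"

definition word_class :: "'s set \<Rightarrow> ('s word \<times> 's word) set \<Rightarrow> 's word \<Rightarrow> 's word set" where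
  "word_class S R w = {v. word_eq S R w v}"

definition presented_group :: "'s set \<Rightarrow> ('s word \<times> 's word) set \<Rightarrow> 's word set monoid" where
  "presented_group S R =
    \<lparr> carrier = word_class S R ` words S,
      monoid.mult = (\<lambda>A B. \<Union>a\<in>A. \<Union>b\<in>B. word_class S R (a @ b)),
      one = word_class S R [] \<rparr>"

lemma words_simps [simp]:
  "[] \<in> words S"
  "u @ v \<in> words S \<longleftrightarrow> u \<in> words S \<and> v \<in> words S"
  "c # v \<in> words S \<longleftrightarrow> fst c \<in> S \<and> v \<in> words S"
  by (cases c; auto simp: words_def)+

lemma word_eq_words: "word_eq S R u v \<Longrightarrow> u \<in> words S \<and> v \<in> words S"
  by (induction rule: word_eq.induct) auto

lemma word_eq_context:
  assumes "word_eq S R u v" "a \<in> words S" "b \<in> words S"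
  shows "word_eq S R (a @ u @ b) (a @ v @ b)"
  using assms
proof (induction rule: word_eq.induct)
  case (refl w)
  then show ?case by (simp add: word_eq.refl)
next
  case (sym v w)
  then show ?case by (simp add: word_eq.sym)
next
  case (trans u v w)
  then show ?case using word_eq.trans[of S R "a @ u @ b" "a @ v @ b" "a @ w @ b"] by simp
next
  case (cancel u v s c)
  then show ?case using word_eq.cancel[of "a @ u" S "v @ b" s R c] by simp
next
  case (relation u v c d)
  then show ?case using word_eq.relation[of "a @ u" S "v @ b" c d R] by simp
qed

lemma word_eq_append:
  assumes "word_eq S R u u'" "word_eq S R v v'"
  shows "word_eq S R (u @ v) (u' @ v')"
proof -
  have "word_eq S R (u @ v) (u' @ v)"
    using word_eq_context[OF assms(1), of "[]" v] word_eq_words[OF assms(2)] by simp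
  moreover have "word_eq S R (u' @ v) (u' @ v')"
    using word_eq_context[OF assms(2), of u' "[]"] word_eq_words[OF assms(1)] by simp
  ultimately show ?thesis by (rule word_eq.trans)
qed

lemma word_class_eq_iff:
  assumes "u \<in> words S" "v \<in> words S"
  shows "word_class S R u = word_class S R v \<longleftrightarrow> word_eq S R u v"
proof
  assume "word_class S R u = word_class S R v"
  moreover have "v \<in> word_class S R v"
    using assms by (simp add: word_class_def word_eq.refl)
  ultimately show "word_eq S R u v" by (simp add: word_class_def set_eq_iff)
next
  assume "word_eq S R u v"
  then show "word_class S R u = word_class S R v"
    unfolding word_class_def by (blast intro: word_eq.sym word_eq.trans)
qed

lemma mult_word_class:
  assumes "u \<in> words S" "v \<in> words S"
  shows "word_class S R u \<otimes>\<^bsub>presented_group S R\<^esub> word_class S R v = word_class S R (u @ v)"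
proof -
  have eq: "word_class S R (a @ b) = word_class S R (u @ v)"
    if "word_eq S R u a" "word_eq S R v b" for a b
    using word_eq.sym[OF word_eq_append[OF that]] word_eq_words[OF that(1)]
      word_eq_words[OF that(2)]
    by (simp add: word_class_eq_iff)
  have "word_eq S R u u" "word_eq S R v v"
    using assms by (auto intro: word_eq.refl)
  then have mem: "u \<in> word_class S R u" "v \<in> word_class S R v"
    by (simp_all add: word_class_def)
  have "word_class S R u \<otimes>\<^bsub>presented_group S R\<^esub> word_class S R v =
      (\<Union>a \<in> word_class S R u. \<Union>b \<in> word_class S R v. word_class S R (a @ b))"
    by (simp add: presented_group_def)
  also have "\<dots> = (\<Union>a \<in> word_class S R u. \<Union>b \<in> word_class S R v. word_class S R (u @ v))"
    by (intro SUP_cong refl eq) (simp_all add: word_class_def)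
  also have "\<dots> = word_class S R (u @ v)" using mem by blast
  finally show ?thesis .
qed

lemma word_inverse:
  assumes "w \<in> words S"
  shows "\<exists>v \<in> words S. word_eq S R (v @ w) []"
  using assms
proof (induction w)
  case Nil
  then show ?case by (intro bexI[of _ "[]"]) (auto intro: word_eq.refl)
next
  case (Cons c w)
  obtain s b where c: "c = (s, b)" by (cases c)
  from Cons obtain v where v: "v \<in> words S" "word_eq S R (v @ w) []" by auto
  have "word_eq S R ((v @ [(s, \<not> b)]) @ c # w) (v @ w)"
    using word_eq.cancel[of v S w s R "\<not> b"] Cons.prems v(1) c by simp
  then show ?case
    using v Cons.prems c
    by (intro bexI[of _ "v @ [(s, \<not> b)]"] word_eq.trans[OF _ v(2)]) auto
qed

lemma group_presented_group: "group (presented_group S R)"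
proof (rule groupI)
  show "\<one>\<^bsub>presented_group S R\<^esub> \<in> carrier (presented_group S R)"
    by (simp add: presented_group_def)
next
  fix A B
  assume "A \<in> carrier (presented_group S R)" "B \<in> carrier (presented_group S R)"
  then obtain a b where "A = word_class S R a" "B = word_class S R b" "a \<in> words S" "b \<in> words S"
    by (auto simp: presented_group_def)
  then show "A \<otimes>\<^bsub>presented_group S R\<^esub> B \<in> carrier (presented_group S R)"
    by (simp add: mult_word_class) (auto simp: presented_group_def)
next
  fix A B C
  assume "A \<in> carrier (presented_group S R)" "B \<in> carrier (presented_group S R)"
    "C \<in> carrier (presented_group S R)"
  then obtain a b c where "A = word_class S R a" "B = word_class S R b" "C = word_class S R c"
    "a \<in> words S" "b \<in> words S" "c \<in> words S"
    by (auto simp: presented_group_def)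
  then show "A \<otimes>\<^bsub>presented_group S R\<^esub> B \<otimes>\<^bsub>presented_group S R\<^esub> C =
      A \<otimes>\<^bsub>presented_group S R\<^esub> (B \<otimes>\<^bsub>presented_group S R\<^esub> C)"
    by (simp add: mult_word_class)
next
  fix A
  assume "A \<in> carrier (presented_group S R)"
  then obtain a where a: "A = word_class S R a" "a \<in> words S"
    by (auto simp: presented_group_def)
  have one: "\<one>\<^bsub>presented_group S R\<^esub> = word_class S R []"
    by (simp add: presented_group_def)
  show "\<one>\<^bsub>presented_group S R\<^esub> \<otimes>\<^bsub>presented_group S R\<^esub> A = A"
    using a by (simp add: one mult_word_class)
  obtain v where v: "v \<in> words S" "word_eq S R (v @ a) []"
    using word_inverse[OF a(2)] by blast
  then have "word_class S R v \<otimes>\<^bsub>presented_group S R\<^esub> A = \<one>\<^bsub>presented_group S R\<^esub>"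
    using a by (simp add: one mult_word_class word_class_eq_iff)
  moreover have "word_class S R v \<in> carrier (presented_group S R)"
    using v by (simp add: presented_group_def)
  ultimately show "\<exists>B \<in> carrier (presented_group S R).
      B \<otimes>\<^bsub>presented_group S R\<^esub> A = \<one>\<^bsub>presented_group S R\<^esub>"
    by blast
qed

definition two_generated :: "('g, 'c) monoid_scheme \<Rightarrow> bool" where
  "two_generated G \<longleftrightarrow> (\<exists>a \<in> carrier G. \<exists>b \<in> carrier G. generate G {a, b} = carrier G)"

datatype BS_gen = BS_a | BS_t

definition BS :: "int \<Rightarrow> int \<Rightarrow> BS_gen word set monoid" where
  "BS m n = presented_group UNIV
    {([(BS_t, True)] @ gen_pow BS_a m @ [(BS_t, False)], gen_pow BS_a n)}"

section \<open>Labelled graphs\<close>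

text \<open>
  Edges are oriented: \<open>arcs \<Gamma>\<close> contains both orientations of every geometric edge, exchanged
  by \<open>rv\<close>.  The label \<open>lab e\<close> sits near the origin \<open>tail \<Gamma> e\<close> of \<open>e\<close>.
\<close>

locale labelled_graph = fin_digraph \<Gamma> + bidirected_digraph \<Gamma> rv
  for \<Gamma> :: "('v, 'e) pre_digraph" and rv :: "'e \<Rightarrow> 'e" +
  fixes lab :: "'e \<Rightarrow> int"
  assumes lab_nonzero: "e \<in> arcs \<Gamma> \<Longrightarrow> lab e \<noteq> 0"

definition reduced_graph :: "('v, 'e) pre_digraph \<Rightarrow> ('e \<Rightarrow> int) \<Rightarrow> bool" where
  "reduced_graph \<Gamma> lab \<longleftrightarrow> (\<forall>e \<in> arcs \<Gamma>. \<bar>lab e\<bar> = 1 \<longrightarrow> tail \<Gamma> e = head \<Gamma> e)"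

text \<open>
  \<open>Graph_Theory.subgraph\<close> does not force a subgraph to contain both orientations of its edges.
\<close>

definition rv_subgraph ::
  "('v, 'e) pre_digraph \<Rightarrow> ('e \<Rightarrow> 'e) \<Rightarrow> ('v, 'e) pre_digraph \<Rightarrow> bool" where
  "rv_subgraph \<Gamma> rv P \<longleftrightarrow> subgraph P \<Gamma> \<and> rv ` arcs P \<subseteq> arcs P"

text \<open>
  Nonemptiness of \<open>P\<close> is part of \<^const>\<open>connected\<close>.
\<close>

definition is_p_plateau ::
  "int \<Rightarrow> ('v, 'e) pre_digraph \<Rightarrow> ('e \<Rightarrow> 'e) \<Rightarrow> ('e \<Rightarrow> int) \<Rightarrow> ('v, 'e) pre_digraph \<Rightarrow> bool" where
  "is_p_plateau p \<Gamma> rv lab P \<longleftrightarrow>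
    rv_subgraph \<Gamma> rv P \<and> connected P \<and>
    (\<forall>e \<in> arcs \<Gamma>. tail \<Gamma> e \<in> verts P \<longrightarrow> (p dvd lab e \<longleftrightarrow> e \<notin> arcs P))"

definition is_plateau ::
  "('v, 'e) pre_digraph \<Rightarrow> ('e \<Rightarrow> 'e) \<Rightarrow> ('e \<Rightarrow> int) \<Rightarrow> ('v, 'e) pre_digraph \<Rightarrow> bool" where
  "is_plateau \<Gamma> rv lab P \<longleftrightarrow> (\<exists>p. prime p \<and> is_p_plateau p \<Gamma> rv lab P)"

text \<open>
  The notion of tree from \<open>Graph_Theory\<close> forbids directed cycles and hence rejects every symmetric
  digraph with an edge; here a tree is a connected graph without nonempty closed paths that never
  backtrack.
\<close>

definition maximal_tree ::
  "('v, 'e) pre_digraph \<Rightarrow> ('e \<Rightarrow> 'e) \<Rightarrow> ('v, 'e) pre_digraph \<Rightarrow> bool" where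
  "maximal_tree \<Gamma> rv T \<longleftrightarrow>
    rv_subgraph \<Gamma> rv T \<and> verts T = verts \<Gamma> \<and> connected T \<and>
    \<not> (\<exists>u p. p \<noteq> [] \<and> pre_digraph.awalk T u p u \<and> successively (\<lambda>e f. f \<noteq> rv e) p)"

datatype ('v, 'e) GBS_gen = Vertex 'v | Stable 'e

text \<open>
  The fundamental group, relative to a maximal tree \<open>T\<close>, of the graph of groups with all vertex
  and edge groups infinite cyclic in which the generator of the group of the edge \<open>e\<close> is sent to
  the \<open>lab e\<close>-th power of the generator at \<open>tail \<Gamma> e\<close> and to the \<open>lab (rv e)\<close>-th power of the
  generator at \<open>head \<Gamma> e\<close>.
\<close>

definition GBS_rels ::
  "('v, 'e) pre_digraph \<Rightarrow> ('e \<Rightarrow> 'e) \<Rightarrow> ('e \<Rightarrow> int) \<Rightarrow> ('v, 'e) pre_digraph \<Rightarrow>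
    (('v, 'e) GBS_gen word \<times> ('v, 'e) GBS_gen word) set" where
  "GBS_rels \<Gamma> rv lab T =
    {([(Stable e, True)] @ gen_pow (Vertex (head \<Gamma> e)) (lab (rv e)) @ [(Stable e, False)],
      gen_pow (Vertex (tail \<Gamma> e)) (lab e)) | e. e \<in> arcs \<Gamma>} \<union>
    {([(Stable e, True), (Stable (rv e), True)], []) | e. e \<in> arcs \<Gamma>} \<union>
    {([(Stable e, True)], []) | e. e \<in> arcs T}"

definition GBS_group ::
  "('v, 'e) pre_digraph \<Rightarrow> ('e \<Rightarrow> 'e) \<Rightarrow> ('e \<Rightarrow> int) \<Rightarrow> ('v, 'e) pre_digraph \<Rightarrow>
    ('v, 'e) GBS_gen word set monoid" where
  "GBS_group \<Gamma> rv lab T =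
    presented_group (Vertex ` verts \<Gamma> \<union> Stable ` arcs \<Gamma>) (GBS_rels \<Gamma> rv lab T)"

definition represents ::
  "('v, 'e) pre_digraph \<Rightarrow> ('e \<Rightarrow> 'e) \<Rightarrow> ('e \<Rightarrow> int) \<Rightarrow> ('g, 'c) monoid_scheme \<Rightarrow> bool" where
  "represents \<Gamma> rv lab G \<longleftrightarrow>
    labelled_graph \<Gamma> rv lab \<and> connected \<Gamma> \<and>
    (\<exists>T. maximal_tree \<Gamma> rv T \<and> G \<cong> GBS_group \<Gamma> rv lab T)"

section \<open>Lollipops\<close>

text \<open>
  The vertex \<open>v\<^sub>i\<close> is the number \<open>i\<close>, for \<open>0 \<le> i \<le> k\<close>, and the vertex \<open>w\<^sub>j\<close> is the number
  \<open>k + j mod l\<close>; in particular \<open>v\<^sub>k = w\<^sub>0 = w\<^sub>l\<close> is \<open>k\<close>.  \<open>Arc i\<close> is the edge from \<open>v\<^sub>i\<close> to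
  \<open>v\<^sub>i\<^sub>+\<^sub>1\<close>, and \<open>Circ j\<close> the edge from \<open>w\<^sub>j\<close> to \<open>w\<^sub>j\<^sub>+\<^sub>1\<close>; the Boolean is \<open>True\<close> for this
  orientation and \<open>False\<close> for the opposite one.
\<close>

datatype lolli_edge = Arc nat | Circ nat

definition lolli_arcs :: "nat \<Rightarrow> nat \<Rightarrow> (lolli_edge \<times> bool) set" where
  "lolli_arcs k l = (Arc ` {..<k} \<union> Circ ` {..<l}) \<times> UNIV"

fun lolli_tail :: "nat \<Rightarrow> nat \<Rightarrow> lolli_edge \<times> bool \<Rightarrow> nat" where
  "lolli_tail k l (Arc i, True) = i"
| "lolli_tail k l (Arc i, False) = Suc i"
| "lolli_tail k l (Circ j, True) = k + j mod l"
| "lolli_tail k l (Circ j, False) = k + Suc j mod l"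

definition lollipop :: "nat \<Rightarrow> nat \<Rightarrow> (nat, lolli_edge \<times> bool) pre_digraph" where
  "lollipop k l =
    \<lparr> verts = {..<k + l}, arcs = lolli_arcs k l,
      tail = lolli_tail k l, head = (\<lambda>(c, b). lolli_tail k l (c, \<not> b)) \<rparr>"

text \<open>The locale \<^locale>\<open>bidirected_digraph\<close> requires the reversal to be the identity off the arcs.\<close>

definition lolli_rev :: "nat \<Rightarrow> nat \<Rightarrow> lolli_edge \<times> bool \<Rightarrow> lolli_edge \<times> bool" where
  "lolli_rev k l e = (if e \<in> lolli_arcs k l then (fst e, \<not> snd e) else e)"

fun lolli_label ::
  "(nat \<Rightarrow> int) \<Rightarrow> (nat \<Rightarrow> int) \<Rightarrow> (nat \<Rightarrow> int) \<Rightarrow> (nat \<Rightarrow> int) \<Rightarrow> lolli_edge \<times> bool \<Rightarrow> int" where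
  "lolli_label q r x y (Arc i, True) = q i"
| "lolli_label q r x y (Arc i, False) = r (Suc i)"
| "lolli_label q r x y (Circ j, True) = x j"
| "lolli_label q r x y (Circ j, False) = y (Suc j)"

lemma labelled_graph_lollipop:
  assumes "l \<ge> 1"
    and "\<forall>i<k. q i \<noteq> 0 \<and> r (Suc i) \<noteq> 0"
    and "\<forall>j<l. x j \<noteq> 0 \<and> y (Suc j) \<noteq> 0"
  shows "labelled_graph (lollipop k l) (lolli_rev k l) (lolli_label q r x y)"
proof -
  have tail_less: "lolli_tail k l (c, b) < k + l" if "(c, b) \<in> lolli_arcs k l" for c b
    using that assms(1) by (cases c; cases b) (auto simp: lolli_arcs_def)
  have label: "lolli_label q r x y (c, b) \<noteq> 0" if "(c, b) \<in> lolli_arcs k l" for c b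
    using that assms(2,3) by (cases c; cases b) (auto simp: lolli_arcs_def)
  have opp: "(c, \<not> b) \<in> lolli_arcs k l \<longleftrightarrow> (c, b) \<in> lolli_arcs k l" for c b
    by (simp add: lolli_arcs_def)
  have fin: "finite (lolli_arcs k l)" by (simp add: lolli_arcs_def)
  show ?thesis
  proof unfold_locales
    fix e assume "e \<in> arcs (lollipop k l)"
    then obtain c b where e: "e = (c, b)" "(c, b) \<in> lolli_arcs k l"
      by (cases e) (simp add: lollipop_def)
    show "tail (lollipop k l) e \<in> verts (lollipop k l)"
      using e tail_less by (simp add: lollipop_def)
    show "head (lollipop k l) e \<in> verts (lollipop k l)"
      using e tail_less[of c "\<not> b"] opp by (simp add: lollipop_def)
    show "lolli_rev k l (lolli_rev k l e) = e"
      using e opp by (simp add: lolli_rev_def)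
    show "tail (lollipop k l) (lolli_rev k l e) = head (lollipop k l) e"
      using e by (simp add: lolli_rev_def lollipop_def)
    show "lolli_label q r x y e \<noteq> 0"
      using e label by simp
  next
    fix e show "e \<in> arcs (lollipop k l) \<longleftrightarrow> lolli_rev k l e \<noteq> e"
      by (cases e) (simp add: lollipop_def lolli_rev_def)
  qed (simp_all add: lollipop_def fin)
qed

end

theory Submission
  imports Defs "HOL-Computational_Algebra.Field_as_Ring"
begin

text \<open>
  A homomorphism from \<open>G\<close> to a group \<open>H\<close> is a sequence of elements of \<open>H\<close> along the path
  \<open>v\<^sub>0, \<dots>, v\<^sub>k = w\<^sub>0, \<dots>, w\<^sub>l\<close> satisfying the edge relations, with \<open>w\<^sub>l\<close> a conjugate of \<open>w\<^sub>0\<close> by the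
  image of the stable letter.  Let \<open>H = BS(QX, QY)\<close>.

  If the homomorphism is onto and some prime divides both \<open>QX\<close> and \<open>QY\<close>, the vertex generators are
  elliptic, because they are commensurated by all of \<open>H\<close>.  Normalise \<open>v\<^sub>0 = a\<^sup>e\<close>.  Then no prime
  dividing both \<open>QX\<close> and \<open>QY\<close> divides \<open>e\<close>: for a lollipop with an arc, \<open>G\<close> would otherwise act by
  affine maps with three independent translation parts, which is impossible for a 2-generated group;
  for a circle, \<open>w\<^sub>0\<close> lies in every plateau.  By Britton's lemma consecutive vertices stay in \<open>\<langle>a\<rangle>\<close>
  until an exponent becomes divisible by \<open>QX\<close> or \<open>QY\<close>.  Either this happens at the attaching vertex,
  which yields one of the first two conditions, or it happens on the circle; comparing the first such
  edges in both directions around the circle yields the third.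

  Conversely, each condition dictates powers of \<open>a\<close>, conjugated by powers of \<open>t\<close>, as images, and the
  exponents have no common prime factor.
\<close>

section \<open>Homomorphisms out of a presented group\<close>

text \<open>Two-generation enters only as linear algebra. Affine maps of a three-dimensional space
  with scalar linear parts and with translation parts orthogonal to a fixed covector form a group,
  and two vectors in dimension three have a common nonzero orthogonal covector. A homomorphism whose
  translation parts span is therefore excluded. With an arc this serves both directions: it controls
  the exponent at v_0, and it shows that a prime dividing Q and r_k divides X or Y, which the
  converse needs. For a circle the position of w_0 in the plateaus takes over.

  Reducedness enters only through the q_i not being units. With an arc this gives QX and QY a common
  prime, on which the ellipticity argument rests, and keeps QX and QY from dividing an exponent
  before the last edge of the arc. A circle with QX and QY coprime satisfies the first condition at
  once.

  The exponent at a vertex is a quotient of products of labels times the starting exponent; the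
  equations are kept in multiplied-out form, so that everything stays in the integers.\<close>

primrec eval_word :: "('g, 'c) monoid_scheme \<Rightarrow> ('s \<Rightarrow> 'g) \<Rightarrow> 's word \<Rightarrow> 'g" where
  "eval_word H f [] = \<one>\<^bsub>H\<^esub>"
| "eval_word H f (c # w) =
    (if snd c then f (fst c) else inv\<^bsub>H\<^esub> f (fst c)) \<otimes>\<^bsub>H\<^esub> eval_word H f w"

lemma (in group) eval_word_closed:
  assumes "f \<in> S \<rightarrow> carrier G" "w \<in> words S"
  shows "eval_word G f w \<in> carrier G"
  using assms(2) by (induction w) (use assms(1) in auto)

lemma (in group) eval_word_append:
  assumes "f \<in> S \<rightarrow> carrier G" "v \<in> words S" "w \<in> words S"
  shows "eval_word G f (v @ w) = eval_word G f v \<otimes> eval_word G f w"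
  using assms(2)
proof (induction v)
  case Nil
  then show ?case using eval_word_closed[OF assms(1,3)] by simp
next
  case (Cons c v)
  have "f (fst c) \<in> carrier G" using assms(1) Cons.prems by auto
  then show ?case
    using Cons eval_word_closed[OF assms(1), of v] eval_word_closed[OF assms(1,3)]
    by (simp add: m_assoc)
qed

lemma (in group) eval_word_gen_pow:
  assumes "f s \<in> carrier G"
  shows "eval_word G f (gen_pow s n) = f s [^] n"
proof -
  have rep: "eval_word G f (replicate N (s, b)) = (if b then f s else inv f s) [^] N" for N b
  proof (induction N)
    case (Suc N)
    have "x [^] Suc N = x \<otimes> x [^] N" if "x \<in> carrier G" for x
      using that by (rule nat_pow_Suc2)
    from this[of "if b then f s else inv f s"] have
      "(if b then f s else inv f s) [^] Suc N =
        (if b then f s else inv f s) \<otimes> (if b then f s else inv f s) [^] N"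
      using assms by simp
    then show ?case by (simp only: replicate_Suc eval_word.simps Suc.IH fst_conv snd_conv)
  qed simp
  show ?thesis
  proof (cases "n < 0")
    case True
    then have "eval_word G f (gen_pow s n) = inv f s [^] nat (- n)" by (simp add: gen_pow_def rep)
    then show ?thesis using True assms by (simp only: int_pow_def2 if_True nat_pow_inv)
  next
    case False
    then have "eval_word G f (gen_pow s n) = f s [^] nat n" by (simp add: gen_pow_def rep)
    also have "\<dots> = f s [^] n" using False by (simp add: int_pow_int[symmetric])
    finally show ?thesis .
  qed
qed

lemma (in group) conjugation_hom:
  assumes "g \<in> carrier G"
  shows "(\<lambda>x. g \<otimes> x \<otimes> inv g) \<in> hom G G"
proof (rule homI)
  fix x y assume "x \<in> carrier G" "y \<in> carrier G"
  then show "g \<otimes> (x \<otimes> y) \<otimes> inv g = g \<otimes> x \<otimes> inv g \<otimes> (g \<otimes> y \<otimes> inv g)"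
    using assms by (simp add: m_assoc) (simp add: m_assoc[symmetric])
qed (use assms in auto)

lemma (in group) int_pow_conjugate:
  assumes "g \<in> carrier G" "x \<in> carrier G"
  shows "(g \<otimes> x \<otimes> inv g) [^] (z :: int) = g \<otimes> x [^] z \<otimes> inv g"
  using hom_int_pow[OF conjugation_hom[OF assms(1)] assms(2) is_group is_group, of z] by simp

lemma gen_pow_words [simp]: "gen_pow s n \<in> words S \<longleftrightarrow> n = 0 \<or> s \<in> S"
  by (simp add: gen_pow_def words_def lists_eq_set set_replicate_conv_if)

lemma hom_eval_word:
  assumes "group G" "group H" "\<phi> \<in> hom G H" "f \<in> S \<rightarrow> carrier G" "w \<in> words S"
  shows "\<phi> (eval_word G f w) = eval_word H (\<phi> \<circ> f) w"
proof -
  interpret group_hom G H \<phi>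
    using assms by (simp add: group_hom_def group_hom_axioms_def)
  show ?thesis using assms(5)
  proof (induction w)
    case (Cons c w)
    then have "f (fst c) \<in> carrier G" "eval_word G f w \<in> carrier G"
      using assms(4) G.eval_word_closed[OF assms(4)] by auto
    then show ?case using Cons by simp
  qed simp
qed

lemma (in group) eval_word_cong_word_eq:
  assumes "f \<in> S \<rightarrow> carrier G"
    and rels: "\<And>a b. (a, b) \<in> R \<Longrightarrow> a \<in> words S \<Longrightarrow> b \<in> words S \<Longrightarrow>
      eval_word G f a = eval_word G f b"
    and "word_eq S R v w"
  shows "eval_word G f v = eval_word G f w"
  using assms(3)
proof (induction rule: word_eq.induct)
  case (cancel u v s b)
  have "f s \<in> carrier G" using assms(1) cancel by auto
  moreover have "eval_word G f v \<in> carrier G"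
    using eval_word_closed[OF assms(1)] cancel by auto
  ultimately show ?case using cancel
    by (simp add: eval_word_append[OF assms(1)] m_assoc[symmetric])
next
  case (relation u v a b)
  then show ?case using rels[OF relation(3-5)]
    by (simp add: eval_word_append[OF assms(1)])
qed auto

text \<open>Von Dyck's theorem. Evaluation is constant on classes, so any representative gives the
  value; relations whose sides are not words over \<open>S\<close> never act and need no
  check.\<close>

lemma (in group) hom_from_presented_group:
  assumes "f \<in> S \<rightarrow> carrier G"
    and "\<And>a b. (a, b) \<in> R \<Longrightarrow> a \<in> words S \<Longrightarrow> b \<in> words S \<Longrightarrow>
      eval_word G f a = eval_word G f b"
  shows "\<exists>\<phi> \<in> hom (presented_group S R) G. \<forall>w \<in> words S. \<phi> (word_class S R w) = eval_word G f w"
proof -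
  define \<phi> where "\<phi> A = eval_word G f (SOME w. w \<in> A)" for A
  have val: "\<phi> (word_class S R w) = eval_word G f w" if "w \<in> words S" for w
  proof -
    have "w \<in> word_class S R w" using that by (simp add: word_class_def word_eq.refl)
    then have "(SOME v. v \<in> word_class S R w) \<in> word_class S R w" by (rule someI)
    then have "word_eq S R w (SOME v. v \<in> word_class S R w)" by (simp add: word_class_def)
    then show ?thesis
      unfolding \<phi>_def by (intro eval_word_cong_word_eq[OF assms, symmetric])
  qed
  moreover have "\<phi> \<in> hom (presented_group S R) G"
  proof (rule homI)
    fix A assume "A \<in> carrier (presented_group S R)"
    then show "\<phi> A \<in> carrier G"
      using val eval_word_closed[OF assms(1)] by (auto simp: presented_group_def)
  next
    fix A B assume "A \<in> carrier (presented_group S R)" "B \<in> carrier (presented_group S R)"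
    then obtain v w where "A = word_class S R v" "v \<in> words S" "B = word_class S R w" "w \<in> words S"
      by (auto simp: presented_group_def)
    then show "\<phi> (A \<otimes>\<^bsub>presented_group S R\<^esub> B) = \<phi> A \<otimes> \<phi> B"
      by (simp add: mult_word_class val eval_word_append[OF assms(1)])
  qed
  ultimately show ?thesis by blast
qed

abbreviation gen_class :: "'s set \<Rightarrow> ('s word \<times> 's word) set \<Rightarrow> 's \<Rightarrow> 's word set" where
  "gen_class S R s \<equiv> word_class S R [(s, True)]"

lemma gen_class_carrier: "gen_class S R \<in> S \<rightarrow> carrier (presented_group S R)"
  by (auto simp: presented_group_def)

lemma word_class_eq_eval_word:
  assumes "w \<in> words S"
  shows "word_class S R w = eval_word (presented_group S R) (gen_class S R) w"
  using assms
proof (induction w)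
  case Nil
  then show ?case by (simp add: presented_group_def)
next
  case (Cons c w)
  interpret group "presented_group S R" by (rule group_presented_group)
  obtain s b where c: "c = (s, b)" and s: "s \<in> S" using Cons.prems by (cases c) auto
  have closed: "gen_class S R s \<in> carrier (presented_group S R)"
    "word_class S R [(s, False)] \<in> carrier (presented_group S R)"
    using s by (auto simp: presented_group_def)
  have "word_class S R [(s, False)] \<otimes>\<^bsub>presented_group S R\<^esub> gen_class S R s = \<one>\<^bsub>presented_group S R\<^esub>"
  proof -
    have "word_eq S R [(s, False), (s, True)] []"
      using s word_eq.cancel[of "[]" S "[]" s R False] by simp
    then have "word_class S R [(s, False), (s, True)] = word_class S R []"
      using s by (subst word_class_eq_iff) auto
    moreover have "word_class S R [(s, False)] \<otimes>\<^bsub>presented_group S R\<^esub> gen_class S R s =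
        word_class S R [(s, False), (s, True)]"
      using s by (subst mult_word_class) auto
    ultimately show ?thesis by (simp add: presented_group_def)
  qed
  then have "word_class S R [(s, False)] = inv\<^bsub>presented_group S R\<^esub> gen_class S R s"
    using closed by (metis inv_equality)
  moreover have "word_class S R (c # w) =
      word_class S R [c] \<otimes>\<^bsub>presented_group S R\<^esub> word_class S R w"
    using Cons.prems by (simp add: mult_word_class)
  ultimately show ?case using Cons c by auto
qed

lemma eval_word_relation:
  assumes "(a, b) \<in> R" "a \<in> words S" "b \<in> words S"
  shows "eval_word (presented_group S R) (gen_class S R) a =
    eval_word (presented_group S R) (gen_class S R) b"
proof -
  have "word_eq S R a b" using word_eq.relation[of "[]" S "[]" a b R] assms by simp
  then show ?thesis
    using assms by (simp flip: word_class_eq_eval_word add: word_class_eq_iff)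
qed

lemma (in group) eval_word_in_generate:
  assumes "w \<in> words S" "f ` S \<subseteq> K"
  shows "eval_word G f w \<in> generate G K"
  using assms(1)
proof (induction w)
  case (Cons c w)
  then have "f (fst c) \<in> K" using assms(2) by auto
  then have "(if snd c then f (fst c) else inv f (fst c)) \<in> generate G K"
    by (simp add: generate.incl generate.inv)
  then show ?case using Cons by (simp add: generate.eng)
qed (auto intro: generate.one)

lemma generate_gen_class:
  "generate (presented_group S R) (gen_class S R ` S) = carrier (presented_group S R)"
proof
  interpret group "presented_group S R" by (rule group_presented_group)
  show "generate (presented_group S R) (gen_class S R ` S) \<subseteq> carrier (presented_group S R)"
    by (intro generate_incl funcset_image gen_class_carrier)
  show "carrier (presented_group S R) \<subseteq> generate (presented_group S R) (gen_class S R ` S)"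
  proof
    fix A assume "A \<in> carrier (presented_group S R)"
    then obtain w where "w \<in> words S" "A = word_class S R w" by (auto simp: presented_group_def)
    then show "A \<in> generate (presented_group S R) (gen_class S R ` S)"
      using eval_word_in_generate[of w S "gen_class S R"] word_class_eq_eval_word[of w S R] by simp
  qed
qed

section \<open>Normal forms in Baumslag-Solitar groups\<close>

text \<open>
  A pair \<open>([(e\<^sub>1, i\<^sub>1), \<dots>, (e\<^sub>r, i\<^sub>r)], j)\<close> stands for \<open>a\<^sup>j t\<^sup>\<plusminus> a\<^bsup>i\<^sub>1\<^esup> \<dots> t\<^sup>\<plusminus> a\<^bsup>i\<^sub>r\<^esup>\<close>, the signs being
  positive where \<open>e\<^sub>s\<close> is true.  Left multiplication makes the group act on the normalised pairs,
  which proves Britton's lemma.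
\<close>

type_synonym bs_state = "(bool \<times> int) list \<times> int"

locale bs_group = group B for B :: "BS_gen word set monoid" (structure) +
  fixes m n :: int
  assumes m_nonzero: "m \<noteq> 0" and n_nonzero: "n \<noteq> 0"
    and B_eq: "B = BS m n"
begin

text \<open>With this indexing the defining relation reads t^e a^(md e) = a^(md (\<not> e)) t^e for
  both signs e, so that one argument covers t and its inverse.\<close>

definition md :: "bool \<Rightarrow> int" where
  "md e = (if e then m else n)"

lemma md_nonzero [simp]: "md e \<noteq> 0"
  by (simp add: md_def m_nonzero n_nonzero)

text \<open>Left multiplication of a^j L by t^e. The largest multiple of \<open>md e\<close> in j
  passes through t^e and becomes a multiple of \<open>md (\<not> e)\<close>; if nothing remains and
  L starts with the opposite letter, the two letters cancel.\<close>

fun stable_step :: "bool \<Rightarrow> bs_state \<Rightarrow> bs_state" where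
  "stable_step e (L, j) =
    (if j mod md e = 0 \<and> L \<noteq> [] \<and> fst (hd L) = (\<not> e)
     then (tl L, md (\<not> e) * (j div md e) + snd (hd L))
     else ((e, j mod md e) # L, md (\<not> e) * (j div md e)))"

fun letter_act :: "BS_gen \<times> bool \<Rightarrow> bs_state \<Rightarrow> bs_state" where
  "letter_act (BS_a, b) (L, j) = (L, if b then j + 1 else j - 1)"
| "letter_act (BS_t, b) s = stable_step b s"

definition word_act :: "BS_gen word \<Rightarrow> bs_state \<Rightarrow> bs_state" where
  "word_act w s = foldr letter_act w s"

text \<open>The excluded pattern is a pinch t^e a^i t^(-e) with \<open>md e dvd i\<close>. The
  exponents in a reduced list are arbitrary; only \<open>valid_state\<close> asks for coset
  representatives, which make \<open>stable_step\<close> invertible.\<close>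

definition reduced_list :: "(bool \<times> int) list \<Rightarrow> bool" where
  "reduced_list L = successively (\<lambda>c d. \<not> (fst d = (\<not> fst c) \<and> md (fst c) dvd snd c)) L"

definition valid_state :: "bs_state \<Rightarrow> bool" where
  "valid_state s \<longleftrightarrow> reduced_list (fst s) \<and> (\<forall>c \<in> set (fst s). snd c mod md (fst c) = snd c)"

lemma reduced_list_Cons:
  "reduced_list (c # L) \<longleftrightarrow> reduced_list L \<and>
    (L \<noteq> [] \<longrightarrow> \<not> (fst (hd L) = (\<not> fst c) \<and> md (fst c) dvd snd c))"
  unfolding reduced_list_def by (cases L) auto

lemma reduced_list_append:
  "reduced_list (K @ L) \<longleftrightarrow> reduced_list K \<and> reduced_list L \<and>
    (K \<noteq> [] \<and> L \<noteq> [] \<longrightarrow>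
      \<not> (fst (hd L) = (\<not> fst (last K)) \<and> md (fst (last K)) dvd snd (last K)))"
  unfolding reduced_list_def by (auto simp: successively_append_iff)

lemma reduced_list_Nil [simp]: "reduced_list []"
  by (simp add: reduced_list_def)

lemma reduced_list_change_last:
  "reduced_list (K @ [(e, i)]) \<longleftrightarrow> reduced_list (K @ [(e, i')])"
  by (simp add: reduced_list_append reduced_list_Cons)

lemma valid_stable_step: "valid_state s \<Longrightarrow> valid_state (stable_step e s)"
  by (cases s; cases "fst s")
    (auto simp: valid_state_def reduced_list_Cons dvd_eq_mod_eq_0)

lemma stable_step_inverse:
  assumes "valid_state s"
  shows "stable_step (\<not> e) (stable_step e s) = s"
proof -
  obtain L j where s: "s = (L, j)" by (cases s)
  show ?thesis
  proof (cases "j mod md e = 0 \<and> L \<noteq> [] \<and> fst (hd L) = (\<not> e)")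
    case True
    then obtain i L' where L: "L = (\<not> e, i) # L'" by (cases L) auto
    have i: "i mod md (\<not> e) = i" and red: "reduced_list ((\<not> e, i) # L')"
      using assms by (auto simp: valid_state_def s L)
    \<comment> \<open>After the cancellation the opposite step must push the letter back. It would
      cancel once more only if i = 0 were followed by the letter e, which is a pinch.\<close>
    have "\<not> (i = 0 \<and> L' \<noteq> [] \<and> fst (hd L') = e)"
      using red by (auto simp: reduced_list_Cons)
    moreover have "i div md (\<not> e) = 0"
      using i by (metis add.right_neutral div_mult_mod_eq md_nonzero mult_eq_0_iff
          add_right_cancel add_0)
    moreover have "md e * (j div md e) = j" using True by (auto simp: dvd_eq_mod_eq_0[symmetric])
    ultimately show ?thesis using True i by (auto simp: s L)
  next
    case False
    then show ?thesis by (auto simp: s)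
  qed
qed

lemma word_act_simps [simp]:
  "word_act [] s = s" "word_act (c # w) s = letter_act c (word_act w s)"
  "word_act (v @ w) s = word_act v (word_act w s)"
  by (simp_all add: word_act_def)

lemma valid_letter_act: "valid_state s \<Longrightarrow> valid_state (letter_act c s)"
  by (cases c; cases s; cases "fst c") (auto simp: valid_state_def[of "(_, _)"] valid_stable_step simp del: stable_step.simps)

lemma valid_word_act: "valid_state s \<Longrightarrow> valid_state (word_act w s)"
  by (induction w) (auto simp: valid_letter_act)

lemma word_act_gen_pow: "word_act (gen_pow BS_a z) (L, j) = (L, j + z)"
proof -
  have "word_act (replicate k (BS_a, b)) (L, j) = (L, if b then j + int k else j - int k)" for k b
    by (induction k) auto
  then show ?thesis by (simp add: gen_pow_def)
qed

lemma letter_act_inverse: "valid_state s \<Longrightarrow> letter_act (x, b) (letter_act (x, \<not> b) s) = s"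
  using stable_step_inverse[of s "\<not> b"] by (cases x; cases s) auto

lemma word_act_relation:
  assumes "valid_state s"
  shows "word_act ([(BS_t, True)] @ gen_pow BS_a m @ [(BS_t, False)]) s = word_act (gen_pow BS_a n) s"
proof -
  obtain L j where s: "s = (L, j)" by (cases s)
  have shift: "stable_step True (K, i + m) = (fst (stable_step True (K, i)), snd (stable_step True (K, i)) + n)"
    for K i
    using m_nonzero by (simp add: md_def algebra_simps)
  have "word_act ([(BS_t, True)] @ gen_pow BS_a m @ [(BS_t, False)]) s
      = stable_step True (fst (stable_step False s), snd (stable_step False s) + m)"
    using word_act_gen_pow[of m "fst (stable_step False s)" "snd (stable_step False s)"]
    by (simp del: stable_step.simps)
  also have "\<dots> = (L, j + n)"
    using stable_step_inverse[OF assms, of False] by (simp add: shift s del: stable_step.simps)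
  finally show ?thesis by (simp add: s word_act_gen_pow)
qed

definition bs_rel where
  "bs_rel = {([(BS_t, True)] @ gen_pow BS_a m @ [(BS_t, False)], gen_pow BS_a n)}"

lemma words_UNIV [simp]: "w \<in> words UNIV"
  by (simp add: words_def lists_eq_set)

lemma word_act_cong:
  assumes "word_eq UNIV bs_rel v w" "valid_state s"
  shows "word_act v s = word_act w s"
  using assms
proof (induction arbitrary: s rule: word_eq.induct)
  case (cancel u v x b)
  then show ?case using letter_act_inverse[of "word_act v s" x b] by (simp add: valid_word_act)
next
  case (relation u v c d)
  then show ?case using word_act_relation[OF valid_word_act[of s v]] by (auto simp: bs_rel_def)
qed auto

definition cls :: "BS_gen word \<Rightarrow> BS_gen word set" where
  "cls w = word_class UNIV bs_rel w"

lemma B_presented: "B = presented_group UNIV bs_rel"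
  by (simp add: B_eq BS_def bs_rel_def)

lemma cls_mult: "cls v \<otimes> cls w = cls (v @ w)"
  using mult_word_class[of v UNIV w bs_rel] by (simp add: cls_def flip: B_presented)

lemma cls_Nil: "cls [] = \<one>"
  by (subst B_presented) (simp add: cls_def presented_group_def)

lemma carrier_cls: "carrier B = range cls"
proof -
  have "words UNIV = UNIV" by auto
  then show ?thesis by (subst B_presented) (auto simp: cls_def presented_group_def)
qed

lemma cls_closed [simp]: "cls w \<in> carrier B"
  by (simp add: carrier_cls)

definition a where "a = cls [(BS_a, True)]"
definition t where "t = cls [(BS_t, True)]"

definition tp where "tp e = (if e then t else inv t)"

lemma gens_closed [simp, intro]: "a \<in> carrier B" "t \<in> carrier B" "tp e \<in> carrier B"
  by (auto simp: a_def t_def tp_def)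

lemma tp_inverse [simp]: "tp e \<otimes> tp (\<not> e) = \<one>" "tp (\<not> e) \<otimes> tp e = \<one>"
  by (auto simp: tp_def)

lemma cls_eq_eval_word: "cls w = eval_word B (\<lambda>s. cls [(s, True)]) w"
  unfolding cls_def using word_class_eq_eval_word[of w UNIV bs_rel] by (simp flip: B_presented)

lemma generate_gens: "generate B {a, t} = carrier B"
proof -
  have "range (\<lambda>s. cls [(s, True)]) = {a, t}"
  proof -
    have U: "(UNIV :: BS_gen set) = {BS_a, BS_t}" using BS_gen.exhaust by auto
    show ?thesis unfolding U a_def t_def by simp
  qed
  then show ?thesis
    using generate_gen_class[of UNIV bs_rel] by (simp add: cls_def flip: B_presented)
qed

definition nf :: "BS_gen word set \<Rightarrow> bs_state" where
  "nf g = word_act (SOME w. w \<in> g) ([], 0)"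

lemma nf_cls: "nf (cls w) = word_act w ([], 0)"
proof -
  have "w \<in> cls w" by (simp add: cls_def word_class_def word_eq.refl)
  then have "(SOME v. v \<in> cls w) \<in> cls w" by (rule someI)
  then have "word_eq UNIV bs_rel w (SOME v. v \<in> cls w)"
    by (simp add: cls_def word_class_def)
  moreover have "valid_state ([], 0)" by (simp add: valid_state_def)
  ultimately show ?thesis unfolding nf_def by (metis word_act_cong)
qed

lemma a_pow_cls: "a [^] (z :: int) = cls (gen_pow BS_a z)"
  using eval_word_gen_pow[of "\<lambda>s. cls [(s, True)]" BS_a z]
  by (subst cls_eq_eval_word) (simp add: a_def)

lemma tp_cls: "tp e = cls [(BS_t, e)]"
proof (cases e)
  case False
  then show ?thesis by (subst cls_eq_eval_word) (simp add: t_def tp_def)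
qed (simp add: tp_def t_def)

lemma nf_mult_a:
  assumes "g \<in> carrier B"
  shows "nf (a [^] (z :: int) \<otimes> g) = (fst (nf g), snd (nf g) + z)"
proof -
  obtain w where "g = cls w" using assms by (auto simp: carrier_cls)
  then show ?thesis
    using word_act_gen_pow[of z "fst (nf g)" "snd (nf g)"]
    by (simp add: a_pow_cls cls_mult nf_cls)
qed

lemma nf_mult_t:
  assumes "g \<in> carrier B"
  shows "nf (tp e \<otimes> g) = stable_step e (nf g)"
proof -
  obtain w where "g = cls w" using assms by (auto simp: carrier_cls)
  then show ?thesis
    by (simp add: tp_cls cls_mult nf_cls del: stable_step.simps)
qed

lemma nf_one: "nf \<one> = ([], 0)"
  using nf_cls[of "[]"] by (simp add: cls_Nil)

lemma valid_nf: "g \<in> carrier B \<Longrightarrow> valid_state (nf g)"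
  by (auto simp: carrier_cls nf_cls intro!: valid_word_act) (simp add: valid_state_def)

lemma relation_a_t: "t \<otimes> a [^] m \<otimes> inv t = a [^] n"
proof -
  have "cls ([(BS_t, True)] @ gen_pow BS_a m @ [(BS_t, False)]) = cls (gen_pow BS_a n)"
    using word_eq.relation[of "[]" UNIV "[]" _ _ bs_rel] unfolding cls_def
    by (subst word_class_eq_iff) (auto simp: bs_rel_def)
  moreover have "cls ([(BS_t, True)] @ gen_pow BS_a m @ [(BS_t, False)]) =
      tp True \<otimes> (a [^] m \<otimes> tp False)"
    by (simp add: tp_cls a_pow_cls cls_mult)
  ultimately show ?thesis by (simp add: a_pow_cls tp_def m_assoc)
qed

lemma tp_a_pow: "tp e \<otimes> a [^] (md e * c) = a [^] (md (\<not> e) * c) \<otimes> tp e"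
proof -
  have t: "t \<otimes> a [^] (m * c) = a [^] (n * c) \<otimes> t" for c
  proof -
    have "(t \<otimes> a [^] m \<otimes> inv t) [^] c = t \<otimes> (a [^] m) [^] c \<otimes> inv t"
      by (simp add: int_pow_conjugate)
    then have "a [^] (n * c) = t \<otimes> a [^] (m * c) \<otimes> inv t"
      by (simp add: relation_a_t int_pow_pow)
    then show ?thesis by (simp add: m_assoc)
  qed
  show ?thesis
  proof (cases e)
    case False
    have "a [^] (m * c) \<otimes> inv t = inv t \<otimes> (t \<otimes> a [^] (m * c)) \<otimes> inv t"
      by (simp add: m_assoc[symmetric])
    also have "\<dots> = inv t \<otimes> a [^] (n * c)" by (simp add: t m_assoc)
    finally show ?thesis using False by (simp add: tp_def md_def)
  qed (simp add: tp_def md_def t)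
qed

section \<open>Britton's lemma and the length of an element\<close>

primrec list_elt :: "(bool \<times> int) list \<Rightarrow> BS_gen word set" where
  "list_elt [] = \<one>"
| "list_elt (c # L) = tp (fst c) \<otimes> a [^] snd c \<otimes> list_elt L"

lemma list_elt_closed [simp]: "list_elt L \<in> carrier B"
  by (induction L) auto

lemma list_elt_append: "list_elt (K @ L) = list_elt K \<otimes> list_elt L"
  by (induction K) (auto simp: m_assoc)

lemma list_elt_shift_last: "list_elt (K @ [(e, i)]) \<otimes> a [^] z = list_elt (K @ [(e, i + z)])"
  by (simp add: list_elt_append m_assoc int_pow_mult)

lemma stable_step_elt:
  "tp e \<otimes> (a [^] snd s \<otimes> list_elt (fst s)) =
    a [^] snd (stable_step e s) \<otimes> list_elt (fst (stable_step e s))"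
proof -
  obtain L j where s: "s = (L, j)" by (cases s)
  have "a [^] j = a [^] (md e * (j div md e)) \<otimes> a [^] (j mod md e)"
    by (simp flip: int_pow_mult)
  then have step: "tp e \<otimes> (a [^] j \<otimes> x) =
      a [^] (md (\<not> e) * (j div md e)) \<otimes> (tp e \<otimes> (a [^] (j mod md e) \<otimes> x))"
    if "x \<in> carrier B" for x
    using that by (simp add: tp_a_pow m_assoc[symmetric])
  show ?thesis
  proof (cases "j mod md e = 0 \<and> L \<noteq> [] \<and> fst (hd L) = (\<not> e)")
    case True
    then obtain i L' where L: "L = (\<not> e, i) # L'" by (cases L) auto
    have "tp e \<otimes> (tp (\<not> e) \<otimes> (a [^] i \<otimes> list_elt L')) = a [^] i \<otimes> list_elt L'"
      by (simp add: m_assoc[symmetric])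
    then show ?thesis using True
      by (simp add: s step) (simp add: L m_assoc int_pow_mult)
  next
    case False
    then have "stable_step e s = ((e, j mod md e) # L, md (\<not> e) * (j div md e))"
      unfolding s stable_step.simps by (rule if_not_P)
    then show ?thesis by (simp add: s step) (simp add: m_assoc)
  qed
qed

lemma elt_nf:
  assumes "g \<in> carrier B"
  shows "g = a [^] snd (nf g) \<otimes> list_elt (fst (nf g))"
proof -
  have "cls w =
      a [^] snd (word_act w ([], 0)) \<otimes> list_elt (fst (word_act w ([], 0)))" for w
  proof (induction w)
    case Nil
    then show ?case by (simp add: cls_Nil)
  next
    case (Cons c w)
    obtain x b where c: "c = (x, b)" by (cases c)
    have split: "cls (c # w) = cls [c] \<otimes> cls w"
      by (simp add: cls_mult)
    show ?case
    proof (cases x)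
      case BS_t
      then show ?thesis
        unfolding split by (simp add: c Cons.IH stable_step_elt flip: tp_cls del: stable_step.simps)
    next
      case BS_a
      have "cls [c] = a [^] (if b then 1 else - 1 :: int)"
        by (simp add: a_pow_cls c BS_a gen_pow_def)
      moreover obtain L j where "word_act w ([], 0) = (L, j)" by (cases "word_act w ([], 0)")
      ultimately show ?thesis
        unfolding split by (simp add: c BS_a Cons.IH m_assoc[symmetric] add.commute flip: int_pow_mult)
    qed
  qed
  moreover obtain w where "g = cls w" using assms by (auto simp: carrier_cls)
  ultimately show ?thesis by (metis nf_cls)
qed

lemma reduced_nf: "g \<in> carrier B \<Longrightarrow> reduced_list (fst (nf g))"
  using valid_nf by (simp add: valid_state_def)

text \<open>Britton's lemma. The divisibility of the leading exponent carries the induction: where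
  the next letter could cancel, the exponent in between changes only by a multiple of the modulus
  that decides about a pinch, so a reduced list creates no cancellation.\<close>

lemma nf_list_elt:
  assumes "reduced_list L"
  shows "length (fst (nf (list_elt L))) = length L \<and>
    (L \<noteq> [] \<longrightarrow> fst (hd (fst (nf (list_elt L)))) = fst (hd L) \<and>
      md (\<not> fst (hd L)) dvd snd (nf (list_elt L)))"
  using assms
proof (induction L)
  case Nil
  then show ?case by (simp add: nf_one)
next
  case (Cons c L)
  obtain e i where c: "c = (e, i)" by (cases c)
  obtain L' j where nfL: "nf (list_elt L) = (L', j)" by (cases "nf (list_elt L)")
  have IH: "length L' = length L" "L \<noteq> [] \<Longrightarrow> fst (hd L') = fst (hd L)"
    "L \<noteq> [] \<Longrightarrow> md (\<not> fst (hd L)) dvd j"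
    using Cons by (auto simp: nfL reduced_list_Cons)
  have nf: "nf (list_elt (c # L)) = stable_step e (L', j + i)"
    by (simp add: c m_assoc nf_mult_t nf_mult_a nfL del: stable_step.simps)
  have "\<not> ((j + i) mod md e = 0 \<and> L' \<noteq> [] \<and> fst (hd L') = (\<not> e))"
  proof
    assume *: "(j + i) mod md e = 0 \<and> L' \<noteq> [] \<and> fst (hd L') = (\<not> e)"
    then have "L \<noteq> []" using IH(1) by auto
    then have "fst (hd L) = (\<not> e)" "md e dvd j" using * IH by auto
    moreover from this * have "md e dvd i"
      by (metis dvd_add_right_iff mod_0_imp_dvd)
    ultimately show False using Cons.prems \<open>L \<noteq> []\<close> by (simp add: c reduced_list_Cons)
  qed
  then show ?case unfolding nf by (auto simp: c IH)
qed

definition len :: "BS_gen word set \<Rightarrow> nat" where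
  "len g = length (fst (nf g))"

lemma len_reduced:
  assumes "reduced_list L"
  shows "len (a [^] (i :: int) \<otimes> list_elt L) = length L" "len (list_elt L) = length L"
  using nf_list_elt[OF assms] by (simp_all add: len_def nf_mult_a)

text \<open>A power of a on the right changes only the last exponent, which is not followed by a
  letter and thus takes no part in any pinch.\<close>

lemma len_reduced_a:
  assumes "reduced_list L"
  shows "len (a [^] (i :: int) \<otimes> list_elt L \<otimes> a [^] (j :: int)) = length L"
proof (cases L rule: rev_cases)
  case Nil
  then show ?thesis using len_reduced(1)[of "[]" "i + j"] by (simp add: int_pow_mult)
next
  case (snoc K c)
  then show ?thesis
    using len_reduced(1)[of "K @ [(fst c, snd c + j)]" i] assms
      reduced_list_change_last[of K "fst c" "snd c" "snd c + j"]
    by (simp add: m_assoc list_elt_shift_last[of K "fst c" "snd c" j, simplified])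
qed

lemma t_not_power: "t \<noteq> a [^] (z :: int)"
proof
  assume "t = a [^] z"
  then have "list_elt [(True, 0)] = a [^] z \<otimes> list_elt []" by (simp add: tp_def)
  moreover have "reduced_list [(True, 0)]" by (simp add: reduced_list_Cons)
  ultimately show False using len_reduced(2)[of "[(True, 0)]"] len_reduced(1)[of "[]" z] by simp
qed

lemma a_pow_inject: "a [^] (i :: int) = a [^] (j :: int) \<longleftrightarrow> i = j"
proof
  assume "a [^] i = a [^] j"
  then have "nf (a [^] i \<otimes> \<one>) = nf (a [^] j \<otimes> \<one>)" by simp
  then show "i = j" by (simp only: nf_mult_a one_closed nf_one) simp
qed simp

text \<open>
  An element of \<open>\<langle>a\<rangle>\<close> that fixes a second vertex of the Bass-Serre tree fixes an edge at the base
  vertex.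
\<close>

lemma a_pow_conj_dvd:
  assumes "g \<in> carrier B" "a [^] (e :: int) \<otimes> g = g \<otimes> a [^] (f :: int)"
    and "\<And>z :: int. g \<noteq> a [^] z"
  shows "m dvd e \<or> n dvd e"
proof -
  obtain L j where nfg: "nf g = (L, j)" by (cases "nf g")
  have g: "g = a [^] j \<otimes> list_elt L" and red: "reduced_list L"
    using elt_nf[OF assms(1)] reduced_nf[OF assms(1)] unfolding nfg by simp_all
  have "L \<noteq> []" using g assms(3)[of j] by auto
  then obtain K e' i where L: "L = K @ [(e', i)]" by (metis rev_exhaust surj_pair)
  have "a [^] j \<otimes> (a [^] e \<otimes> list_elt L) = a [^] e \<otimes> g"
    by (simp add: g m_assoc[symmetric] add.commute flip: int_pow_mult)
  also have "\<dots> = a [^] j \<otimes> (list_elt L \<otimes> a [^] f)"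
    by (simp add: assms(2)) (simp add: g m_assoc)
  finally have "a [^] e \<otimes> list_elt L = list_elt (K @ [(e', i + f)])"
    by (simp add: L list_elt_shift_last)
  then have eq: "snd (nf (list_elt L)) + e = snd (nf (list_elt (K @ [(e', i + f)])))"
    by (metis list_elt_closed nf_mult_a snd_conv)
  have "reduced_list (K @ [(e', i + f)])"
    using red by (simp add: L reduced_list_change_last[of K e' i "i + f"])
  moreover have "fst (hd (K @ [(e', i + f)])) = fst (hd L)" by (cases K) (simp_all add: L)
  ultimately have "md (\<not> fst (hd L)) dvd snd (nf (list_elt L)) + e"
    using nf_list_elt[of "K @ [(e', i + f)]"] by (simp add: eq)
  moreover have "md (\<not> fst (hd L)) dvd snd (nf (list_elt L))"
    using nf_list_elt[OF red] \<open>L \<noteq> []\<close> by simp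
  ultimately have "md (\<not> fst (hd L)) dvd e" by (metis dvd_add_right_iff)
  then show ?thesis by (auto simp: md_def split: if_splits)
qed

section \<open>Elements commensurated by the whole group\<close>

lemma inv_tp: "inv (tp e) = tp (\<not> e)"
  by (simp add: tp_def)

lemma list_elt_replicate:
  "list_elt (concat (replicate N P)) = list_elt P [^] (N :: nat)"
proof (induction N)
  case (Suc N)
  then show ?case using nat_pow_Suc2[of "list_elt P" N] by (simp add: list_elt_append del: nat_pow_Suc)
qed simp

text \<open>A pinch at the seam between two copies of P would involve the last and the first letter
  of P. Conjugation by the last stable letter would then cancel both and shorten P by two.\<close>

lemma minimal_cyclically_reduced:
  assumes "reduced_list P" "P \<noteq> []"
    and min: "\<And>w. w \<in> carrier B \<Longrightarrow> length P \<le> len (w \<otimes> list_elt P \<otimes> inv w)"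
  shows "reduced_list (concat (replicate N P))"
proof -
  obtain e1 i1 where hd: "hd P = (e1, i1)" by (cases "hd P")
  obtain er ir where last: "last P = (er, ir)" by (cases "last P")
  have cyc: "\<not> (e1 = (\<not> er) \<and> md er dvd ir)"
  proof
    assume *: "e1 = (\<not> er) \<and> md er dvd ir"
    obtain R where R: "P = (e1, i1) # R" using assms(2) hd by (cases P) auto
    then have "R \<noteq> []" using last * by auto
    then have "R = butlast R @ [(er, ir)]" using last R by (metis append_butlast_last_id last_ConsR)
    then obtain M where M: "P = (e1, i1) # M @ [(er, ir)]" using R by metis
    have redM: "reduced_list M"
      using assms(1) by (simp add: M reduced_list_Cons reduced_list_append)
    obtain c where c: "ir = md er * c" using * by auto
    have "tp er \<otimes> list_elt P \<otimes> inv (tp er) =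
        (tp er \<otimes> tp e1) \<otimes> a [^] i1 \<otimes> list_elt M \<otimes> (tp er \<otimes> a [^] ir) \<otimes> tp e1"
      using * by (simp add: M list_elt_append m_assoc inv_tp del: tp_inverse)
    also have "\<dots> = a [^] i1 \<otimes> list_elt M \<otimes> (a [^] (md (\<not> er) * c) \<otimes> (tp er \<otimes> tp e1))"
      using * by (simp add: c tp_a_pow m_assoc)
    also have "\<dots> = a [^] i1 \<otimes> list_elt M \<otimes> a [^] (md (\<not> er) * c)"
      using * by simp
    finally have "len (tp er \<otimes> list_elt P \<otimes> inv (tp er)) = length M"
      using redM by (simp add: len_reduced_a)
    then show False using min[of "tp er"] by (simp add: M)
  qed
  show ?thesis
  proof (induction N)
    case (Suc N)
    have "hd (concat (replicate N P)) = hd P" if "concat (replicate N P) \<noteq> []"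
      using that assms(2) by (cases N) auto
    then show ?case
      using Suc assms(1) cyc by (auto simp: reduced_list_append hd last)
  qed simp
qed

text \<open>A shortest conjugate P that is not a power of a has powers of length N |P|. A suitable
  conjugate of P^N is reduced as written and has length N |P| + 4. If g carries P^(A s) to P^(C s)
  for all s, the constant 4 is a contradiction.\<close>

lemma commensurating_imp_elliptic:
  assumes z: "z \<in> carrier B" and "\<not> is_unit m" "\<not> is_unit n"
    and comm: "\<And>g. g \<in> carrier B \<Longrightarrow>
      \<exists>(N :: int) (M :: int). N \<noteq> 0 \<and> M \<noteq> 0 \<and> g \<otimes> z [^] N \<otimes> inv g = z [^] M"
  shows "\<exists>h \<in> carrier B. \<exists>e :: int. z = h \<otimes> a [^] e \<otimes> inv h"
proof (rule ccontr)
  assume not_ell: "\<not> ?thesis"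
  obtain h where h: "h \<in> carrier B"
    and min: "\<And>h'. h' \<in> carrier B \<Longrightarrow> len (h \<otimes> z \<otimes> inv h) \<le> len (h' \<otimes> z \<otimes> inv h')"
    using ex_has_least_nat[of "\<lambda>h. h \<in> carrier B" \<one> "\<lambda>h. len (h \<otimes> z \<otimes> inv h)"] by auto
  define y where "y = h \<otimes> z \<otimes> inv h"
  have yc: "y \<in> carrier B" using h z by (simp add: y_def)
  obtain L j where nfy: "nf y = (L, j)" by (cases "nf y")
  have y: "y = a [^] j \<otimes> list_elt L" and redL: "reduced_list L"
    using elt_nf[OF yc] reduced_nf[OF yc] unfolding nfy by simp_all
  have "L \<noteq> []"
  proof
    assume "L = []"
    then have "z = inv h \<otimes> a [^] j \<otimes> inv (inv h)"
      using y h z by (simp add: y_def m_assoc) (metis inv_solve_left inv_solve_right m_assoc m_closed inv_closed)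
    then show False using not_ell h by blast
  qed
  then obtain K er ir where L: "L = K @ [(er, ir)]" by (metis rev_exhaust surj_pair)
  \<comment> \<open>The leading power of a is moved cyclically to the end, so that P is a bare list
    whose powers are obtained by concatenation.\<close>
  define P where "P = K @ [(er, ir + j)]"
  have redP: "reduced_list P" using redL reduced_list_change_last by (simp add: L P_def) blast
  define c where "c = inv (a [^] j) \<otimes> h"
  have c: "c \<in> carrier B" using h by (simp add: c_def)
  have P: "list_elt P = c \<otimes> z \<otimes> inv c"
  proof -
    have "c \<otimes> z \<otimes> inv c = inv (a [^] j) \<otimes> y \<otimes> a [^] j"
      using h z by (simp add: c_def y_def m_assoc inv_mult_group)
    also have "\<dots> = list_elt L \<otimes> a [^] j" by (simp add: y m_assoc[symmetric])
    finally show ?thesis by (simp add: L P_def list_elt_shift_last)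
  qed
  have min_P: "length P \<le> len (w \<otimes> list_elt P \<otimes> inv w)" if w: "w \<in> carrier B" for w
  proof -
    have "length P = len y" using len_reduced(1)[OF redL, of j] by (simp add: y L P_def)
    also have "\<dots> \<le> len ((w \<otimes> c) \<otimes> z \<otimes> inv (w \<otimes> c))" using min w c by (simp add: y_def)
    also have "(w \<otimes> c) \<otimes> z \<otimes> inv (w \<otimes> c) = w \<otimes> list_elt P \<otimes> inv w"
      using w c z by (simp add: P m_assoc inv_mult_group)
    finally show ?thesis .
  qed
  have P_ne: "P \<noteq> []" by (simp add: P_def)
  have red_rep: "reduced_list (concat (replicate N P))" for N
    using minimal_cyclically_reduced[OF redP P_ne min_P] by simp
  define p where "p = list_elt P"
  have pc: "p \<in> carrier B" by (simp add: p_def)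
  \<comment> \<open>Conjugating twice replaces the exponents N and M, whose signs are unknown, by
    their squares. These are positive, so natural powers and their lengths can be compared.\<close>
  have squares: "\<exists>(A :: nat) (C :: nat). A > 0 \<and> (\<forall>s :: nat.
      (g \<otimes> g) \<otimes> p [^] (A * s) \<otimes> inv (g \<otimes> g) = p [^] (C * s))"
    if g: "g \<in> carrier B" for g
  proof -
    have "inv c \<otimes> g \<otimes> c \<in> carrier B" using g c by simp
    from comm[OF this] obtain N M :: int where NM: "N \<noteq> 0" "M \<noteq> 0"
      and eq: "(inv c \<otimes> g \<otimes> c) \<otimes> z [^] N \<otimes> inv (inv c \<otimes> g \<otimes> c) = z [^] M"
      by blast
    have pp: "p [^] i = c \<otimes> z [^] i \<otimes> inv c" for i :: int
      unfolding p_def P using c z by (rule int_pow_conjugate)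
    have "g \<otimes> p [^] N \<otimes> inv g =
        c \<otimes> ((inv c \<otimes> g \<otimes> c) \<otimes> z [^] N \<otimes> inv (inv c \<otimes> g \<otimes> c)) \<otimes> inv c"
      using g c z by (simp add: pp inv_mult_group m_assoc) (simp add: m_assoc[symmetric])
    then have conj: "g \<otimes> p [^] N \<otimes> inv g = p [^] M" by (simp add: eq pp)
    have conj_mult: "g \<otimes> p [^] (N * i) \<otimes> inv g = p [^] (M * i)" for i :: int
      using int_pow_conjugate[OF g, of "p [^] N" i] conj pc by (simp add: int_pow_pow)
    have "(g \<otimes> g) \<otimes> p [^] (N * N * i) \<otimes> inv (g \<otimes> g) = p [^] (M * M * i)" for i :: int
    proof -
      have "(g \<otimes> g) \<otimes> p [^] (N * N * i) \<otimes> inv (g \<otimes> g) =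
          g \<otimes> (g \<otimes> p [^] (N * (N * i)) \<otimes> inv g) \<otimes> inv g"
        using g pc by (simp add: inv_mult_group m_assoc mult.assoc)
      also have "\<dots> = g \<otimes> p [^] (N * (M * i)) \<otimes> inv g"
        by (subst conj_mult) (simp only: mult.left_commute[of M N])
      finally show ?thesis by (simp add: conj_mult mult.assoc)
    qed
    from this[of "int s" for s]
    have "(g \<otimes> g) \<otimes> p [^] (nat (N * N) * s) \<otimes> inv (g \<otimes> g) = p [^] (nat (M * M) * s)" for s
      by (simp add: int_pow_int[symmetric])
    moreover have "nat (N * N) > 0" using NM by (auto simp: zero_less_mult_iff)
    ultimately show ?thesis by blast
  qed
  define i where "i = ir + j"
  \<comment> \<open>The inverse of g is a^(-1) t^er, so on the right only equal signs follow each
    other. On the left the exponents are 1, which no nonunit modulus divides. Hence no pinch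
    arises.\<close>
  define g where "g = tp (\<not> er) \<otimes> a"
  have gc: "g \<in> carrier B" by (simp add: g_def)
  have length_conj: "len ((g \<otimes> g) \<otimes> p [^] N \<otimes> inv (g \<otimes> g)) = N * length P + 4" if "N > 0" for N :: nat
  proof -
    define R where "R = concat (replicate (N - 1) P) @ K"
    define R' where "R' = [(\<not> er, 1), (\<not> er, 1)] @ R @ [(er, i - 1), (er, - 1), (er, 0)]"
    have rep: "concat (replicate N P) = R @ [(er, i)]"
      using that by (cases N) (simp_all add: R_def P_def i_def flip: replicate_append_same)
    have inv_g: "inv (g \<otimes> g) = a [^] (- 1 :: int) \<otimes> tp er \<otimes> a [^] (- 1 :: int) \<otimes> tp er"
      by (simp add: g_def inv_mult_group inv_tp m_assoc int_pow_neg)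
    have "(g \<otimes> g) \<otimes> p [^] N \<otimes> inv (g \<otimes> g) =
        (g \<otimes> g) \<otimes> (list_elt (R @ [(er, i)]) \<otimes> a [^] (- 1 :: int)) \<otimes>
          (tp er \<otimes> a [^] (- 1 :: int) \<otimes> tp er)"
      unfolding inv_g p_def list_elt_replicate[symmetric] rep using gc by (simp add: m_assoc)
    also have "\<dots> = list_elt R'"
      unfolding list_elt_shift_last by (simp add: R'_def list_elt_append g_def m_assoc)
    finally have "(g \<otimes> g) \<otimes> p [^] N \<otimes> inv (g \<otimes> g) = list_elt R'" .
    moreover have "reduced_list R'"
    proof -
      have "reduced_list (R @ [(er, i - 1)])"
        using red_rep[of N] reduced_list_change_last unfolding rep by blast
      moreover have "\<not> md e dvd 1" for e using assms(2,3) by (simp add: md_def)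
      ultimately show ?thesis
        unfolding R'_def by (auto simp: reduced_list_append reduced_list_Cons)
    qed
    moreover have "length R' = N * length P + 4"
      using arg_cong[OF rep, of length] by (simp add: R'_def length_concat sum_list_replicate)
    ultimately show ?thesis by (simp add: len_reduced)
  qed
  have length_pow: "len (p [^] N) = N * length P" for N :: nat
    using len_reduced(2)[OF red_rep[of N]]
    by (simp add: p_def list_elt_replicate length_concat sum_list_replicate)
  obtain A C :: nat where AC: "A > 0"
    "\<And>s. (g \<otimes> g) \<otimes> p [^] (A * s) \<otimes> inv (g \<otimes> g) = p [^] (C * s)"
    using squares[OF gc] by blast
  have "A * s * length P + 4 = C * s * length P" if "s > 0" for s
    using length_conj[of "A * s"] AC that by (simp add: length_pow)
  \<comment> \<open>Passing from s = 1 to s = 2 doubles the multiples of \<open>length P\<close> but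
    not the 4.\<close>
  from this[of 1] this[of 2] show False by simp
qed

end

section \<open>Homomorphisms out of the group of a lollipop\<close>

abbreviation gbs_gen where
  "gbs_gen \<Gamma> rv lab T \<equiv>
    gen_class (Vertex ` verts \<Gamma> \<union> Stable ` arcs \<Gamma>) (GBS_rels \<Gamma> rv lab T)"

lemma (in group) hom_from_GBS_group:
  assumes "wf_digraph \<Gamma>" and "rv ` arcs \<Gamma> \<subseteq> arcs \<Gamma>" and "arcs T \<subseteq> arcs \<Gamma>"
    and V: "V \<in> verts \<Gamma> \<rightarrow> carrier G" and s: "s \<in> arcs \<Gamma> \<rightarrow> carrier G"
    and edge: "\<And>e. e \<in> arcs \<Gamma> \<Longrightarrow>
      s e \<otimes> V (head \<Gamma> e) [^] lab (rv e) \<otimes> inv s e = V (tail \<Gamma> e) [^] lab e"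
    and rev: "\<And>e. e \<in> arcs \<Gamma> \<Longrightarrow> s e \<otimes> s (rv e) = \<one>"
    and tree: "\<And>e. e \<in> arcs T \<Longrightarrow> s e = \<one>"
  shows "\<exists>\<phi> \<in> hom (GBS_group \<Gamma> rv lab T) G.
    (\<forall>v \<in> verts \<Gamma>. \<phi> (gbs_gen \<Gamma> rv lab T (Vertex v)) = V v) \<and>
    (\<forall>e \<in> arcs \<Gamma>. \<phi> (gbs_gen \<Gamma> rv lab T (Stable e)) = s e)"
proof -
  define F where "F c = (case c of Vertex v \<Rightarrow> V v | Stable e \<Rightarrow> s e)" for c
  define S where "S = Vertex ` verts \<Gamma> \<union> Stable ` arcs \<Gamma>"
  have F: "F \<in> S \<rightarrow> carrier G" using V s by (auto simp: F_def S_def)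
  have rels: "eval_word G F v = eval_word G F w" if "(v, w) \<in> GBS_rels \<Gamma> rv lab T" for v w
  proof -
    have ends: "head \<Gamma> e \<in> verts \<Gamma>" "tail \<Gamma> e \<in> verts \<Gamma>" if "e \<in> arcs \<Gamma>" for e
      using that assms(1) by (auto simp: wf_digraph_def)
    from that consider e where "e \<in> arcs \<Gamma>"
        "v = [(Stable e, True)] @ gen_pow (Vertex (head \<Gamma> e)) (lab (rv e)) @ [(Stable e, False)]"
        "w = gen_pow (Vertex (tail \<Gamma> e)) (lab e)"
      | e where "e \<in> arcs \<Gamma>" "v = [(Stable e, True), (Stable (rv e), True)]" "w = []"
      | e where "e \<in> arcs T" "v = [(Stable e, True)]" "w = []"
      unfolding GBS_rels_def by blast
    then show ?thesis
    proof cases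
      case 1
      have "F (Vertex (head \<Gamma> e)) \<in> carrier G" "F (Vertex (tail \<Gamma> e)) \<in> carrier G" "s e \<in> carrier G"
        using F s ends[OF 1(1)] 1(1) by (auto simp: S_def)
      moreover have "gen_pow (Vertex (head \<Gamma> e)) (lab (rv e)) \<in> words S" "[(Stable e, False)] \<in> words S"
        using ends[OF 1(1)] 1(1) by (auto simp: S_def)
      ultimately show ?thesis using edge[OF 1(1)]
        unfolding 1(2,3) append_Cons append_Nil eval_word.simps
        by (simp add: eval_word_append[OF F] eval_word_gen_pow m_assoc) (simp add: F_def m_assoc)
    next
      case 2
      then have "s e \<in> carrier G" "s (rv e) \<in> carrier G" using s assms(2) by auto
      then show ?thesis using rev[OF 2(1)] 2 by (simp add: F_def)
    next
      case 3
      then show ?thesis using tree[OF 3(1)] by (simp add: F_def)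
    qed
  qed
  obtain \<phi> where \<phi>: "\<phi> \<in> hom (presented_group S (GBS_rels \<Gamma> rv lab T)) G"
    "\<forall>w \<in> words S. \<phi> (word_class S (GBS_rels \<Gamma> rv lab T) w) = eval_word G F w"
    using hom_from_presented_group[OF F, of "GBS_rels \<Gamma> rv lab T"] rels by blast
  have "\<phi> (gen_class S (GBS_rels \<Gamma> rv lab T) c) = F c" if "c \<in> S" for c
    using \<phi>(2) F that by (auto simp: Pi_iff)
  then show ?thesis using \<phi>(1)
    by (intro bexI[of _ \<phi>]) (auto simp: GBS_group_def S_def F_def)
qed

lemma GBS_group_hom_relations:
  fixes H (structure)
  assumes "wf_digraph \<Gamma>" and "rv ` arcs \<Gamma> \<subseteq> arcs \<Gamma>" and "arcs T \<subseteq> arcs \<Gamma>" and "group H"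
    and \<phi>: "\<phi> \<in> hom (GBS_group \<Gamma> rv lab T) H"
    and V: "V = (\<lambda>v. \<phi> (gbs_gen \<Gamma> rv lab T (Vertex v)))"
    and s: "s = (\<lambda>e. \<phi> (gbs_gen \<Gamma> rv lab T (Stable e)))"
  shows "V \<in> verts \<Gamma> \<rightarrow> carrier H" "s \<in> arcs \<Gamma> \<rightarrow> carrier H"
    and "e \<in> arcs \<Gamma> \<Longrightarrow>
      s e \<otimes> V (head \<Gamma> e) [^] lab (rv e) \<otimes> inv s e = V (tail \<Gamma> e) [^] lab e"
    and "e \<in> arcs T \<Longrightarrow> s e = \<one>"
    and "e \<in> arcs \<Gamma> \<Longrightarrow> s e \<otimes> s (rv e) = \<one>"
    and "\<phi> ` carrier (GBS_group \<Gamma> rv lab T) = generate H (V ` verts \<Gamma> \<union> s ` arcs \<Gamma>)"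
proof -
  define S where "S = Vertex ` verts \<Gamma> \<union> Stable ` arcs \<Gamma>"
  define R where "R = GBS_rels \<Gamma> rv lab T"
  define P where "P = presented_group S R"
  define F where "F = \<phi> \<circ> gen_class S R"
  interpret H: group H by fact
  have P: "group P" unfolding P_def by (rule group_presented_group)
  have \<phi>P: "\<phi> \<in> hom P H" using \<phi> by (simp add: GBS_group_def P_def S_def R_def)
  have F: "F \<in> S \<rightarrow> carrier H"
    using gen_class_carrier[of S R] \<phi>P unfolding F_def P_def hom_def by auto
  have VF: "V v = F (Vertex v)" and sF: "s e = F (Stable e)" for v e
    by (simp_all add: V s F_def S_def R_def)
  show Vc: "V \<in> verts \<Gamma> \<rightarrow> carrier H" and sc: "s \<in> arcs \<Gamma> \<rightarrow> carrier H"
    using F by (auto simp: VF sF S_def)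
  have rel: "eval_word H F v = eval_word H F w"
    if "(v, w) \<in> R" "v \<in> words S" "w \<in> words S" for v w
  proof -
    have "\<phi> (eval_word P (gen_class S R) v) = \<phi> (eval_word P (gen_class S R) w)"
      using eval_word_relation[OF that] by (simp add: P_def)
    then show ?thesis
      using hom_eval_word[OF P \<open>group H\<close> \<phi>P gen_class_carrier[of S R, folded P_def] that(2)]
        hom_eval_word[OF P \<open>group H\<close> \<phi>P gen_class_carrier[of S R, folded P_def] that(3)]
      by (simp add: F_def)
  qed
  show "s e \<otimes> V (head \<Gamma> e) [^] lab (rv e) \<otimes> inv s e = V (tail \<Gamma> e) [^] lab e"
    if e: "e \<in> arcs \<Gamma>"
  proof -
    have ends: "head \<Gamma> e \<in> verts \<Gamma>" "tail \<Gamma> e \<in> verts \<Gamma>"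
      using e assms(1) by (auto simp: wf_digraph_def)
    have c: "F (Vertex (head \<Gamma> e)) \<in> carrier H" "F (Vertex (tail \<Gamma> e)) \<in> carrier H"
      "F (Stable e) \<in> carrier H"
      using F ends e by (auto simp: S_def)
    have w: "gen_pow (Vertex (head \<Gamma> e)) (lab (rv e)) \<in> words S" "[(Stable e, False)] \<in> words S"
      "gen_pow (Vertex (tail \<Gamma> e)) (lab e) \<in> words S"
      using ends e by (auto simp: S_def)
    have "eval_word H F ((Stable e, True) # gen_pow (Vertex (head \<Gamma> e)) (lab (rv e)) @ [(Stable e, False)])
        = eval_word H F (gen_pow (Vertex (tail \<Gamma> e)) (lab e))"
    proof (rule rel)
      show "((Stable e, True) # gen_pow (Vertex (head \<Gamma> e)) (lab (rv e)) @ [(Stable e, False)],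
        gen_pow (Vertex (tail \<Gamma> e)) (lab e)) \<in> R"
        using e by (auto simp: R_def GBS_rels_def)
    qed (use w e in \<open>auto simp: S_def\<close>)
    then show ?thesis using c
      by (simp add: H.eval_word_append[OF F w(1,2)] H.eval_word_gen_pow H.m_assoc VF sF)
  qed
  show "s e = \<one>" if e: "e \<in> arcs T"
  proof -
    have "eval_word H F [(Stable e, True)] = eval_word H F []"
      using e assms(3) by (intro rel) (auto simp: R_def GBS_rels_def S_def)
    moreover have "F (Stable e) \<in> carrier H" using sc e assms(3) by (auto simp: sF Pi_iff)
    ultimately show ?thesis by (simp add: sF)
  qed
  show "s e \<otimes> s (rv e) = \<one>" if e: "e \<in> arcs \<Gamma>"
  proof -
    have "eval_word H F [(Stable e, True), (Stable (rv e), True)] = eval_word H F []"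
      using e assms(2) by (intro rel) (auto simp: R_def GBS_rels_def S_def)
    moreover have "F (Stable e) \<in> carrier H" "F (Stable (rv e)) \<in> carrier H"
      using sc e assms(2) by (auto simp: sF Pi_iff)
    ultimately show ?thesis by (simp add: sF)
  qed
  interpret group_hom P H \<phi>
    using P \<phi>P by (simp add: group_hom_def group_hom_axioms_def H.is_group)
  have "\<phi> ` carrier P = generate H (\<phi> ` (gen_class S R ` S))"
    using generate_img[of "gen_class S R ` S"] gen_class_carrier[of S R] generate_gen_class[of S R]
    by (auto simp: P_def)
  also have "\<phi> ` (gen_class S R ` S) = V ` verts \<Gamma> \<union> s ` arcs \<Gamma>"
    by (simp add: image_Un image_image V s S_def R_def)
  finally show "\<phi> ` carrier (GBS_group \<Gamma> rv lab T) = generate H (V ` verts \<Gamma> \<union> s ` arcs \<Gamma>)"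
    by (simp add: GBS_group_def P_def S_def R_def)
qed

text \<open>
  The images of the vertex generators, transported along the path \<open>v\<^sub>0, \<dots>, v\<^sub>k = w\<^sub>0, \<dots>, w\<^sub>l\<close>
  that unwinds the circle, where \<open>w\<^sub>l\<close> is the translate of \<open>w\<^sub>0\<close> by the stable letter.
\<close>

definition lolli_tuple ::
  "('g, 'c) monoid_scheme \<Rightarrow> nat \<Rightarrow> nat \<Rightarrow> (nat \<Rightarrow> int) \<Rightarrow> (nat \<Rightarrow> int) \<Rightarrow> (nat \<Rightarrow> int) \<Rightarrow>
    (nat \<Rightarrow> int) \<Rightarrow> (nat \<Rightarrow> 'g) \<Rightarrow> 'g \<Rightarrow> bool" where
  "lolli_tuple H k l q r x y u \<tau> \<longleftrightarrow>
    (\<forall>i \<le> k + l. u i \<in> carrier H) \<and> \<tau> \<in> carrier H \<and>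
    (\<forall>i<k. u i [^]\<^bsub>H\<^esub> q i = u (Suc i) [^]\<^bsub>H\<^esub> r (Suc i)) \<and>
    (\<forall>j<l. u (k + j) [^]\<^bsub>H\<^esub> x j = u (k + Suc j) [^]\<^bsub>H\<^esub> y (Suc j)) \<and>
    u (k + l) = \<tau> \<otimes>\<^bsub>H\<^esub> u k \<otimes>\<^bsub>H\<^esub> inv\<^bsub>H\<^esub> \<tau>"

section \<open>Maximal trees of a lollipop\<close>

lemma lollipop_simps [simp]:
  "verts (lollipop k l) = {..<k + l}"
  "arcs (lollipop k l) = lolli_arcs k l"
  "tail (lollipop k l) = lolli_tail k l"
  "head (lollipop k l) (c, b) = lolli_tail k l (c, \<not> b)"
  by (simp_all add: lollipop_def)

lemma lolli_arcs_iff [simp]: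
  "(Arc i, b) \<in> lolli_arcs k l \<longleftrightarrow> i < k"
  "(Circ j, b) \<in> lolli_arcs k l \<longleftrightarrow> j < l"
  by (auto simp: lolli_arcs_def)

lemma lolli_arcs_rev: "(c, b) \<in> lolli_arcs k l \<longleftrightarrow> (c, \<not> b) \<in> lolli_arcs k l"
  by (simp add: lolli_arcs_def)

lemma lolli_rev_simp: "(c, b) \<in> lolli_arcs k l \<Longrightarrow> lolli_rev k l (c, b) = (c, \<not> b)"
  by (simp add: lolli_rev_def)

lemma connected_closed_set:
  assumes "connected T" "u \<in> verts T" "u \<in> U" "v \<in> verts T"
    and closed: "\<And>e. e \<in> arcs T \<Longrightarrow> tail T e \<in> U \<longleftrightarrow> head T e \<in> U"
  shows "v \<in> U"
proof -
  have "u \<rightarrow>\<^sup>*\<^bsub>with_proj (mk_symmetric T)\<^esub> v"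
    using assms(1,2,4) by (auto simp: connected_def strongly_connected_def mk_symmetric_def)
  then have "(u, v) \<in> rtrancl_on (verts T) (parcs (mk_symmetric T))"
    by (simp add: reachable_def mk_symmetric_def arcs_ends_conv)
  then show ?thesis
    by (induction rule: rtrancl_on_induct) (use assms(3) closed in \<open>auto simp: mk_symmetric_def\<close>)
qed

text \<open>Some circle edge is missing, since the full circle is a closed path without
  backtracking. Nothing else can be missing: without the i-th arc edge the set \<open>{..i}\<close>
  is cut off, and without two circle edges i0 < i1 the set \<open>{k + i0<..k + i1}\<close>
  is.\<close>

lemma lollipop_maximal_tree:
  assumes "maximal_tree (lollipop k l) (lolli_rev k l) T" "l \<ge> 1"
  shows "\<exists>j0<l. arcs T = lolli_arcs k l - {Circ j0} \<times> UNIV"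
proof -
  have sub: "subgraph T (lollipop k l)" and rev: "lolli_rev k l ` arcs T \<subseteq> arcs T"
    and verts: "verts T = {..<k + l}" and conn: "connected T"
    and acyclic: "\<not> (\<exists>u p. p \<noteq> [] \<and> pre_digraph.awalk T u p u \<and> successively (\<lambda>e f. f \<noteq> lolli_rev k l e) p)"
    using assms(1) by (auto simp: maximal_tree_def rv_subgraph_def)
  have arcs: "arcs T \<subseteq> lolli_arcs k l" and tail: "tail T = lolli_tail k l"
    and head: "head T = head (lollipop k l)"
    using sub by (auto simp: subgraph_def compatible_def)
  have flip: "(c, b) \<in> arcs T \<longleftrightarrow> (c, True) \<in> arcs T" for c b
  proof -
    have "(c, \<not> b') \<in> arcs T" if "(c, b') \<in> arcs T" for b'
    proof -
      have "lolli_rev k l (c, b') \<in> arcs T" using rev that by blast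
      moreover have "(c, b') \<in> lolli_arcs k l" using that arcs by blast
      ultimately show ?thesis by (simp add: lolli_rev_simp)
    qed
    from this[of True] this[of False] show ?thesis by (cases b) auto
  qed
  have closed: "v \<in> U" if "u \<in> U" "u < k + l" "v < k + l"
    "\<And>e. e \<in> arcs T \<Longrightarrow> lolli_tail k l e \<in> U \<longleftrightarrow> lolli_tail k l (fst e, \<not> snd e) \<in> U" for u v U
    using connected_closed_set[OF conn, of u U v] that verts
    by (auto simp: tail head lollipop_def split_beta)
  have "\<exists>j0<l. (Circ j0, True) \<notin> arcs T"
  proof (rule ccontr)
    assume "\<not> ?thesis"
    then have all: "(Circ j, True) \<in> arcs T" if "j < l" for j using that by blast
    define p where "p = map (\<lambda>j. (Circ j, True)) [0..<l]"
    have cas: "pre_digraph.cas T (k + i mod l) (map (\<lambda>j. (Circ j, True)) [i..<i + d]) (k + (i + d) mod l)"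
      for i d
    proof (induction d arbitrary: i)
      case (Suc d)
      have "[i..<i + Suc d] = i # [Suc i..<Suc i + d]" by (simp add: upt_conv_Cons)
      then show ?case using Suc[of "Suc i"]
        by (simp add: pre_digraph.cas.simps tail head)
    qed (simp add: pre_digraph.cas.simps)
    have "pre_digraph.awalk T k p k"
      using cas[of 0 l] all assms(2) by (auto simp: pre_digraph.awalk_def p_def verts)
    moreover have "successively (\<lambda>e f. f \<noteq> lolli_rev k l e) p"
      by (auto simp: p_def successively_map lolli_rev_def successively_conv_nth)
    moreover have "p \<noteq> []" using assms(2) by (simp add: p_def)
    ultimately show False using acyclic by blast
  qed
  then obtain j0 where j0: "j0 < l" "(Circ j0, True) \<notin> arcs T" by blast
  have arc: "(Arc i, True) \<in> arcs T" if "i < k" for i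
  proof (rule ccontr)
    assume i: "(Arc i, True) \<notin> arcs T"
    have "k \<in> {..i}"
    proof (rule closed[of 0])
      fix e assume e: "e \<in> arcs T"
      obtain c b where eb: "e = (c, b)" by (cases e)
      have T: "(c, True) \<in> arcs T" using e eb flip by blast
      have "(c, b) \<in> lolli_arcs k l" using e eb arcs by blast
      then show "lolli_tail k l e \<in> {..i} \<longleftrightarrow> lolli_tail k l (fst e, \<not> snd e) \<in> {..i}"
        using T i that by (cases c; cases b) (auto simp: eb le_Suc_eq Suc_le_eq le_less)
    qed (use assms(2) in auto)
    then show False using that by simp
  qed
  have circ: "(Circ j, True) \<in> arcs T" if j: "j < l" "j \<noteq> j0" for j
  proof (rule ccontr)
    assume no: "(Circ j, True) \<notin> arcs T"
    define i0 i1 where "i0 = min j j0" and "i1 = max j j0"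
    have i01: "i0 < i1" "i1 < l" "(Circ i0, True) \<notin> arcs T" "(Circ i1, True) \<notin> arcs T"
      using j j0 no by (auto simp: i0_def i1_def min_def max_def)
    have "k + i0 \<in> {k + i0<..k + i1}"
    proof (rule closed[of "k + i1"])
      fix e assume e: "e \<in> arcs T"
      obtain c b where eb: "e = (c, b)" by (cases e)
      have T: "(c, True) \<in> arcs T" using e eb flip by blast
      have mem: "(c, b) \<in> lolli_arcs k l" using e eb arcs by blast
      have circ: "k + j mod l \<in> {k + i0<..k + i1} \<longleftrightarrow> k + Suc j mod l \<in> {k + i0<..k + i1}"
        if "c = Circ j" for j
      proof -
        have "j < l" "j \<noteq> i0" "j \<noteq> i1" using mem T i01 that by auto
        then show ?thesis using i01 by (cases "Suc j = l") auto
      qed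
      show "lolli_tail k l e \<in> {k + i0<..k + i1} \<longleftrightarrow> lolli_tail k l (fst e, \<not> snd e) \<in> {k + i0<..k + i1}"
        using mem circ by (cases c; cases b) (auto simp: eb)
    qed (use i01 in auto)
    then show False by simp
  qed
  have "arcs T = lolli_arcs k l - {Circ j0} \<times> UNIV"
  proof (rule Set.set_eqI)
    fix e :: "lolli_edge \<times> bool"
    obtain c b where eb: "e = (c, b)" by (cases e)
    show "e \<in> arcs T \<longleftrightarrow> e \<in> lolli_arcs k l - {Circ j0} \<times> UNIV"
      using arc circ j0 flip[of c b] arcs by (cases c) (auto simp: eb)
  qed
  then show ?thesis using j0(1) by blast
qed

lemma wf_lollipop:
  assumes "l \<ge> 1"
  shows "wf_digraph (lollipop k l)" "lolli_rev k l ` arcs (lollipop k l) \<subseteq> arcs (lollipop k l)"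
proof -
  have "labelled_graph (lollipop k l) (lolli_rev k l) (lolli_label (\<lambda>_. 1) (\<lambda>_. 1) (\<lambda>_. 1) (\<lambda>_. 1))"
    using assms by (intro labelled_graph_lollipop) auto
  then interpret labelled_graph "lollipop k l" "lolli_rev k l" "lolli_label (\<lambda>_. 1) (\<lambda>_. 1) (\<lambda>_. 1) (\<lambda>_. 1)" .
  show "wf_digraph (lollipop k l)" by unfold_locales
  show "lolli_rev k l ` arcs (lollipop k l) \<subseteq> arcs (lollipop k l)"
    by (auto simp: lolli_rev_def simp flip: lolli_arcs_rev)
qed

section \<open>Homomorphisms as tuples\<close>

lemma (in group) conj_inverse:
  assumes "s \<in> carrier G" "a \<in> carrier G" "b \<in> carrier G" "s \<otimes> a \<otimes> inv s = b"
  shows "inv s \<otimes> b \<otimes> inv (inv s) = a"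
  using assms(1-3) unfolding assms(4)[symmetric] by (simp add: m_assoc) (simp add: m_assoc[symmetric])

abbreviation lolli_group where
  "lolli_group k l q r x y T \<equiv> GBS_group (lollipop k l) (lolli_rev k l) (lolli_label q r x y) T"

abbreviation lolli_gen where
  "lolli_gen k l q r x y T \<equiv> gbs_gen (lollipop k l) (lolli_rev k l) (lolli_label q r x y) T"

text \<open>A tuple closes up at w_l, whereas the stable letter of the given tree sits at the
  omitted edge \<open>j0\<close>. Conjugating the values beyond that edge by the inverse of \<tau>
  moves the jump there.\<close>

lemma lolli_tuple_to_hom:
  fixes H (structure)
  assumes "group H" "l \<ge> 1" "maximal_tree (lollipop k l) (lolli_rev k l) T"
    and tuple: "lolli_tuple H k l q r x y u \<tau>"
  shows "\<exists>\<phi> \<in> hom (lolli_group k l q r x y T) H.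
    insert \<tau> (u ` {..k + l}) \<subseteq> \<phi> ` carrier (lolli_group k l q r x y T)"
proof -
  interpret H: group H by fact
  obtain j0 where j0: "j0 < l" and T: "arcs T = lolli_arcs k l - {Circ j0} \<times> UNIV"
    using lollipop_maximal_tree[OF assms(3,2)] by blast
  have u: "\<And>i. i \<le> k + l \<Longrightarrow> u i \<in> carrier H" and \<tau>: "\<tau> \<in> carrier H"
    and arc: "\<And>i. i < k \<Longrightarrow> u i [^] q i = u (Suc i) [^] r (Suc i)"
    and circ: "\<And>j. j < l \<Longrightarrow> u (k + j) [^] x j = u (k + Suc j) [^] y (Suc j)"
    and close: "u (k + l) = \<tau> \<otimes> u k \<otimes> inv \<tau>"
    using tuple by (auto simp: lolli_tuple_def)
  define V where "V i = (if i \<le> k + j0 then u i else inv \<tau> \<otimes> u i \<otimes> inv (inv \<tau>))" for i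
  define s where "s e = (if e = (Circ j0, True) then \<tau> else if e = (Circ j0, False) then inv \<tau> else \<one>)" for e
  have Vc: "V i \<in> carrier H" if "i < k + l" for i using that u \<tau> by (simp add: V_def)
  have sc: "s e \<in> carrier H" for e using \<tau> by (simp add: s_def)
  \<comment> \<open>For the last edge the next vertex is w_0, with value \<open>u k\<close>; the
    closing relation identifies it with the conjugate of \<open>u (k + l)\<close>.\<close>
  have V_next: "V (k + Suc j mod l) =
      (if j < j0 then u (k + Suc j) else inv \<tau> \<otimes> u (k + Suc j) \<otimes> inv (inv \<tau>))"
    if "j < l" for j
  proof (cases "Suc j = l")
    case True
    then show ?thesis using j0 H.conj_inverse[OF \<tau> u u close[symmetric]] by (simp add: V_def)
  next
    case False
    then show ?thesis using that by (simp add: V_def)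
  qed
  have conj: "(inv \<tau> \<otimes> a \<otimes> \<tau>) [^] z = inv \<tau> \<otimes> a [^] z \<otimes> \<tau>"
    if "a \<in> carrier H" for a and z :: int
    using H.int_pow_conjugate[of "inv \<tau>" a z] \<tau> that by simp
  have edge: "s (c, True) \<otimes> V (lolli_tail k l (c, False)) [^] lolli_label q r x y (c, False)
      \<otimes> inv s (c, True) = V (lolli_tail k l (c, True)) [^] lolli_label q r x y (c, True)"
    if "(c, True) \<in> lolli_arcs k l" for c
  proof (cases c)
    case (Arc i)
    then show ?thesis using that arc[of i] u[of "Suc i"] by (simp add: V_def s_def)
  next
    case (Circ j)
    then have j: "j < l" using that by simp
    have uc: "u (k + Suc j) \<in> carrier H" "u (k + j) \<in> carrier H" using u j by auto
    consider "j < j0" | "j = j0" | "j > j0" by linarith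
    then show ?thesis
    proof cases
      case 1
      then show ?thesis using j uc circ[OF j] by (simp add: Circ s_def V_next) (simp add: V_def)
    next
      case 2
      have "\<tau> \<otimes> (inv \<tau> \<otimes> u (k + Suc j) \<otimes> inv (inv \<tau>)) [^] y (Suc j) \<otimes> inv \<tau>
          = u (k + Suc j) [^] y (Suc j)"
        using \<tau> uc by (subst H.int_pow_conjugate) (simp_all add: H.m_assoc, simp add: H.m_assoc[symmetric])
      then show ?thesis using 2 j circ[OF j] by (simp add: Circ s_def V_next) (simp add: V_def)
    next
      case 3
      then show ?thesis using j uc circ[OF j] \<tau>
        by (simp add: Circ s_def V_next)
          (simp add: V_def conj)
    qed
  qed
  have rev: "s e \<otimes> s (lolli_rev k l e) = \<one>" if "e \<in> lolli_arcs k l" for e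
    using that \<tau> by (cases e) (auto simp: s_def lolli_rev_simp)
  have s_inv: "s (c, False) = inv s (c, True)" for c using \<tau> by (simp add: s_def)
  have tail_less: "lolli_tail k l (c, b) < k + l" if "(c, True) \<in> lolli_arcs k l" for c b
    using that assms(2) by (cases c; cases b) auto
  have "\<exists>\<phi> \<in> hom (lolli_group k l q r x y T) H.
      (\<forall>v \<in> verts (lollipop k l). \<phi> (lolli_gen k l q r x y T (Vertex v)) = V v) \<and>
      (\<forall>e \<in> arcs (lollipop k l). \<phi> (lolli_gen k l q r x y T (Stable e)) = s e)"
  proof (rule H.hom_from_GBS_group)
    fix e assume "e \<in> arcs (lollipop k l)"
    moreover obtain c b where eb: "e = (c, b)" by (cases e)
    ultimately have e: "e = (c, b)" "(c, True) \<in> lolli_arcs k l" "(c, b) \<in> lolli_arcs k l"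
      using lolli_arcs_rev[of c b k l] by (cases b; simp)+
    show "s e \<otimes> V (head (lollipop k l) e) [^] lolli_label q r x y (lolli_rev k l e) \<otimes> inv s e =
        V (tail (lollipop k l) e) [^] lolli_label q r x y e"
    proof (cases b)
      case True
      then show ?thesis using edge[OF e(2)] e by (simp add: lolli_rev_simp)
    next
      case False
      have "inv s (c, True) \<otimes> V (lolli_tail k l (c, True)) [^] lolli_label q r x y (c, True)
          \<otimes> inv (inv s (c, True)) = V (lolli_tail k l (c, False)) [^] lolli_label q r x y (c, False)"
        using H.conj_inverse[OF sc _ _ edge[OF e(2)]] Vc[OF tail_less[OF e(2)]] by simp
      then show ?thesis using False e by (simp add: lolli_rev_simp s_inv)
    qed
    show "s e \<otimes> s (lolli_rev k l e) = \<one>" using rev e by blast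
  next
    fix e assume "e \<in> arcs T"
    then show "s e = \<one>" by (auto simp: T s_def)
  qed (use wf_lollipop[OF assms(2)] Vc sc T in auto)
  then obtain \<phi> where \<phi>: "\<phi> \<in> hom (lolli_group k l q r x y T) H"
      and \<phi>V: "\<And>v. v < k + l \<Longrightarrow> \<phi> (lolli_gen k l q r x y T (Vertex v)) = V v"
      and \<phi>s: "\<And>e. e \<in> lolli_arcs k l \<Longrightarrow> \<phi> (lolli_gen k l q r x y T (Stable e)) = s e"
    by auto
  define K where "K = \<phi> ` carrier (lolli_group k l q r x y T)"
  have group: "group (lolli_group k l q r x y T)"
    unfolding GBS_group_def by (rule group_presented_group)
  interpret group_hom "lolli_group k l q r x y T" H \<phi>
    using group \<phi> by (simp add: group_hom_def group_hom_axioms_def H.is_group)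
  interpret K: subgroup K H unfolding K_def by (rule img_is_subgroup)
  have gens: "lolli_gen k l q r x y T c
      \<in> carrier (lolli_group k l q r x y T)"
    if "c \<in> Vertex ` {..<k + l} \<union> Stable ` lolli_arcs k l" for c
    unfolding GBS_group_def by (rule funcset_mem[OF gen_class_carrier]) (use that in simp)
  have VK: "V v \<in> K" if "v < k + l" for v
    unfolding K_def \<phi>V[OF that, symmetric] using gens that by blast
  have "s (Circ j0, True) \<in> K"
    using gens[of "Stable (Circ j0, True)"] \<phi>s[of "(Circ j0, True)"] j0 unfolding K_def
    by (metis UnI2 image_eqI lolli_arcs_iff(2))
  then have \<tau>K: "\<tau> \<in> K" by (simp add: s_def)
  have "u i \<in> K" if "i \<le> k + l" for i
  proof (cases "i = k + l")
    case True
    then show ?thesis using close \<tau>K VK[of k] assms(2) by (simp add: V_def)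
  next
    case False
    then have i: "i < k + l" using that by simp
    show ?thesis
    proof (cases "i \<le> k + j0")
      case True
      then show ?thesis using VK[OF i] by (simp add: V_def)
    next
      case False
      then have "u i = \<tau> \<otimes> V i \<otimes> inv \<tau>"
        using \<tau> u[OF that] by (simp add: V_def H.m_assoc) (simp add: H.m_assoc[symmetric])
      then show ?thesis using VK[OF i] \<tau>K by simp
    qed
  qed
  then show ?thesis using \<phi> \<tau>K by (auto simp: K_def)
qed

text \<open>The inverse construction: the vertices beyond the omitted edge \<open>j0\<close> are
  conjugated by the image \<tau> of its stable letter, so that all edges before w_l obey the
  relations without a stable letter.\<close>

lemma hom_to_lolli_tuple:
  fixes H (structure)
  assumes "group H" "l \<ge> 1" "maximal_tree (lollipop k l) (lolli_rev k l) T"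
    and \<phi>: "\<phi> \<in> hom (lolli_group k l q r x y T) H"
  shows "\<exists>u \<tau>. lolli_tuple H k l q r x y u \<tau> \<and>
    \<phi> ` carrier (lolli_group k l q r x y T)
      \<subseteq> generate H (insert \<tau> (u ` {..k + l}))"
proof -
  interpret H: group H by fact
  obtain j0 where j0: "j0 < l" and T: "arcs T = lolli_arcs k l - {Circ j0} \<times> UNIV"
    using lollipop_maximal_tree[OF assms(3,2)] by blast
  have Tsub: "arcs T \<subseteq> arcs (lollipop k l)" by (auto simp: T)
  define V where "V = (\<lambda>v. \<phi> (lolli_gen k l q r x y T (Vertex v)))"
  define s where "s = (\<lambda>e. \<phi> (lolli_gen k l q r x y T (Stable e)))"
  note rels = GBS_group_hom_relations[OF wf_lollipop[OF assms(2)] Tsub assms(1) \<phi> V_def s_def]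
  have Vc: "V i \<in> carrier H" if "i < k + l" for i using rels(1) that by auto
  have sc: "s e \<in> carrier H" if "e \<in> lolli_arcs k l" for e using rels(2) that by auto
  define \<tau> where "\<tau> = s (Circ j0, True)"
  have \<tau>: "\<tau> \<in> carrier H" using sc j0 by (simp add: \<tau>_def)
  define u where "u i = (if i \<le> k + j0 then V i else \<tau> \<otimes> V (if i = k + l then k else i) \<otimes> inv \<tau>)" for i
  have kl: "k < k + l" using assms(2) by simp
  have uc: "u i \<in> carrier H" if "i \<le> k + l" for i
    using that \<tau> Vc j0 kl by (auto simp: u_def)
  have tree: "s (c, b) = \<one>" if "(c, b) \<in> lolli_arcs k l" "c \<noteq> Circ j0" for c b
    using rels(4)[of "(c, b)"] that by (simp add: T)
  have arc: "u i [^] q i = u (Suc i) [^] r (Suc i)" if "i < k" for i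
    using rels(3)[of "(Arc i, True)"] tree[of "Arc i" True] that Vc[of "Suc i"] kl
    by (simp add: lolli_rev_simp u_def)
  have u_next: "u (k + Suc j) = (if j < j0 then V (k + Suc j mod l) else \<tau> \<otimes> V (k + Suc j mod l) \<otimes> inv \<tau>)"
    if "j < l" for j
    using that j0 by (cases "Suc j = l") (auto simp: u_def)
  have circ: "u (k + j) [^] x j = u (k + Suc j) [^] y (Suc j)" if j: "j < l" for j
  proof -
    have edge: "s (Circ j, True) \<otimes> V (k + Suc j mod l) [^] y (Suc j) \<otimes> inv s (Circ j, True) = V (k + j) [^] x j"
      using rels(3)[of "(Circ j, True)"] j by (simp add: lolli_rev_simp)
    have Vn: "V (k + Suc j mod l) \<in> carrier H" "V (k + j) \<in> carrier H" using Vc j assms(2) by auto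
    consider "j < j0" | "j = j0" | "j > j0" by linarith
    then show ?thesis
    proof cases
      case 1
      then have "Suc j mod l = Suc j" using j0 by simp
      then show ?thesis using 1 j edge tree[of "Circ j" True] Vn by (simp add: u_def)
    next
      case 2
      then have nxt: "u (k + Suc j) = \<tau> \<otimes> V (k + Suc j mod l) \<otimes> inv \<tau>"
        using u_next[OF j] by simp
      show ?thesis unfolding nxt using 2 edge \<tau> Vn
        by (simp add: H.int_pow_conjugate \<tau>_def[symmetric]) (simp add: u_def)
    next
      case 3
      then have nxt: "u (k + Suc j) = \<tau> \<otimes> V (k + Suc j mod l) \<otimes> inv \<tau>"
        using u_next[OF j] by simp
      show ?thesis unfolding nxt using 3 j edge tree[of "Circ j" True] \<tau> Vn
        by (simp add: H.int_pow_conjugate) (simp add: u_def H.int_pow_conjugate)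
    qed
  qed
  have "u (k + l) = \<tau> \<otimes> u k \<otimes> inv \<tau>" using j0 by (simp add: u_def)
  then have tuple: "lolli_tuple H k l q r x y u \<tau>"
    using uc \<tau> arc circ by (simp add: lolli_tuple_def)
  define K where "K = generate H (insert \<tau> (u ` {..k + l}))"
  interpret K: subgroup K H
    unfolding K_def by (rule H.generate_is_subgroup) (use uc \<tau> in auto)
  have uK: "u i \<in> K" if "i \<le> k + l" for i
    using that by (auto simp: K_def intro: generate.incl)
  have \<tau>K: "\<tau> \<in> K" by (auto simp: K_def intro: generate.incl)
  have VK: "V i \<in> K" if i: "i < k + l" for i
  proof (cases "i \<le> k + j0")
    case True
    then show ?thesis using uK[of i] i by (simp add: u_def)
  next
    case False
    then have "V i = inv \<tau> \<otimes> u i \<otimes> \<tau>"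
      using \<tau> Vc[OF i] i by (simp add: u_def H.m_assoc) (simp add: H.m_assoc[symmetric])
    then show ?thesis using \<tau>K uK[of i] i by simp
  qed
  have sK: "s e \<in> K" if e: "e \<in> lolli_arcs k l" for e
  proof -
    obtain c b where eb: "e = (c, b)" by (cases e)
    show ?thesis
    proof (cases "c = Circ j0")
      case False
      then show ?thesis using tree e eb by simp
    next
      case True
      show ?thesis
      proof (cases b)
        case False
        have "s (Circ j0, False) \<otimes> \<tau> = \<one>"
          using rels(5)[of "(Circ j0, False)"] j0 by (simp add: lolli_rev_simp \<tau>_def)
        then have "s (Circ j0, False) = inv \<tau>"
          using H.inv_equality[of "s (Circ j0, False)" \<tau>] \<tau> sc j0 by simp
        then show ?thesis using True False eb \<tau>K by simp
      qed (use True eb \<tau>K \<tau>_def in simp)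
    qed
  qed
  have "generate H (V ` {..<k + l} \<union> s ` lolli_arcs k l) \<subseteq> K"
    using VK sK by (intro H.generate_subgroup_incl K.subgroup_axioms) auto
  then show ?thesis using tuple rels(6) by (auto simp: K_def)
qed


text \<open>Here the choice of the maximal tree disappears: surjectivity becomes generation by the
  entries of a tuple.\<close>

lemma lolli_epi_iff:
  assumes "group G" "group H" "l \<ge> 1"
    and "represents (lollipop k l) (lolli_rev k l) (lolli_label q r x y) G"
  shows "(\<exists>\<phi>. \<phi> \<in> epi G H) \<longleftrightarrow>
    (\<exists>u \<tau>. lolli_tuple H k l q r x y u \<tau> \<and> generate H (insert \<tau> (u ` {..k + l})) = carrier H)"
proof -
  interpret H: group H by fact
  obtain T where T: "maximal_tree (lollipop k l) (lolli_rev k l) T"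
    and iso: "G \<cong> lolli_group k l q r x y T"
    using assms(4) by (auto simp: represents_def)
  define P where "P = lolli_group k l q r x y T"
  have P: "group P" unfolding P_def GBS_group_def by (rule group_presented_group)
  have iso': "P \<cong> G" using group.iso_sym[OF assms(1) iso] by (simp add: P_def)
  obtain h h' where h: "h \<in> iso G P" and h': "h' \<in> iso P G"
    using iso iso' by (auto simp: is_iso_def P_def)
  show ?thesis
  proof
    assume "\<exists>\<phi>. \<phi> \<in> epi G H"
    then obtain \<phi> where "\<phi> \<in> epi G H" by blast
    then have "\<phi> \<circ> h' \<in> epi P H" using h' epi_compose by (auto simp: iso_iff_mon_epi)
    then have \<phi>: "\<phi> \<circ> h' \<in> hom P H" "(\<phi> \<circ> h') ` carrier P = carrier H" by (auto simp: epi_def)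
    obtain u \<tau> where u: "lolli_tuple H k l q r x y u \<tau>"
      "carrier H \<subseteq> generate H (insert \<tau> (u ` {..k + l}))"
      using hom_to_lolli_tuple[OF assms(2,3) T \<phi>(1)[unfolded P_def]] \<phi>(2) unfolding P_def by metis
    moreover have "generate H (insert \<tau> (u ` {..k + l})) \<subseteq> carrier H"
      using u(1) by (intro H.generate_incl) (auto simp: lolli_tuple_def)
    ultimately show "\<exists>u \<tau>. lolli_tuple H k l q r x y u \<tau> \<and>
        generate H (insert \<tau> (u ` {..k + l})) = carrier H"
      by blast
  next
    assume "\<exists>u \<tau>. lolli_tuple H k l q r x y u \<tau> \<and>
        generate H (insert \<tau> (u ` {..k + l})) = carrier H"
    then obtain u \<tau> where u: "lolli_tuple H k l q r x y u \<tau>"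
      "generate H (insert \<tau> (u ` {..k + l})) = carrier H"
      by blast
    obtain \<phi> where \<phi>: "\<phi> \<in> hom P H" "insert \<tau> (u ` {..k + l}) \<subseteq> \<phi> ` carrier P"
      using lolli_tuple_to_hom[OF assms(2,3) T u(1)] unfolding P_def by blast
    interpret group_hom P H \<phi>
      using P \<phi>(1) by (simp add: group_hom_def group_hom_axioms_def H.is_group)
    have "carrier H \<subseteq> \<phi> ` carrier P"
      using H.generate_subgroup_incl[OF \<phi>(2) img_is_subgroup] u(2) by simp
    then have "\<phi> \<in> epi P H" using \<phi>(1) by (simp add: epi_iff_subset)
    then have "\<phi> \<circ> h \<in> epi G H" using h epi_compose by (auto simp: iso_iff_mon_epi)
    then show "\<exists>\<phi>. \<phi> \<in> epi G H" by blast
  qed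
qed

text \<open>The tuple need not generate \<open>H\<close>. This is the form in which two-generation
  of G is exploited, with affine groups as \<open>H\<close>.\<close>

lemma lolli_tuple_two_generated:
  assumes "group G" "two_generated G" "group H" "l \<ge> 1"
    and "represents (lollipop k l) (lolli_rev k l) (lolli_label q r x y) G"
    and tuple: "lolli_tuple H k l q r x y u \<tau>"
  shows "\<exists>g1 \<in> carrier H. \<exists>g2 \<in> carrier H. insert \<tau> (u ` {..k + l}) \<subseteq> generate H {g1, g2}"
proof -
  obtain T where T: "maximal_tree (lollipop k l) (lolli_rev k l) T"
    and iso: "G \<cong> lolli_group k l q r x y T"
    using assms(5) by (auto simp: represents_def)
  define P where "P = lolli_group k l q r x y T"
  have P: "group P" unfolding P_def GBS_group_def by (rule group_presented_group)
  obtain h where h: "h \<in> iso G P" using iso by (auto simp: is_iso_def P_def)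
  obtain \<phi> where \<phi>: "\<phi> \<in> hom P H" "insert \<tau> (u ` {..k + l}) \<subseteq> \<phi> ` carrier P"
    using lolli_tuple_to_hom[OF assms(3,4) T tuple] unfolding P_def by blast
  have comp: "\<phi> \<circ> h \<in> hom G H" using h \<phi>(1) hom_compose by (auto simp: iso_def)
  obtain a b where ab: "a \<in> carrier G" "b \<in> carrier G" "generate G {a, b} = carrier G"
    using assms(2) by (auto simp: two_generated_def)
  interpret group_hom G H "\<phi> \<circ> h"
    using comp assms(1,3) by (simp add: group_hom_def group_hom_axioms_def)
  have "\<phi> ` carrier P = (\<phi> \<circ> h) ` carrier G"
  proof -
    have "h ` carrier G = carrier P" using h by (auto simp: iso_def bij_betw_def)
    then show ?thesis by (metis image_comp)
  qed
  also have "\<dots> = generate H {(\<phi> \<circ> h) a, (\<phi> \<circ> h) b}"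
    using generate_img[of "{a, b}"] ab by simp
  finally have "insert \<tau> (u ` {..k + l}) \<subseteq> generate H {(\<phi> \<circ> h) a, (\<phi> \<circ> h) b}"
    using \<phi>(2) by simp
  then show ?thesis by (intro bexI[of _ "(\<phi> \<circ> h) a"] bexI[of _ "(\<phi> \<circ> h) b"] hom_closed ab)
qed

section \<open>Affine groups and an obstruction to being 2-generated\<close>

text \<open>
  The maps \<open>z \<mapsto> u z + b\<close> on three-dimensional space over the residue field of \<open>P\<close>.  Only two cases
  matter: \<open>P\<close> a prime integer, and \<open>P = 0\<close> in the field of complex numbers, where \<open>x mod 0 = x\<close>.
\<close>

definition aff :: "'a::unique_euclidean_ring \<Rightarrow> ('a \<times> 'a \<times> 'a \<times> 'a) monoid" where
  "aff P =
    \<lparr> carrier = {(u, b1, b2, b3). (\<exists>v. (u * v) mod P = 1 mod P) \<and>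
        u mod P = u \<and> b1 mod P = b1 \<and> b2 mod P = b2 \<and> b3 mod P = b3},
      monoid.mult = (\<lambda>(u, b1, b2, b3) (v, c1, c2, c3).
        ((u * v) mod P, (b1 + u * c1) mod P, (b2 + u * c2) mod P, (b3 + u * c3) mod P)),
      one = (1 mod P, 0, 0, 0) \<rparr>"

fun dot :: "'a::comm_ring_1 \<times> 'a \<times> 'a \<Rightarrow> 'a \<times> 'a \<times> 'a \<times> 'a \<Rightarrow> 'a" where
  "dot (c1, c2, c3) (u, b1, b2, b3) = c1 * b1 + c2 * b2 + c3 * b3"

lemma aff_mult [simp]:
  "(u, b1, b2, b3) \<otimes>\<^bsub>aff P\<^esub> (v, c1, c2, c3) =
    ((u * v) mod P, (b1 + u * c1) mod P, (b2 + u * c2) mod P, (b3 + u * c3) mod P)"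
  by (simp add: aff_def)

lemma aff_one: "\<one>\<^bsub>aff P\<^esub> = (1 mod P, 0, 0, 0)"
  by (simp add: aff_def)

lemma aff_carrier: "(u, b1, b2, b3) \<in> carrier (aff P) \<longleftrightarrow> (\<exists>v. (u * v) mod P = 1 mod P) \<and>
    u mod P = u \<and> b1 mod P = b1 \<and> b2 mod P = b2 \<and> b3 mod P = b3"
  by (simp add: aff_def)

lemma mod_mult_add:
  fixes P :: "'a::unique_euclidean_ring"
  shows "(a + b * (x mod P)) mod P = (a + b * x) mod P"
    "(a + x mod P * b) mod P = (a + x * b) mod P"
    "(b * (x mod P) + a) mod P = (b * x + a) mod P"
    "(x mod P * b + a) mod P = (x * b + a) mod P"
proof -
  have "P dvd b * (x mod P - x)" by (metis dvd_mult mod_eq_dvd_iff mod_mod_trivial)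
  then show "(a + b * (x mod P)) mod P = (a + b * x) mod P"
    "(a + x mod P * b) mod P = (a + x * b) mod P"
    "(b * (x mod P) + a) mod P = (b * x + a) mod P"
    "(x mod P * b + a) mod P = (x * b + a) mod P"
    by (simp_all add: mod_eq_dvd_iff algebra_simps)
qed

lemma mod_dot:
  fixes P :: "'a::unique_euclidean_ring"
  shows "(c1 * (b1 mod P) + c2 * (b2 mod P) + c3 * (b3 mod P)) mod P =
    (c1 * b1 + c2 * b2 + c3 * b3) mod P"
proof -
  have "P dvd c * (b mod P - b)" for b c by (metis dvd_mult mod_eq_dvd_iff mod_mod_trivial)
  then have "P dvd c1 * (b1 mod P - b1) + c2 * (b2 mod P - b2) + c3 * (b3 mod P - b3)"
    by (intro dvd_add)
  then show ?thesis by (simp add: mod_eq_dvd_iff algebra_simps)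
qed

lemma aff_inverse:
  assumes "(u, b1, b2, b3) \<in> carrier (aff P)"
  shows "\<exists>v. (v mod P, (- v * b1) mod P, (- v * b2) mod P, (- v * b3) mod P) \<in> carrier (aff P) \<and>
    (v mod P, (- v * b1) mod P, (- v * b2) mod P, (- v * b3) mod P) \<otimes>\<^bsub>aff P\<^esub> (u, b1, b2, b3) = \<one>\<^bsub>aff P\<^esub>"
proof -
  obtain v where v: "(u * v) mod P = 1 mod P" using assms by (auto simp: aff_carrier)
  have zero: "((- v * b) mod P + v mod P * b) mod P = 0" for b
    by (simp only: mod_mult_add mod_add_left_eq) simp
  have "(v mod P * u) mod P = 1 mod P" using v by (simp add: mod_simps mult.commute)
  moreover from this have "(v mod P, (- v * b1) mod P, (- v * b2) mod P, (- v * b3) mod P) \<in> carrier (aff P)"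
    by (auto simp: aff_carrier)
  ultimately show ?thesis
    by (intro exI[of _ v]) (simp only: aff_mult aff_one zero simp_thms)
qed

lemma group_aff:
  fixes P :: "'a::unique_euclidean_ring"
  shows "group (aff P)"
proof (rule groupI)
  show "\<one>\<^bsub>aff P\<^esub> \<in> carrier (aff P)"
    by (auto simp: aff_one aff_carrier mod_simps intro!: exI[of _ 1])
next
  fix g h assume "g \<in> carrier (aff P)" "h \<in> carrier (aff P)"
  moreover obtain u b1 b2 b3 where g: "g = (u, b1, b2, b3)" by (cases g)
  moreover obtain v c1 c2 c3 where h: "h = (v, c1, c2, c3)" by (cases h)
  ultimately obtain u' v' where uv: "(u * u') mod P = 1 mod P" "(v * v') mod P = 1 mod P"
    by (auto simp: aff_carrier)
  have "((u * v) mod P * (u' * v')) mod P = ((u * u') mod P * ((v * v') mod P)) mod P"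
  proof -
    have "((u * v) mod P * (u' * v')) mod P = ((u * v) * (u' * v')) mod P"
      by (simp only: mod_mult_left_eq)
    also have "(u * v) * (u' * v') = (u * u') * (v * v')" by (simp only: ac_simps)
    finally show ?thesis by (simp only: mod_mult_eq)
  qed
  also have "\<dots> = 1 mod P" unfolding uv by (simp add: mod_simps)
  finally show "g \<otimes>\<^bsub>aff P\<^esub> h \<in> carrier (aff P)"
    by (auto simp: g h aff_carrier)
next
  fix f g h :: "'a \<times> 'a \<times> 'a \<times> 'a"
  obtain u b1 b2 b3 where g: "g = (u, b1, b2, b3)" by (cases g)
  obtain v c1 c2 c3 where h: "h = (v, c1, c2, c3)" by (cases h)
  obtain w d1 d2 d3 where f: "f = (w, d1, d2, d3)" by (cases f)
  show "f \<otimes>\<^bsub>aff P\<^esub> g \<otimes>\<^bsub>aff P\<^esub> h = f \<otimes>\<^bsub>aff P\<^esub> (g \<otimes>\<^bsub>aff P\<^esub> h)"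
    by (simp only: f g h aff_mult mod_mult_add mod_add_left_eq mod_add_right_eq mod_mult_left_eq
        mod_mult_right_eq) (simp add: algebra_simps)
next
  fix g assume "g \<in> carrier (aff P)"
  moreover obtain u b1 b2 b3 where g: "g = (u, b1, b2, b3)" by (cases g)
  ultimately show "\<one>\<^bsub>aff P\<^esub> \<otimes>\<^bsub>aff P\<^esub> g = g"
    by (simp add: aff_one aff_carrier mod_simps)
next
  fix g assume "g \<in> carrier (aff P)"
  moreover obtain u b1 b2 b3 where g: "g = (u, b1, b2, b3)" by (cases g)
  ultimately show "\<exists>h \<in> carrier (aff P). h \<otimes>\<^bsub>aff P\<^esub> g = \<one>\<^bsub>aff P\<^esub>"
    using aff_inverse by blast
qed

text \<open>The linear parts are scalars, so a product has pairing
  \<open>dot c g + u * dot c h\<close> modulo P. For P = 0 divisibility by P means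
  vanishing.\<close>

lemma subgroup_dot: "subgroup {g \<in> carrier (aff P). P dvd dot c g} (aff P)"
proof -
  interpret group "aff P" by (rule group_aff)
  obtain c1 c2 c3 where c: "c = (c1, c2, c3)" by (cases c)
  show ?thesis
  proof (rule subgroupI)
    have "\<one>\<^bsub>aff P\<^esub> \<in> {g \<in> carrier (aff P). P dvd dot c g}"
      using one_closed by (simp add: c aff_one)
    then show "{g \<in> carrier (aff P). P dvd dot c g} \<noteq> {}" by blast
  next
    fix g assume "g \<in> {g \<in> carrier (aff P). P dvd dot c g}"
    moreover obtain u b1 b2 b3 where g: "g = (u, b1, b2, b3)" by (cases g)
    ultimately have gc: "g \<in> carrier (aff P)" and dvd: "P dvd c1 * b1 + c2 * b2 + c3 * b3"
      by (simp_all add: c)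
    obtain v where "(v mod P, (- v * b1) mod P, (- v * b2) mod P, (- v * b3) mod P) \<in> carrier (aff P)"
      "(v mod P, (- v * b1) mod P, (- v * b2) mod P, (- v * b3) mod P) \<otimes>\<^bsub>aff P\<^esub> g = \<one>\<^bsub>aff P\<^esub>"
      using aff_inverse gc unfolding g by blast
    then have inv: "inv\<^bsub>aff P\<^esub> g = (v mod P, (- v * b1) mod P, (- v * b2) mod P, (- v * b3) mod P)"
      using gc by (metis inv_equality)
    have "(c1 * ((- v * b1) mod P) + c2 * ((- v * b2) mod P) + c3 * ((- v * b3) mod P)) mod P =
        (- v * (c1 * b1 + c2 * b2 + c3 * b3)) mod P"
      by (simp only: mod_dot) (simp add: algebra_simps)
    also have "\<dots> = 0" using dvd by (metis dvd_mult dvd_imp_mod_0)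
    finally have "P dvd dot c (inv\<^bsub>aff P\<^esub> g)" by (simp add: c inv dvd_eq_mod_eq_0)
    then show "inv\<^bsub>aff P\<^esub> g \<in> {g \<in> carrier (aff P). P dvd dot c g}" using gc by simp
  next
    fix g h assume gh: "g \<in> {g \<in> carrier (aff P). P dvd dot c g}" "h \<in> {g \<in> carrier (aff P). P dvd dot c g}"
    obtain u b1 b2 b3 where g: "g = (u, b1, b2, b3)" by (cases g)
    obtain v d1 d2 d3 where h: "h = (v, d1, d2, d3)" by (cases h)
    have "(dot c (g \<otimes>\<^bsub>aff P\<^esub> h)) mod P = (dot c g + u * dot c h) mod P"
      unfolding c g h aff_mult dot.simps mod_dot by (simp add: algebra_simps)
    also have "\<dots> = 0" using gh by (metis (no_types, lifting) dvd_add dvd_imp_mod_0 dvd_mult mem_Collect_eq)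
    finally show "g \<otimes>\<^bsub>aff P\<^esub> h \<in> {g \<in> carrier (aff P). P dvd dot c g}"
      using gh by (simp add: dvd_eq_mod_eq_0)
  qed auto
qed

text \<open>The cross product of the two translation parts is orthogonal to both. If it vanishes
  modulo P, a vector whose first two coordinates z1, z2 are not both zero yields (-z2, z1, 0); if
  all these coordinates vanish, (1, 0, 0) works.\<close>

lemma exists_orthogonal:
  fixes P :: "'a::unique_euclidean_ring"
  assumes "\<not> P dvd 1"
  shows "\<exists>c1 c2 c3. \<not> (P dvd c1 \<and> P dvd c2 \<and> P dvd c3) \<and>
    P dvd dot (c1, c2, c3) g \<and> P dvd dot (c1, c2, c3) h"
proof -
  obtain u x1 x2 x3 where g: "g = (u, x1, x2, x3)" by (cases g)
  obtain v y1 y2 y3 where h: "h = (v, y1, y2, y3)" by (cases h)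
  define c1 c2 c3 where "c1 = x2 * y3 - x3 * y2" and "c2 = x3 * y1 - x1 * y3" and "c3 = x1 * y2 - x2 * y1"
  show ?thesis
  proof (cases "P dvd c1 \<and> P dvd c2 \<and> P dvd c3")
    case False
    have "dot (c1, c2, c3) g = 0" "dot (c1, c2, c3) h = 0"
      by (simp_all add: c1_def c2_def c3_def g h algebra_simps)
    then show ?thesis using False by (metis dvd_0_right)
  next
    case cross: True
    have *: ?thesis if "P dvd dot c (s, z1, z2, z3) \<longrightarrow> P dvd dot c g \<and> P dvd dot c h"
      "\<not> P dvd z1 \<or> \<not> P dvd z2" "c = (- z2, z1, 0)" for c s z1 z2 z3
    proof -
      have "\<not> (P dvd - z2 \<and> P dvd z1 \<and> P dvd 0) \<and>
          P dvd dot (- z2, z1, 0) g \<and> P dvd dot (- z2, z1, 0) h"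
        using that by (auto simp: mult.commute)
      then show ?thesis by blast
    qed
    have neg: "P dvd z - w \<longleftrightarrow> P dvd w - z" for z w :: 'a
      by (metis dvd_minus_iff minus_diff_eq)
    consider "\<not> P dvd x1 \<or> \<not> P dvd x2" | "\<not> P dvd y1 \<or> \<not> P dvd y2"
      | "P dvd x1" "P dvd x2" "P dvd y1" "P dvd y2" by blast
    then show ?thesis
    proof cases
      case 1
      then show ?thesis using cross
        by (intro *[of "(- x2, x1, 0)" u x1 x2 x3]) (auto simp: g h c3_def algebra_simps)
    next
      case 2
      then show ?thesis using cross neg[of "x1 * y2" "x2 * y1"]
        by (intro *[of "(- y2, y1, 0)" v y1 y2 y3]) (auto simp: g h c3_def algebra_simps)
    next
      case 3
      then show ?thesis using assms by (intro exI[of _ 1] exI[of _ 0] exI[of _ 0]) (simp add: g h)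
    qed
  qed
qed

section \<open>Translations, and rotations of finite order\<close>

lemma aff_nat_pow:
  assumes "1 mod P = 1"
  shows "(u, b1, b2, b3) [^]\<^bsub>aff P\<^esub> (n :: nat) = (u ^ n mod P,
    ((\<Sum>i<n. u ^ i) * b1) mod P, ((\<Sum>i<n. u ^ i) * b2) mod P, ((\<Sum>i<n. u ^ i) * b3) mod P)"
proof (induction n)
  case 0
  then show ?case by (simp add: aff_one)
next
  case (Suc n)
  then show ?case by (simp add: mod_simps mod_mult_add algebra_simps)
qed

lemma aff_translation:
  assumes "1 mod P = 1"
  shows "(1, b1 mod P, b2 mod P, b3 mod P) \<in> carrier (aff P)"
    "(1, b1 mod P, b2 mod P, b3 mod P) [^]\<^bsub>aff P\<^esub> (z :: int) =
      (1, (of_int z * b1) mod P, (of_int z * b2) mod P, (of_int z * b3) mod P)"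
proof -
  interpret group "aff P" by (rule group_aff)
  show closed: "(1, b1 mod P, b2 mod P, b3 mod P) \<in> carrier (aff P)" for b1 b2 b3
    using assms by (auto simp: aff_carrier intro!: exI[of _ 1])
  have nat: "(1, b1 mod P, b2 mod P, b3 mod P) [^]\<^bsub>aff P\<^esub> k =
      (1, (of_nat k * b1) mod P, (of_nat k * b2) mod P, (of_nat k * b3) mod P)" for k
    by (simp add: aff_nat_pow[OF assms] assms mod_simps)
  show "(1, b1 mod P, b2 mod P, b3 mod P) [^]\<^bsub>aff P\<^esub> z =
      (1, (of_int z * b1) mod P, (of_int z * b2) mod P, (of_int z * b3) mod P)"
  proof (cases z)
    case (nonneg k)
    then show ?thesis by (simp only: int_pow_int nat of_int_of_nat_eq)
  next
    case (neg k)
    have "inv\<^bsub>aff P\<^esub> ((1, b1 mod P, b2 mod P, b3 mod P) [^]\<^bsub>aff P\<^esub> Suc k) =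
        (1, (of_int z * b1) mod P, (of_int z * b2) mod P, (of_int z * b3) mod P)"
      unfolding nat using assms
      by (intro inv_equality closed) (simp add: aff_one neg mod_simps algebra_simps)
    then show ?thesis unfolding neg by (simp only: int_pow_neg_int[OF closed])
  qed
qed

text \<open>The N-th power multiplies the translation part by the geometric sum of \<zeta>, which is
  zero. Hence the translation part of a rotation can be chosen freely without changing which of
  these powers are trivial.\<close>

lemma aff_rotation:
  fixes \<zeta> :: complex
  assumes "\<zeta> ^ N = 1" "\<zeta> \<noteq> 1" "N > 0"
  shows "(\<zeta>, b1, b2, b3) \<in> carrier (aff 0)"
    and "int N dvd z \<Longrightarrow> (\<zeta>, b1, b2, b3) [^]\<^bsub>aff 0\<^esub> z = \<one>\<^bsub>aff 0\<^esub>"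
proof -
  interpret group "aff (0 :: complex)" by (rule group_aff)
  have "\<zeta> \<noteq> 0" using assms by (auto simp: zero_power)
  then show c: "(\<zeta>, b1, b2, b3) \<in> carrier (aff 0)"
    by (auto simp: aff_carrier intro!: exI[of _ "inverse \<zeta>"])
  have "(\<Sum>i<N. \<zeta> ^ i) = 0" using assms by (simp add: geometric_sum)
  then have "(\<zeta>, b1, b2, b3) [^]\<^bsub>aff 0\<^esub> N = \<one>\<^bsub>aff 0\<^esub>"
    using assms by (simp add: aff_nat_pow aff_one)
  then have "(\<zeta>, b1, b2, b3) [^]\<^bsub>aff 0\<^esub> (int N * k) = \<one>\<^bsub>aff 0\<^esub>" for k :: int
    using int_pow_pow[OF c, of "int N" k] by (simp add: int_pow_int)
  then show "int N dvd z \<Longrightarrow> (\<zeta>, b1, b2, b3) [^]\<^bsub>aff 0\<^esub> z = \<one>\<^bsub>aff 0\<^esub>"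
    by auto
qed

lemma exists_root_of_unity:
  fixes p :: int
  assumes "prime p"
  shows "\<exists>\<zeta> :: complex. \<zeta> ^ nat p = 1 \<and> \<zeta> \<noteq> 1"
proof (rule ccontr)
  assume "\<not> ?thesis"
  then have "{z :: complex. z ^ nat p = 1} \<subseteq> {1}" by blast
  then have "card {z :: complex. z ^ nat p = 1} \<le> 1"
    using card_mono[of "{1 :: complex}"] by simp
  moreover have "nat p \<ge> 2" using prime_ge_2_int[OF assms] by simp
  ultimately show False using card_roots_unity_eq[of "nat p"] by simp
qed

text \<open>A covector orthogonal to the translation parts of two generators annihilates the whole
  image. Tuples with spanning translation parts contradict this.\<close>

lemma lolli_tuple_aff_dependent:
  assumes "group G" "two_generated G" "l \<ge> 1"
    and "represents (lollipop k l) (lolli_rev k l) (lolli_label q r x y) G"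
    and tuple: "lolli_tuple (aff P) k l q r x y u \<tau>" and "\<not> P dvd 1"
  obtains c1 c2 c3 where "\<not> (P dvd c1 \<and> P dvd c2 \<and> P dvd c3)"
    and "\<And>i. i \<le> k + l \<Longrightarrow> P dvd dot (c1, c2, c3) (u i)" "P dvd dot (c1, c2, c3) \<tau>"
proof -
  interpret group "aff P" by (rule group_aff)
  obtain g h where gh: "g \<in> carrier (aff P)" "h \<in> carrier (aff P)"
    and gen: "insert \<tau> (u ` {..k + l}) \<subseteq> generate (aff P) {g, h}"
    using lolli_tuple_two_generated[OF assms(1,2) group_aff assms(3,4) tuple] by blast
  obtain c1 c2 c3 where c: "\<not> (P dvd c1 \<and> P dvd c2 \<and> P dvd c3)"
    "P dvd dot (c1, c2, c3) g" "P dvd dot (c1, c2, c3) h"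
    using exists_orthogonal[OF assms(6)] by blast
  have "generate (aff P) {g, h} \<subseteq> {g \<in> carrier (aff P). P dvd dot (c1, c2, c3) g}"
    using gh c by (intro generate_subgroup_incl subgroup_dot) auto
  then show ?thesis using gen c(1) by (intro that[of c1 c2 c3]) auto
qed

section \<open>Consequences of 2-generation\<close>

lemma (in bs_group) hom_from_BS:
  assumes "group H" "\<alpha> \<in> carrier H" "\<beta> \<in> carrier H"
    and rel: "\<beta> \<otimes>\<^bsub>H\<^esub> \<alpha> [^]\<^bsub>H\<^esub> m \<otimes>\<^bsub>H\<^esub> inv\<^bsub>H\<^esub> \<beta> = \<alpha> [^]\<^bsub>H\<^esub> n"
  shows "\<exists>\<rho> \<in> hom B H. \<rho> a = \<alpha> \<and> \<rho> t = \<beta>"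
proof -
  interpret H: group H by fact
  define f where "f s = (case s of BS_a \<Rightarrow> \<alpha> | BS_t \<Rightarrow> \<beta>)" for s
  have f: "f \<in> UNIV \<rightarrow> carrier H" using assms(2,3) by (auto simp: f_def split: BS_gen.split)
  have "eval_word H f v = eval_word H f w" if "(v, w) \<in> bs_rel" for v w
    using that rel assms(2,3) H.eval_word_append[OF f, of "gen_pow BS_a m" "[(BS_t, False)]"]
      H.eval_word_gen_pow[of f BS_a]
    by (auto simp: bs_rel_def f_def H.m_assoc)
  from H.hom_from_presented_group[OF f, of bs_rel, OF this] obtain \<rho>
    where \<rho>: "\<rho> \<in> hom (presented_group UNIV bs_rel) H"
      "\<forall>w \<in> words UNIV. \<rho> (word_class UNIV bs_rel w) = eval_word H f w"
    by blast
  have "\<rho> a = \<alpha>" "\<rho> t = \<beta>"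
    using \<rho>(2) assms(2,3) by (simp_all add: a_def t_def cls_def f_def)
  then show ?thesis using \<rho>(1) unfolding B_presented[symmetric] by blast
qed

lemma (in bs_group) hom_generated_subset:
  assumes "group H" "\<rho> \<in> hom B H" "subgroup K H" "S \<subseteq> carrier B" "generate B S = carrier B"
    and "\<rho> ` S \<subseteq> K" and "g \<in> carrier B"
  shows "\<rho> g \<in> K"
proof -
  interpret group_hom B H \<rho>
    using assms by (simp add: group_hom_def group_hom_axioms_def is_group)
  have "\<rho> ` carrier B = generate H (\<rho> ` S)" using generate_img[OF assms(4)] assms(5) by simp
  also have "\<dots> \<subseteq> K" using H.generate_subgroup_incl[OF assms(6,3)] .
  finally show ?thesis using assms(7) by blast
qed

text \<open>
  Otherwise the group would act affinely on \<open>\<complex>\<^sup>3\<close> with \<open>v\<^sub>0\<close> acting as a rotation of order \<open>p\<^sub>1\<close> and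
  everything else through the action of the Baumslag-Solitar group by rotations of order \<open>p\<close>, with
  three independent translation parts.
\<close>

lemma (in bs_group) exponent_origin_coprime:
  assumes G: "group G" "two_generated G" "l \<ge> 1"
    "represents (lollipop k l) (lolli_rev k l) (lolli_label q r x y) G"
    and tuple: "lolli_tuple B k l q r x y u \<tau>"
    and gen: "generate B (insert \<tau> (u ` {..k + l})) = carrier B"
    and "k \<ge> 1" and p: "prime p" "p dvd m" "p dvd n" and p1: "prime p1" "p1 dvd q 0"
    and u0: "h \<in> carrier B" "u 0 = h \<otimes> a [^] e \<otimes> inv h"
  shows "\<not> p dvd (e :: int)"
proof
  assume "p dvd e"
  interpret A: group "aff (0 :: complex)" by (rule group_aff)
  obtain \<zeta> :: complex where \<zeta>: "\<zeta> ^ nat p = 1" "\<zeta> \<noteq> 1" using exists_root_of_unity[OF p(1)] by blast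
  obtain \<zeta>1 :: complex where \<zeta>1: "\<zeta>1 ^ nat p1 = 1" "\<zeta>1 \<noteq> 1" using exists_root_of_unity[OF p1(1)] by blast
  have pos: "nat p > 0" "nat p1 > 0" "int (nat p) = p" "int (nat p1) = p1"
    using prime_gt_0_int[OF p(1)] prime_gt_0_int[OF p1(1)] by auto
  \<comment> \<open>The three translation parts are the basis vectors. The relation of the
    Baumslag-Solitar group holds for \<alpha> and \<beta> because p divides m and n, so both powers
    of \<alpha> are trivial.\<close>
  define \<alpha> where "\<alpha> = (\<zeta>, 0 :: complex, 1 :: complex, 0 :: complex)"
  define \<beta> where "\<beta> = (1 :: complex, 0 :: complex, 0 :: complex, 1 :: complex)"
  define \<gamma> where "\<gamma> = (\<zeta>1, 1 :: complex, 0 :: complex, 0 :: complex)"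
  have \<alpha>: "\<alpha> \<in> carrier (aff 0)" and \<alpha>_pow: "\<And>z. p dvd z \<Longrightarrow> \<alpha> [^]\<^bsub>aff 0\<^esub> z = \<one>\<^bsub>aff 0\<^esub>"
    unfolding \<alpha>_def using aff_rotation[OF \<zeta> pos(1)] pos(3) by auto
  have \<gamma>: "\<gamma> \<in> carrier (aff 0)" and \<gamma>_pow: "\<And>z. p1 dvd z \<Longrightarrow> \<gamma> [^]\<^bsub>aff 0\<^esub> z = \<one>\<^bsub>aff 0\<^esub>"
    unfolding \<gamma>_def using aff_rotation[OF \<zeta>1 pos(2)] pos(4) by auto
  have \<beta>: "\<beta> \<in> carrier (aff 0)" by (auto simp: \<beta>_def aff_carrier intro!: exI[of _ 1])
  have "\<beta> \<otimes>\<^bsub>aff 0\<^esub> \<alpha> [^]\<^bsub>aff 0\<^esub> m \<otimes>\<^bsub>aff 0\<^esub> inv\<^bsub>aff 0\<^esub> \<beta> = \<alpha> [^]\<^bsub>aff 0\<^esub> n"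
    using \<beta> by (simp add: \<alpha>_pow p)
  then obtain \<rho> where \<rho>: "\<rho> \<in> hom B (aff 0)" "\<rho> a = \<alpha>" "\<rho> t = \<beta>"
    using hom_from_BS[OF group_aff \<alpha> \<beta>] by blast
  interpret \<rho>: group_hom B "aff (0 :: complex)" \<rho>
    using \<rho>(1) by (simp add: group_hom_def group_hom_axioms_def is_group group_aff)
  have uc: "u i \<in> carrier B" if "i \<le> k + l" for i using tuple that by (simp add: lolli_tuple_def)
  have \<tau>c: "\<tau> \<in> carrier B" using tuple by (simp add: lolli_tuple_def)
  have \<rho>u0: "\<rho> (u 0) = \<one>\<^bsub>aff 0\<^esub>"
    using u0 \<open>p dvd e\<close> by (simp add: \<rho>.hom_int_pow[symmetric] \<rho>.hom_int_pow \<rho>(2) \<alpha>_pow)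
  \<comment> \<open>With k at least 1, v_0 occurs only in the relation of the first arc edge, whose
    two sides are trivial under \<rho>. As p1 divides q_0, the power of \<gamma> is trivial too, so
    v_0 may be sent to \<gamma> independently of \<rho>.\<close>
  define u' where "u' i = (if i = 0 then \<gamma> else \<rho> (u i))" for i
  have "lolli_tuple (aff 0) k l q r x y u' (\<rho> \<tau>)"
    unfolding lolli_tuple_def
  proof (intro conjI allI impI)
    fix i assume "i \<le> k + l"
    then show "u' i \<in> carrier (aff 0)" using \<gamma> uc by (simp add: u'_def)
  next
    show "\<rho> \<tau> \<in> carrier (aff 0)" using \<tau>c by simp
  next
    fix i assume i: "i < k"
    have eq: "u i [^] q i = u (Suc i) [^] r (Suc i)" using tuple i by (simp add: lolli_tuple_def)
    have "\<rho> (u i) [^]\<^bsub>aff 0\<^esub> q i = \<rho> (u (Suc i)) [^]\<^bsub>aff 0\<^esub> r (Suc i)"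
      using arg_cong[OF eq, of \<rho>] uc i by (simp add: \<rho>.hom_int_pow)
    then show "u' i [^]\<^bsub>aff 0\<^esub> q i = u' (Suc i) [^]\<^bsub>aff 0\<^esub> r (Suc i)"
      using \<gamma>_pow[OF p1(2)] \<rho>u0 by (auto simp: u'_def)
  next
    fix j assume j: "j < l"
    have eq: "u (k + j) [^] x j = u (k + Suc j) [^] y (Suc j)" using tuple j by (simp add: lolli_tuple_def)
    have "\<rho> (u (k + j)) [^]\<^bsub>aff 0\<^esub> x j = \<rho> (u (k + Suc j)) [^]\<^bsub>aff 0\<^esub> y (Suc j)"
      using arg_cong[OF eq, of \<rho>] uc[of "k + j"] uc[of "k + Suc j"] j by (simp add: \<rho>.hom_int_pow)
    then show "u' (k + j) [^]\<^bsub>aff 0\<^esub> x j = u' (k + Suc j) [^]\<^bsub>aff 0\<^esub> y (Suc j)"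
      using \<open>k \<ge> 1\<close> by (simp add: u'_def)
  next
    have "u (k + l) = \<tau> \<otimes> u k \<otimes> inv \<tau>" using tuple by (simp add: lolli_tuple_def)
    then show "u' (k + l) = \<rho> \<tau> \<otimes>\<^bsub>aff 0\<^esub> u' k \<otimes>\<^bsub>aff 0\<^esub> inv\<^bsub>aff 0\<^esub> \<rho> \<tau>"
      using \<open>k \<ge> 1\<close> \<tau>c uc[of k] by (simp add: u'_def)
  qed
  then obtain c1 c2 c3 where c: "\<not> (0 dvd c1 \<and> 0 dvd c2 \<and> 0 dvd c3)"
    "\<And>i. i \<le> k + l \<Longrightarrow> 0 dvd dot (c1, c2, c3) (u' i)" "0 dvd dot (c1, c2, c3) (\<rho> \<tau>)"
    using lolli_tuple_aff_dependent[OF G] by (metis dvd_0_left_iff one_neq_zero)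
  \<comment> \<open>The unmodified images also lie in the kernel of the covector, the one of v_0
    being trivial. They generate the image of \<rho>, so \<alpha> and \<beta> lie there as well;
    together with \<gamma> this kills all three coordinates.\<close>
  define K where "K = {g \<in> carrier (aff 0). 0 dvd dot (c1, c2, c3) g}"
  have "\<rho> (u i) \<in> K" if i: "i \<le> k + l" for i
  proof (cases "i = 0")
    case True
    then show ?thesis using A.one_closed by (simp add: K_def \<rho>u0) (simp add: aff_one)
  next
    case False
    then show ?thesis using c(2)[OF i] uc[OF i] by (simp add: K_def u'_def)
  qed
  then have "\<rho> ` insert \<tau> (u ` {..k + l}) \<subseteq> K" using c(3) \<tau>c by (auto simp: K_def)
  moreover have "subgroup K (aff 0)" unfolding K_def by (rule subgroup_dot)
  moreover have "insert \<tau> (u ` {..k + l}) \<subseteq> carrier B" using uc \<tau>c by auto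
  ultimately have "\<rho> g \<in> K" if "g \<in> carrier B" for g
    using hom_generated_subset[OF group_aff \<rho>(1) _ _ gen _ that] by blast
  from this[of a] this[of t] have "c2 = 0" "c3 = 0" by (auto simp: \<rho> K_def \<alpha>_def \<beta>_def)
  moreover have "c1 = 0" using c(2)[of 0] by (simp add: u'_def \<gamma>_def)
  ultimately show False using c(1) by simp
qed

text \<open>At vertex i, the product of the labels f of the earlier edges and the labels g of the
  later ones is an integer solution E of E i * f i = E (i + 1) * g (i + 1). Exponents along a path
  are chosen in this way below.\<close>

lemma prod_path_step_from:
  fixes f g :: "nat \<Rightarrow> int"
  assumes "b \<le> i" "i < M"
  shows "(\<Prod>j\<in>{b..<i}. f j) * (\<Prod>j\<in>{i<..M}. g j) * f i =
    (\<Prod>j\<in>{b..<Suc i}. f j) * (\<Prod>j\<in>{Suc i<..M}. g j) * g (Suc i)"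
proof -
  have "{i<..M} = insert (Suc i) {Suc i<..M}" "{b..<Suc i} = insert i {b..<i}" using assms by auto
  then show ?thesis by simp
qed

lemmas prod_path_step = prod_path_step_from[OF le0, unfolded atLeast0LessThan]

lemma prime_dvd_prod_int:
  fixes p :: int
  assumes "prime p" "finite A"
  shows "p dvd prod f A \<longleftrightarrow> (\<exists>i \<in> A. p dvd f i)"
  using assms by (simp add: prime_dvd_prod_iff)

text \<open>
  Otherwise the group would act affinely on the three-dimensional space over the field with \<open>p\<close>
  elements, with independent translation parts at a vertex of the arc, at \<open>w\<^sub>0\<close> and for the stable
  letter.
\<close>

lemma prime_dvd_arc_and_attachment:
  assumes G: "group G" "two_generated G" "l \<ge> 1"
    "represents (lollipop k l) (lolli_rev k l) (lolli_label q r x y) G"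
    and "prime p" and "p dvd (\<Prod>i<k. q i)" and rk: "p dvd r k"
  shows "p dvd (\<Prod>j<l. x j) \<or> p dvd (\<Prod>j=1..l. y j)"
proof (rule ccontr)
  assume "\<not> ?thesis"
  then have X: "\<not> p dvd (\<Prod>j<l. x j)" and Y: "\<not> p dvd (\<Prod>j=1..l. y j)" by auto
  have p1: "p > 1" and one: "1 mod p = 1" using prime_gt_1_int[OF \<open>prime p\<close>] by auto
  interpret A: group "aff p" by (rule group_aff)
  have "\<exists>i. i < k \<and> p dvd q i" using assms(5,6) by (auto simp: prime_dvd_prod_int)
  then obtain i' where i': "i' < k" "p dvd q i'" and least: "\<And>i. i < i' \<Longrightarrow> \<not> p dvd q i"
    using exists_least_iff[of "\<lambda>i. i < k \<and> p dvd q i"] by (metis order.strict_trans)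
  define E where "E i = (\<Prod>j<i. q j) * (\<Prod>j\<in>{i<..i'}. r j)" for i
  define f where "f j = (\<Prod>i<j. x i) * (\<Prod>i\<in>{j<..l}. y i)" for j
  have fl: "f l = (\<Prod>j<l. x j)" and f0: "f 0 = (\<Prod>j=1..l. y j)"
  proof -
    have "{0<..l} = {1..l}" by auto
    then show "f l = (\<Prod>j<l. x j)" "f 0 = (\<Prod>j=1..l. y j)" by (simp_all add: f_def)
  qed
  have "coprime (f 0) p" using Y \<open>prime p\<close> by (simp add: f0 prime_imp_coprime coprime_commute)
  then obtain v where v: "(f 0 * v) mod p = 1"
    using bezout_int[of "f 0" p] one by (metis coprime_imp_gcd_eq_1 mod_mult_self2 mult.commute)
  have "coprime (f l) p" using X \<open>prime p\<close> by (simp add: fl prime_imp_coprime coprime_commute)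
  then obtain v' where v': "(f l * v') mod p = 1"
    using bezout_int[of "f l" p] one by (metis coprime_imp_gcd_eq_1 mod_mult_self2 mult.commute)
  \<comment> \<open>The linear part must carry the translation f 0 = Y of w_0 to the translation f l
    = X of w_l. The quotient X / Y modulo p exists and is invertible because p divides
    neither.\<close>
  define \<tau> where "\<tau> = ((f l * v) mod p, 0 :: int, 0 :: int, 1 :: int)"
  have \<tau>: "\<tau> \<in> carrier (aff p)"
  proof -
    have "((f l * v) mod p * (f 0 * v')) mod p = ((f l * v) * (f 0 * v')) mod p"
      by (simp only: mod_mult_left_eq)
    also have "(f l * v) * (f 0 * v') = (f l * v') * (f 0 * v)" by (simp only: ac_simps)
    also have "(f l * v') * (f 0 * v) mod p = ((f l * v') mod p * ((f 0 * v) mod p)) mod p"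
      by (simp only: mod_mult_eq)
    also have "\<dots> = 1 mod p" by (simp add: v v')
    finally show ?thesis using one by (auto simp: \<tau>_def aff_carrier)
  qed
  \<comment> \<open>The first coordinate lives on v_0, ..., v_i' and the second on the circle. The
    two blocks are independent: the label q_i' kills the first and r_k kills the second, both being
    divisible by p.\<close>
  define u where "u i = (if i \<le> i' then (1 :: int, E i mod p, 0 mod p, 0 mod p)
    else if i < k then (1, 0 mod p, 0 mod p, 0 mod p) else (1, 0 mod p, f (i - k) mod p, 0 mod p))" for i
  have u_pow: "u i [^]\<^bsub>aff p\<^esub> z = (if i \<le> i' then (1, (z * E i) mod p, 0, 0)
    else if i < k then (1, 0, 0, 0) else (1, 0, (z * f (i - k)) mod p, 0))" for i and z :: int
    using aff_translation(2)[OF one, of "E i" 0 0 z] aff_translation(2)[OF one, of 0 0 0 z]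
      aff_translation(2)[OF one, of 0 "f (i - k)" 0 z]
    by (simp add: u_def)
  have uc: "u i \<in> carrier (aff p)" for i
    using aff_translation(1)[OF one, of "E i" 0 0] aff_translation(1)[OF one, of 0 0 0]
      aff_translation(1)[OF one, of 0 "f (i - k)" 0]
    by (simp add: u_def)
  have "lolli_tuple (aff p) k l q r x y u \<tau>"
    unfolding lolli_tuple_def
  proof (intro conjI allI impI uc \<tau>)
    fix i assume i: "i < k"
    consider "i < i'" | "i = i'" "Suc i < k" | "i = i'" "Suc i = k" | "i > i'" "Suc i < k" | "i > i'" "Suc i = k"
      using i by linarith
    then show "u i [^]\<^bsub>aff p\<^esub> q i = u (Suc i) [^]\<^bsub>aff p\<^esub> r (Suc i)"
    proof cases
      case 1
      then have "E i * q i = E (Suc i) * r (Suc i)" unfolding E_def by (rule prod_path_step)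
      then show ?thesis using 1 by (simp add: u_pow mult.commute)
    qed (use i' rk i in \<open>auto simp: u_pow\<close>)
  next
    fix j assume j: "j < l"
    then have "f j * x j = f (Suc j) * y (Suc j)" unfolding f_def by (rule prod_path_step)
    then show "u (k + j) [^]\<^bsub>aff p\<^esub> x j = u (k + Suc j) [^]\<^bsub>aff p\<^esub> y (Suc j)"
      using i'(1) by (simp add: u_pow mult.commute)
  next
    have "u (k + l) \<otimes>\<^bsub>aff p\<^esub> \<tau> = ((f l * v) mod p, 0, f l mod p, 1 mod p)"
      using i'(1) by (simp add: u_def \<tau>_def mod_simps)
    also have "f l mod p = (f l * (f 0 * v mod p)) mod p" by (simp add: v)
    also have "\<dots> = (f l * (f 0 * v)) mod p" by (simp only: mod_mult_right_eq)
    also have "f l * (f 0 * v) = (f l * v) * f 0" by (simp only: ac_simps)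
    also have "(f l * v) * f 0 mod p = ((f l * v) mod p * (f 0 mod p)) mod p"
      by (simp only: mod_mult_eq)
    also have "((f l * v) mod p, 0, \<dots>, 1 mod p) = \<tau> \<otimes>\<^bsub>aff p\<^esub> u k"
      using i'(1) by (simp add: u_def \<tau>_def mod_simps)
    finally have "u (k + l) \<otimes>\<^bsub>aff p\<^esub> \<tau> = \<tau> \<otimes>\<^bsub>aff p\<^esub> u k" .
    then show "u (k + l) = \<tau> \<otimes>\<^bsub>aff p\<^esub> u k \<otimes>\<^bsub>aff p\<^esub> inv\<^bsub>aff p\<^esub> \<tau>"
      using uc \<tau> by (metis A.inv_solve_right A.m_closed)
  qed
  then obtain c1 c2 c3 where c: "\<not> (p dvd c1 \<and> p dvd c2 \<and> p dvd c3)"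
    "\<And>i. i \<le> k + l \<Longrightarrow> p dvd dot (c1, c2, c3) (u i)" "p dvd dot (c1, c2, c3) \<tau>"
    using lolli_tuple_aff_dependent[OF G, of p u \<tau>] p1 by (metis zdvd_not_zless zero_less_one)
  have "\<not> p dvd E i'" using least \<open>prime p\<close> by (simp add: E_def prime_dvd_prod_int)
  then have "p dvd c1" using c(2)[of i'] i'(1) \<open>prime p\<close>
    by (simp add: u_def prime_dvd_mult_iff dvd_mod_iff)
  moreover have "p dvd c2" using c(2)[of k] i'(1) \<open>prime p\<close> Y
    by (simp add: u_def prime_dvd_mult_iff dvd_mod_iff f0)
  moreover have "p dvd c3" using c(3) by (simp add: \<tau>_def)
  ultimately show False using c(1) by simp
qed


section \<open>Exponents modulo p on a circle\<close>

lemma subgroup_translations: "subgroup {g \<in> carrier (aff P). fst g = 1 mod P} (aff P)"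
proof -
  interpret group "aff P" by (rule group_aff)
  show ?thesis
  proof (rule subgroupI)
    have "\<one>\<^bsub>aff P\<^esub> \<in> {g \<in> carrier (aff P). fst g = 1 mod P}"
      using one_closed by (simp add: aff_one)
    then show "{g \<in> carrier (aff P). fst g = 1 mod P} \<noteq> {}" by blast
  next
    fix g assume g: "g \<in> {g \<in> carrier (aff P). fst g = 1 mod P}"
    obtain u b1 b2 b3 where inv: "inv\<^bsub>aff P\<^esub> g = (u, b1, b2, b3)" by (cases "inv\<^bsub>aff P\<^esub> g")
    obtain c1 c2 c3 where g': "g = (1 mod P, c1, c2, c3)" using g by (cases g) auto
    have invc: "inv\<^bsub>aff P\<^esub> g \<in> carrier (aff P)" using g by simp
    then have "u mod P = u" by (simp add: inv aff_carrier)
    moreover have "inv\<^bsub>aff P\<^esub> g \<otimes>\<^bsub>aff P\<^esub> g = \<one>\<^bsub>aff P\<^esub>" using g by simp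
    then have "u mod P = 1 mod P" unfolding inv unfolding g' by (simp add: aff_one mod_simps)
    ultimately show "inv\<^bsub>aff P\<^esub> g \<in> {g \<in> carrier (aff P). fst g = 1 mod P}" using invc by (simp add: inv)
  next
    fix g h assume gh: "g \<in> {g \<in> carrier (aff P). fst g = 1 mod P}" "h \<in> {g \<in> carrier (aff P). fst g = 1 mod P}"
    obtain b1 b2 b3 where g: "g = (1 mod P, b1, b2, b3)" using gh by (cases g) auto
    obtain c1 c2 c3 where h: "h = (1 mod P, c1, c2, c3)" using gh by (cases h) auto
    show "g \<otimes>\<^bsub>aff P\<^esub> h \<in> {g \<in> carrier (aff P). fst g = 1 mod P}"
      using gh m_closed[of g h] by (simp add: g h mod_simps)
  qed auto
qed

lemma connected_interval:
  assumes "verts T = {lo..hi::nat}" "lo \<le> hi"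
    and edge: "\<And>j. lo \<le> j \<Longrightarrow> j < hi \<Longrightarrow> \<exists>e \<in> arcs T. tail T e = j \<and> head T e = Suc j"
  shows "connected T"
proof -
  define R where "R = parcs (mk_symmetric T)"
  have step: "(j, Suc j) \<in> R" "(Suc j, j) \<in> R" if "lo \<le> j" "j < hi" for j
    using edge[OF that] by (auto simp: R_def mk_symmetric_def) metis+
  have path: "(lo, lo + d) \<in> rtrancl_on {lo..hi} R \<and> (lo + d, lo) \<in> rtrancl_on {lo..hi} R"
    if "lo + d \<le> hi" for d
    using that
  proof (induction d)
    case (Suc d)
    have "(lo + d, lo + Suc d) \<in> R" "(lo + Suc d, lo + d) \<in> R" using step[of "lo + d"] Suc.prems by auto
    moreover have "(lo + Suc d, lo + Suc d) \<in> rtrancl_on {lo..hi} R" using Suc.prems by auto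
    moreover have mem: "lo + d \<in> {lo..hi}" "lo + Suc d \<in> {lo..hi}" using Suc.prems by auto
    ultimately have "(lo + Suc d, lo + d) \<in> rtrancl_on {lo..hi} R"
      by (blast intro: rtrancl_on_into_rtrancl_on)
    moreover have "(lo, lo + d) \<in> rtrancl_on {lo..hi} R" "(lo + d, lo) \<in> rtrancl_on {lo..hi} R"
      using Suc by auto
    ultimately show ?case
      using \<open>(lo + d, lo + Suc d) \<in> R\<close> mem by (blast intro: rtrancl_on_into_rtrancl_on rtrancl_on_trans)
  qed (use assms(2) in auto)
  have "(u, v) \<in> rtrancl_on {lo..hi} R" if "u \<in> {lo..hi}" "v \<in> {lo..hi}" for u v
    using path[of "u - lo"] path[of "v - lo"] that by (auto intro: rtrancl_on_trans)
  then show ?thesis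
    using assms(1,2)
    by (auto simp: connected_def strongly_connected_def reachable_def R_def mk_symmetric_def arcs_ends_conv)
qed

text \<open>
  The vertices of the circle whose exponents are prime to \<open>p\<close> form a union of \<open>p\<close>-plateaus, which is
  nonempty by surjectivity.
\<close>

lemma (in bs_group) circle_exponent_coprime:
  assumes "l \<ge> 1" and tuple: "lolli_tuple B 0 l q r x y u \<tau>"
    and gen: "generate B (insert \<tau> (u ` {..0 + l})) = carrier B"
    and p: "prime p" "p dvd m" "p dvd n"
    and ell: "\<And>i. i \<le> l \<Longrightarrow> h i \<in> carrier B \<and> u i = h i \<otimes> a [^] (e i :: int) \<otimes> inv h i"
    and plateau: "\<And>P. is_plateau (lollipop 0 l) (lolli_rev 0 l) (lolli_label q r x y) P \<Longrightarrow> 0 \<in> verts P"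
  shows "\<not> p dvd e 0"
proof
  assume e0: "p dvd e 0"
  have one: "1 mod p = 1" and p1: "\<not> p dvd 1" using prime_gt_1_int[OF p(1)] by auto
  interpret A: group "aff p" by (rule group_aff)
  \<comment> \<open>Since p divides m and n, the group maps onto a two-dimensional vector space over
    the field with p elements, realised by translations. Conjugations become invisible and the
    exponents can be read off modulo p.\<close>
  define \<alpha> where "\<alpha> = (1 :: int, 1 mod p, 0 mod p, 0 mod p)"
  define \<beta> where "\<beta> = (1 :: int, 0 mod p, 1 mod p, 0 mod p)"
  have \<alpha>: "\<alpha> \<in> carrier (aff p)" and \<beta>: "\<beta> \<in> carrier (aff p)"
    unfolding \<alpha>_def \<beta>_def by (rule aff_translation(1)[OF one])+
  have \<alpha>_pow: "\<alpha> [^]\<^bsub>aff p\<^esub> z = (1, z mod p, 0, 0)" for z :: int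
    unfolding \<alpha>_def aff_translation(2)[OF one] by simp
  have "\<alpha> [^]\<^bsub>aff p\<^esub> z = \<one>\<^bsub>aff p\<^esub>" if "p dvd z" for z using that by (simp add: \<alpha>_pow aff_one one)
  then have "\<beta> \<otimes>\<^bsub>aff p\<^esub> \<alpha> [^]\<^bsub>aff p\<^esub> m \<otimes>\<^bsub>aff p\<^esub> inv\<^bsub>aff p\<^esub> \<beta> = \<alpha> [^]\<^bsub>aff p\<^esub> n"
    using \<beta> p by simp
  then obtain \<rho> where \<rho>: "\<rho> \<in> hom B (aff p)" "\<rho> a = \<alpha>" "\<rho> t = \<beta>"
    using hom_from_BS[OF group_aff \<alpha> \<beta>] by blast
  interpret \<rho>: group_hom B "aff p" \<rho>
    using \<rho>(1) by (simp add: group_hom_def group_hom_axioms_def is_group group_aff)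
  have uc: "u i \<in> carrier B" if "i \<le> l" for i using tuple that by (simp add: lolli_tuple_def)
  have \<tau>c: "\<tau> \<in> carrier B" using tuple by (simp add: lolli_tuple_def)
  have fst: "fst (\<rho> g) = 1" if "g \<in> carrier B" for g
  proof -
    have "\<rho> g \<in> {g \<in> carrier (aff p). fst g = 1 mod p}"
      by (rule hom_generated_subset[OF group_aff \<rho>(1) subgroup_translations _ generate_gens _ that])
        (use \<alpha> \<beta> in \<open>auto simp: \<rho> \<alpha>_def \<beta>_def one\<close>)
    then show ?thesis using one by simp
  qed
  have comm: "\<rho> g \<otimes>\<^bsub>aff p\<^esub> \<rho> g' = \<rho> g' \<otimes>\<^bsub>aff p\<^esub> \<rho> g" if "g \<in> carrier B" "g' \<in> carrier B" for g g'
    using fst[OF that(1)] fst[OF that(2)] by (cases "\<rho> g"; cases "\<rho> g'") (simp add: add.commute)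
  have conj: "\<rho> (g \<otimes> g' \<otimes> inv g) = \<rho> g'" if "g \<in> carrier B" "g' \<in> carrier B" for g g'
    using that comm[of g g'] by (simp add: A.m_assoc)
  have \<rho>_pow: "\<rho> (u i [^] z) = (1, (e i * z) mod p, 0, 0)" if "i \<le> l" for i and z :: int
  proof -
    have "u i [^] z = h i \<otimes> a [^] (e i * z) \<otimes> inv h i"
      using ell[OF that] by (simp add: int_pow_conjugate int_pow_pow)
    then have "\<rho> (u i [^] z) = \<rho> (a [^] (e i * z))"
      using ell[OF that] conj[of "h i" "a [^] (e i * z)"] by (simp only: gens_closed int_pow_closed)
    then show ?thesis by (simp add: \<rho>.hom_int_pow \<rho>(2) \<alpha>_pow)
  qed
  have edge: "p dvd e j \<or> p dvd x j \<longleftrightarrow> p dvd e (Suc j) \<or> p dvd y (Suc j)" if "j < l" for j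
  proof -
    have "u j [^] x j = u (Suc j) [^] y (Suc j)" using tuple that by (simp add: lolli_tuple_def)
    then have "(e j * x j) mod p = (e (Suc j) * y (Suc j)) mod p"
      using \<rho>_pow[of j "x j"] \<rho>_pow[of "Suc j" "y (Suc j)"] that by simp
    then have "p dvd e j * x j \<longleftrightarrow> p dvd e (Suc j) * y (Suc j)" by (simp add: dvd_eq_mod_eq_0)
    then show ?thesis using p(1) by (simp add: prime_dvd_mult_iff)
  qed
  have el: "p dvd e l"
  proof -
    have "u l = \<tau> \<otimes> u 0 \<otimes> inv \<tau>" using tuple by (simp add: lolli_tuple_def)
    then have "\<rho> (u l) = \<rho> (u 0)" using conj[OF \<tau>c uc[OF le0]] by (simp only:)
    then have "\<rho> (u l [^] (1 :: int)) = \<rho> (u 0 [^] (1 :: int))" using uc by simp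
    then show ?thesis unfolding \<rho>_pow[OF order.refl] \<rho>_pow[OF le0] using e0 by (simp add: dvd_eq_mod_eq_0)
  qed
  \<comment> \<open>Otherwise all vertices become trivial and \<tau> alone would have to span a
    two-dimensional space.\<close>
  have "\<exists>s \<le> l. \<not> p dvd e s"
  proof (rule ccontr)
    assume "\<not> ?thesis"
    then have u1: "\<rho> (u i) = (1, 0, 0, 0)" if "i \<le> l" for i
      using \<rho>_pow[OF that, of 1] uc[OF that] that by simp
    obtain s1 s2 s3 where \<rho>\<tau>: "\<rho> \<tau> = (1, s1, s2, s3)" using fst[OF \<tau>c] by (cases "\<rho> \<tau>") auto
    obtain c1 c2 where c: "\<not> (p dvd c1 \<and> p dvd c2)" "p dvd c1 * s1 + c2 * s2"
    proof (cases "p dvd s1 \<and> p dvd s2")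
      case True
      then show ?thesis using p1 by (intro that[of 1 0]) auto
    next
      case False
      then show ?thesis by (intro that[of s2 "- s1"]) (auto simp: mult.commute)
    qed
    define K where "K = {g \<in> carrier (aff p). p dvd dot (c1, c2, 0) g}"
    have "subgroup K (aff p)" unfolding K_def by (rule subgroup_dot)
    moreover have "insert \<tau> (u ` {..0 + l}) \<subseteq> carrier B" using uc \<tau>c by auto
    moreover have "\<rho> ` insert \<tau> (u ` {..0 + l}) \<subseteq> K"
      using c(2) \<rho>.hom_closed[OF \<tau>c] \<rho>.hom_closed[OF uc] by (auto simp: K_def u1 \<rho>\<tau>)
    ultimately have "\<rho> g \<in> K" if "g \<in> carrier B" for g
      using hom_generated_subset[OF group_aff \<rho>(1) _ _ gen _ that] by blast
    from this[of a] this[of t] show False using c(1) by (auto simp: K_def \<rho> \<alpha>_def \<beta>_def one)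
  qed
  then obtain s where s: "s \<le> l" "\<not> p dvd e s" by blast
  \<comment> \<open>From s the segment is extended to the left as long as no y label is divisible by
    p, and to the right in the same way with the x labels. Its ends then carry labels divisible by
    p, which makes it a p-plateau.\<close>
  define L where "L i \<longleftrightarrow> i \<le> s \<and> (\<forall>j. i \<le> j \<and> j < s \<longrightarrow> \<not> p dvd y (Suc j))" for i
  define lo where "lo = (LEAST i. L i)"
  have "L s" by (auto simp: L_def)
  then have "L lo" unfolding lo_def by (rule LeastI)
  then have lo: "lo \<le> s" "\<And>j. lo \<le> j \<Longrightarrow> j < s \<Longrightarrow> \<not> p dvd y (Suc j)" by (auto simp: L_def)
  have backward: "\<not> p dvd e (s - d)" if "s - d \<ge> lo" for d
    using that
  proof (induction d)
    case (Suc d)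
    show ?case
    proof (cases "d < s")
      case True
      then have "Suc (s - Suc d) = s - d" by simp
      then show ?thesis using Suc edge[of "s - Suc d"] lo(2)[of "s - Suc d"] s(1) True by auto
    qed (use Suc in simp)
  qed (use s in simp)
  have low: "\<not> p dvd e i" if "lo \<le> i" "i \<le> s" for i using backward[of "s - i"] that by simp
  have "lo \<noteq> 0" using low[of 0] e0 lo(1) by auto
  have y_lo: "p dvd y lo"
  proof (rule ccontr)
    assume y: "\<not> p dvd y lo"
    have "\<not> p dvd y (Suc j)" if "lo - 1 \<le> j" "j < s" for j
      using lo(2)[of j] that y \<open>lo \<noteq> 0\<close> by (cases "j = lo - 1") auto
    then have "L (lo - 1)" using lo(1) by (simp add: L_def)
    then have "lo \<le> lo - 1" unfolding lo_def by (rule Least_le)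
    then show False using \<open>lo \<noteq> 0\<close> by simp
  qed
  define R where "R i \<longleftrightarrow> s \<le> i \<and> (i \<ge> l \<or> p dvd x i)" for i
  define hi where "hi = (LEAST i. R i)"
  have "R l" using s(1) by (simp add: R_def)
  then have "R hi" unfolding hi_def by (rule LeastI)
  then have hi: "s \<le> hi" "hi \<ge> l \<or> p dvd x hi" by (auto simp: R_def)
  have x_hi: "j < l" "\<not> p dvd x j" if "s \<le> j" "j < hi" for j
    using not_less_Least[of j R] that by (auto simp: hi_def R_def)
  have high: "\<not> p dvd e (s + d)" if "s + d \<le> hi" for d
    using that
  proof (induction d)
    case (Suc d)
    then show ?case using edge[of "s + d"] x_hi[of "s + d"] by auto
  qed (use s in simp)
  \<comment> \<open>The exponents stay prime to p throughout the segment, while those at w_0 and at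
    its translate w_l are divisible by p. So the segment reaches neither end.\<close>
  have hi_less: "hi < l"
  proof (rule ccontr)
    assume "\<not> hi < l"
    then show False using high[of "l - s"] el s(1) by auto
  qed
  have inner: "\<not> p dvd x j" "\<not> p dvd y (Suc j)" if j: "lo \<le> j" "j < hi" for j
  proof -
    have "\<not> p dvd x j \<and> \<not> p dvd y (Suc j)"
    proof (cases "j < s")
      case True
      then show ?thesis using lo(2)[OF j(1) True] edge[of j] low[of "Suc j"] j s(1) by auto
    next
      case False
      then show ?thesis using x_hi[of j] j edge[of j] high[of "j - s"] by auto
    qed
    then show "\<not> p dvd x j" "\<not> p dvd y (Suc j)" by auto
  qed
  have xhi: "p dvd x hi" using hi(2) hi_less by simp
  define P where "P = \<lparr>verts = {lo..hi}, arcs = Circ ` {lo..<hi} \<times> UNIV,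
    tail = tail (lollipop 0 l), head = head (lollipop 0 l)\<rparr>"
  have Psimps: "verts P = {lo..hi}" "arcs P = Circ ` {lo..<hi} \<times> UNIV"
    "tail P = tail (lollipop 0 l)" "head P = head (lollipop 0 l)" by (simp_all add: P_def)
  have sub: "subgraph P (lollipop 0 l)"
    unfolding subgraph_def
  proof (intro conjI)
    show "wf_digraph (lollipop 0 l)" by (rule wf_lollipop[OF assms(1)])
    show "wf_digraph P"
    proof
      fix e assume "e \<in> arcs P"
      then obtain j b where e: "e = (Circ j, b)" "lo \<le> j" "j < hi" by (auto simp: Psimps)
      then show "tail P e \<in> verts P" "head P e \<in> verts P"
        using hi_less by (cases b; simp add: Psimps)+
    qed
  qed (use hi_less in \<open>auto simp: Psimps compatible_def\<close>)
  have rev: "lolli_rev 0 l ` arcs P \<subseteq> arcs P"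
    using hi_less by (auto simp: Psimps lolli_rev_def)
  have conn: "connected P"
  proof (rule connected_interval[OF Psimps(1)])
    show "lo \<le> hi" using lo(1) hi(1) by simp
    fix j assume "lo \<le> j" "j < hi"
    then show "\<exists>e \<in> arcs P. tail P e = j \<and> head P e = Suc j"
      using hi_less by (intro bexI[of _ "(Circ j, True)"]) (auto simp: Psimps)
  qed
  have "p dvd lolli_label q r x y e \<longleftrightarrow> e \<notin> arcs P"
    if e: "e \<in> arcs (lollipop 0 l)" "tail (lollipop 0 l) e \<in> verts P" for e
  proof -
    obtain j b where eb: "e = (Circ j, b)" and j: "j < l" using e(1) by (auto simp: lolli_arcs_def)
    show ?thesis
    proof (cases b)
      case True
      then show ?thesis using e(2) eb j inner[of j] xhi by (cases "j = hi") (auto simp: Psimps)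
    next
      case False
      \<comment> \<open>The origin of the reversed edge is w_(j+1). For j = l - 1 this is w_0, which
        is outside because \<open>lo\<close> is not 0.\<close>
      then have mem: "Suc j mod l \<in> {lo..hi}" using e(2) eb by (simp add: Psimps)
      then have "Suc j < l" using j \<open>lo \<noteq> 0\<close> by (cases "Suc j = l") auto
      then show ?thesis using False mem eb inner[of j] y_lo by (cases "Suc j = lo") (auto simp: Psimps)
    qed
  qed
  then have "is_plateau (lollipop 0 l) (lolli_rev 0 l) (lolli_label q r x y) P"
    unfolding is_plateau_def is_p_plateau_def rv_subgraph_def using p(1) sub rev conn by blast
  then have "0 \<in> verts P" by (rule plateau)
  then show False using \<open>lo \<noteq> 0\<close> by (simp add: Psimps)
qed

section \<open>From an epimorphism to the arithmetic conditions\<close>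

definition (in group) commensurable :: "'a \<Rightarrow> 'a \<Rightarrow> bool" where
  "commensurable g h \<longleftrightarrow> (\<exists>(A :: int) (C :: int). A \<noteq> 0 \<and> C \<noteq> 0 \<and> g [^] A = h [^] C)"

context group
begin

lemma commensurable_refl [simp]: "commensurable g g"
  unfolding commensurable_def by (intro exI[of _ 1]) simp

lemma commensurable_sym: "commensurable g h \<Longrightarrow> commensurable h g"
  unfolding commensurable_def by metis

lemma commensurable_trans:
  assumes "commensurable f g" "commensurable g h" "f \<in> carrier G" "g \<in> carrier G" "h \<in> carrier G"
  shows "commensurable f h"
proof -
  obtain A C A' C' :: int where AC: "A \<noteq> 0" "C \<noteq> 0" "f [^] A = g [^] C" "A' \<noteq> 0" "C' \<noteq> 0" "g [^] A' = h [^] C'"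
    using assms(1,2) unfolding commensurable_def by blast
  have "f [^] (A * A') = (g [^] A') [^] C"
    using AC(3) assms by (metis int_pow_pow mult.commute)
  also have "\<dots> = h [^] (C' * C)" using AC(6) assms by (simp add: int_pow_pow)
  finally show ?thesis unfolding commensurable_def using AC by (metis mult_eq_0_iff)
qed

lemma commensurable_conj:
  assumes "commensurable g h" "s \<in> carrier G" "g \<in> carrier G" "h \<in> carrier G"
  shows "commensurable (s \<otimes> g \<otimes> inv s) (s \<otimes> h \<otimes> inv s)"
  using assms unfolding commensurable_def by (auto simp: int_pow_conjugate)

lemma subgroup_commensurator:
  assumes z: "z \<in> carrier G"
  shows "subgroup {g \<in> carrier G. commensurable (g \<otimes> z \<otimes> inv g) z} G"
proof (rule subgroupI)
  have "\<one> \<in> {g \<in> carrier G. commensurable (g \<otimes> z \<otimes> inv g) z}" using z by simp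
  then show "{g \<in> carrier G. commensurable (g \<otimes> z \<otimes> inv g) z} \<noteq> {}" by blast
next
  fix g assume "g \<in> {g \<in> carrier G. commensurable (g \<otimes> z \<otimes> inv g) z}"
  then have g: "g \<in> carrier G" "commensurable (g \<otimes> z \<otimes> inv g) z" by auto
  have "commensurable (inv g \<otimes> (g \<otimes> z \<otimes> inv g) \<otimes> inv (inv g)) (inv g \<otimes> z \<otimes> inv (inv g))"
    using g z by (intro commensurable_conj) auto
  moreover have "inv g \<otimes> (g \<otimes> z \<otimes> inv g) \<otimes> inv (inv g) = z"
    using g z conj_inverse[OF g(1) z _ HOL.refl] by simp
  ultimately show "inv g \<in> {g \<in> carrier G. commensurable (g \<otimes> z \<otimes> inv g) z}"
    using g commensurable_sym by simp
next
  fix g h assume "g \<in> {g \<in> carrier G. commensurable (g \<otimes> z \<otimes> inv g) z}"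
    "h \<in> {g \<in> carrier G. commensurable (g \<otimes> z \<otimes> inv g) z}"
  then have g: "g \<in> carrier G" "commensurable (g \<otimes> z \<otimes> inv g) z"
    and h: "h \<in> carrier G" "commensurable (h \<otimes> z \<otimes> inv h) z" by auto
  have "commensurable (g \<otimes> (h \<otimes> z \<otimes> inv h) \<otimes> inv g) (g \<otimes> z \<otimes> inv g)"
    using g h z by (intro commensurable_conj) auto
  then have "commensurable (g \<otimes> (h \<otimes> z \<otimes> inv h) \<otimes> inv g) z"
    using g h z by (elim commensurable_trans) auto
  moreover have "g \<otimes> (h \<otimes> z \<otimes> inv h) \<otimes> inv g = g \<otimes> h \<otimes> z \<otimes> inv (g \<otimes> h)"
    using g h z by (simp add: m_assoc inv_mult_group)
  ultimately show "g \<otimes> h \<in> {g \<in> carrier G. commensurable (g \<otimes> z \<otimes> inv g) z}"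
    using g h by simp
qed auto

lemma lolli_tuple_commensurable:
  assumes tuple: "lolli_tuple G k l q r x y u \<tau>"
    and "\<forall>i<k. q i \<noteq> 0 \<and> r (Suc i) \<noteq> 0" "\<forall>j<l. x j \<noteq> 0 \<and> y (Suc j) \<noteq> 0"
    and "i \<le> k + l" "j \<le> k + l"
  shows "commensurable (u i) (u j)"
proof -
  have uc: "u i \<in> carrier G" if "i \<le> k + l" for i using tuple that by (simp add: lolli_tuple_def)
  have step: "commensurable (u i) (u (Suc i))" if i: "i < k + l" for i
  proof (cases "i < k")
    case True
    then have "u i [^] q i = u (Suc i) [^] r (Suc i)" using tuple by (simp add: lolli_tuple_def)
    then show ?thesis using assms(2) True by (auto simp: commensurable_def)
  next
    case False
    then obtain j where "i = k + j" "j < l" using i by (metis add_less_cancel_left le_Suc_ex not_less)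
    then have "u i [^] x j = u (Suc i) [^] y (Suc j)" using tuple by (simp add: lolli_tuple_def)
    then show ?thesis using assms(3) \<open>j < l\<close> by (auto simp: commensurable_def)
  qed
  have "commensurable (u 0) (u i)" if "i \<le> k + l" for i
    using that
  proof (induction i)
    case (Suc i)
    then show ?case using step[of i] uc by (auto elim!: commensurable_trans)
  qed simp
  then show ?thesis using assms(4,5) uc
    by (meson commensurable_sym commensurable_trans le0)
qed

end

context bs_group
begin

text \<open>All vertex generators are commensurable along the edges. Each commutes with itself,
  hence commensurates every other one; \<tau> carries \<open>u k\<close> to \<open>u (k + l)\<close>
  and does the same. So the commensurator of \<open>u i\<close> is everything.\<close>

lemma lolli_tuple_elliptic:
  assumes tuple: "lolli_tuple B k l q r x y u \<tau>"
    and labels: "\<forall>i<k. q i \<noteq> 0 \<and> r (Suc i) \<noteq> 0" "\<forall>j<l. x j \<noteq> 0 \<and> y (Suc j) \<noteq> 0"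
    and gen: "generate B (insert \<tau> (u ` {..k + l})) = carrier B"
    and units: "\<not> is_unit m" "\<not> is_unit n" and i: "i \<le> k + l"
  shows "\<exists>h \<in> carrier B. \<exists>e :: int. u i = h \<otimes> a [^] e \<otimes> inv h"
proof (rule commensurating_imp_elliptic[OF _ units])
  have uc: "u j \<in> carrier B" if "j \<le> k + l" for j using tuple that by (simp add: lolli_tuple_def)
  have \<tau>c: "\<tau> \<in> carrier B" using tuple by (simp add: lolli_tuple_def)
  note comm = lolli_tuple_commensurable[OF tuple labels]
  show "u i \<in> carrier B" using uc i .
  define K where "K = {g \<in> carrier B. commensurable (g \<otimes> u i \<otimes> inv g) (u i)}"
  have "u j \<in> K" if j: "j \<le> k + l" for j
  proof -
    have "commensurable (u j \<otimes> u i \<otimes> inv u j) (u j \<otimes> u j \<otimes> inv u j)"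
      using comm[OF i j] uc i j by (intro commensurable_conj) auto
    then have "commensurable (u j \<otimes> u i \<otimes> inv u j) (u j)" using uc[OF j] by (simp add: m_assoc)
    then show ?thesis using comm[OF j i] uc i j by (auto simp: K_def elim!: commensurable_trans)
  qed
  moreover have "\<tau> \<in> K"
  proof -
    have "commensurable (\<tau> \<otimes> u i \<otimes> inv \<tau>) (\<tau> \<otimes> u k \<otimes> inv \<tau>)"
      using comm[OF i, of k] uc i \<tau>c by (intro commensurable_conj) auto
    then have "commensurable (\<tau> \<otimes> u i \<otimes> inv \<tau>) (u (k + l))" using tuple by (simp add: lolli_tuple_def)
    then show ?thesis using comm[OF order.refl i] uc i \<tau>c by (auto simp: K_def elim!: commensurable_trans)
  qed
  ultimately have "generate B (insert \<tau> (u ` {..k + l})) \<subseteq> K"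
    unfolding K_def using uc[OF i] by (intro generate_subgroup_incl subgroup_commensurator) auto
  then have "commensurable (g \<otimes> u i \<otimes> inv g) (u i)" if "g \<in> carrier B" for g
    using that gen by (auto simp: K_def)
  then show "\<exists>(N :: int) (M :: int). N \<noteq> 0 \<and> M \<noteq> 0 \<and> g \<otimes> u i [^] N \<otimes> inv g = u i [^] M"
    if "g \<in> carrier B" for g
    using that uc[OF i] by (auto simp: commensurable_def int_pow_conjugate)
qed

section \<open>Walking along the lollipop inside a vertex stabiliser\<close>

definition a_powers where "a_powers = range (\<lambda>z :: int. a [^] z)"

lemma subgroup_a_powers: "subgroup a_powers B"
proof (rule subgroupI)
  fix g h assume "g \<in> a_powers" "h \<in> a_powers"
  then obtain y z :: int where "g = a [^] y" "h = a [^] z" by (auto simp: a_powers_def)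
  then show "g \<otimes> h \<in> a_powers" by (auto simp: a_powers_def simp flip: int_pow_mult)
next
  fix g assume "g \<in> a_powers"
  then obtain z :: int where "g = a [^] z" by (auto simp: a_powers_def)
  then show "inv g \<in> a_powers" by (auto simp: a_powers_def simp flip: int_pow_neg)
qed (auto simp: a_powers_def)

lemma proper_a_powers: "\<not> carrier B \<subseteq> a_powers"
  using gens_closed(2) t_not_power by (auto simp: a_powers_def)

text \<open>The subgroup generated by a is the stabiliser of the base vertex of the Bass-Serre tree,
  and the right-hand side fixes the translate of that vertex by h. A power divisible by neither m
  nor n fixes no other vertex, so h lies in the stabiliser and commutes with a.\<close>

lemma a_pow_eq_conj:
  assumes "h \<in> carrier B" "a [^] (E :: int) = h \<otimes> a [^] (f :: int) \<otimes> inv h" "\<not> (m dvd E \<or> n dvd E)"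
  shows "h \<in> a_powers" "E = f"
proof -
  have "a [^] E \<otimes> h = h \<otimes> a [^] f"
    using assms(1) unfolding assms(2) by (simp add: m_assoc)
  then show h: "h \<in> a_powers" using a_pow_conj_dvd[OF assms(1)] assms(3) by (force simp: a_powers_def)
  then obtain z :: int where "h = a [^] z" by (auto simp: a_powers_def)
  then have "a [^] E = a [^] f"
    unfolding assms(2) by (simp flip: int_pow_neg int_pow_mult)
  then show "E = f" by (simp add: a_pow_inject)
qed

text \<open>As long as the exponent E at the current edge is divisible by neither m nor n, the next
  vertex stays in the subgroup generated by a. If this never stopped, the last edge would put \<tau>
  there too, against \<open>not_all\<close>.\<close>

lemma circle_walk:
  assumes "l \<ge> 1" and W0: "W 0 = a [^] (e :: int)" and Wl: "W l = \<tau> \<otimes> a [^] e \<otimes> inv \<tau>" and \<tau>: "\<tau> \<in> carrier B"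
    and edge: "\<And>j. j < l \<Longrightarrow> W j [^] (x j :: int) = W (Suc j) [^] (y (Suc j) :: int)"
    and ell: "\<And>j. j \<le> l \<Longrightarrow> \<exists>h \<in> carrier B. \<exists>f :: int. W j = h \<otimes> a [^] f \<otimes> inv h"
    and not_all: "\<not> (\<tau> \<in> a_powers \<and> (\<forall>j \<le> l. W j \<in> a_powers))"
  shows "\<exists>j<l. \<exists>E. (m dvd E \<or> n dvd E) \<and> E * (\<Prod>i=1..j. y i) = e * (\<Prod>i<Suc j. x i)"
proof (rule ccontr)
  assume "\<not> ?thesis"
  then have no: "\<not> (m dvd E \<or> n dvd E)" if "j < l" "E * (\<Prod>i=1..j. y i) = e * (\<Prod>i<Suc j. x i)" for j E
    using that by blast
  have walk: "\<exists>f :: int. W j = a [^] f \<and> f * (\<Prod>i=1..j. y i) = e * (\<Prod>i<j. x i)" if "j \<le> l" for j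
    using that
  proof (induction j)
    case 0
    then show ?case using W0 by auto
  next
    case (Suc j)
    then obtain f :: int where f: "W j = a [^] f" "f * (\<Prod>i=1..j. y i) = e * (\<Prod>i<j. x i)" by auto
    obtain h and g :: int where h: "h \<in> carrier B" "W (Suc j) = h \<otimes> a [^] g \<otimes> inv h"
      using ell[OF Suc.prems] by blast
    have E: "(f * x j) * (\<Prod>i=1..j. y i) = e * (\<Prod>i<Suc j. x i)"
      using f(2) by (simp add: algebra_simps)
    have "a [^] (f * x j) = h \<otimes> a [^] (g * y (Suc j)) \<otimes> inv h"
      using edge[of j] Suc.prems h by (simp add: f int_pow_pow int_pow_conjugate)
    from a_pow_eq_conj[OF h(1) this] no[OF _ E] Suc.prems
    have "h \<in> a_powers" and g: "f * x j = g * y (Suc j)" by auto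
    then obtain z :: int where "h = a [^] z" by (auto simp: a_powers_def)
    then have "W (Suc j) = a [^] g" unfolding h(2) by (simp flip: int_pow_neg int_pow_mult)
    moreover have "g * (\<Prod>i=1..Suc j. y i) = e * (\<Prod>i<Suc j. x i)"
      using E by (simp add: g algebra_simps)
    ultimately show ?case by blast
  qed
  obtain f :: int where f: "W (l - 1) = a [^] f" "f * (\<Prod>i=1..l - 1. y i) = e * (\<Prod>i<l - 1. x i)"
    using walk[of "l - 1"] by auto
  have l: "Suc (l - 1) = l" using assms(1) by simp
  have E: "(f * x (l - 1)) * (\<Prod>i=1..l - 1. y i) = e * (\<Prod>i<Suc (l - 1). x i)"
    using f(2) by (simp add: algebra_simps)
  have "a [^] (f * x (l - 1)) = \<tau> \<otimes> a [^] (e * y l) \<otimes> inv \<tau>"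
    using edge[of "l - 1"] assms(1) \<tau> unfolding l Wl f by (simp add: int_pow_pow int_pow_conjugate)
  then have "\<tau> \<in> a_powers" using a_pow_eq_conj(1)[OF \<tau>] no[OF _ E] assms(1) by auto
  then show False using not_all walk by (auto simp: a_powers_def)
qed

text \<open>The second walk is the first one on the reversed circle, translated back by the inverse
  of \<tau>, with the roles of x and y exchanged.\<close>

lemma circle_walk_both:
  assumes "l \<ge> 1" and tuple: "lolli_tuple B k l q r x y u \<tau>"
    and gen: "generate B (insert \<tau> (u ` {..k + l})) = carrier B"
    and ell: "\<And>i. i \<le> k + l \<Longrightarrow> \<exists>h \<in> carrier B. \<exists>e :: int. u i = h \<otimes> a [^] e \<otimes> inv h"
    and arc: "\<And>i. i \<le> k \<Longrightarrow> u i \<in> a_powers" and uk: "u k = a [^] (e :: int)"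
  shows "\<exists>j<l. \<exists>E. (m dvd E \<or> n dvd E) \<and> E * (\<Prod>i=1..j. y i) = e * (\<Prod>i<Suc j. x i)"
    and "\<exists>j<l. \<exists>E. (m dvd E \<or> n dvd E) \<and>
      E * (\<Prod>i\<in>{Suc j..<l}. x i) = e * (\<Prod>i\<in>{Suc j..l}. y i)"
proof -
  have uc: "u i \<in> carrier B" if "i \<le> k + l" for i using tuple that by (simp add: lolli_tuple_def)
  have \<tau>: "\<tau> \<in> carrier B" and close: "u (k + l) = \<tau> \<otimes> a [^] e \<otimes> inv \<tau>"
    and edge: "\<And>j. j < l \<Longrightarrow> u (k + j) [^] x j = u (k + Suc j) [^] y (Suc j)"
    using tuple uk by (auto simp: lolli_tuple_def)
  have not_all: "\<not> (\<tau> \<in> a_powers \<and> (\<forall>j \<le> l. u (k + j) \<in> a_powers))"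
  proof
    assume *: "\<tau> \<in> a_powers \<and> (\<forall>j \<le> l. u (k + j) \<in> a_powers)"
    have "u i \<in> a_powers" if "i \<le> k + l" for i
      using arc[of i] * that by (cases "i \<le> k") (auto dest: spec[of _ "i - k"])
    then have "generate B (insert \<tau> (u ` {..k + l})) \<subseteq> a_powers"
      using * by (intro generate_subgroup_incl subgroup_a_powers) auto
    then show False using gen proper_a_powers by simp
  qed
  show "\<exists>j<l. \<exists>E. (m dvd E \<or> n dvd E) \<and> E * (\<Prod>i=1..j. y i) = e * (\<Prod>i<Suc j. x i)"
    using circle_walk[of l "\<lambda>j. u (k + j)" e \<tau> x y] assms(1) uk close \<tau> edge ell not_all by simp
  define W where "W j = inv \<tau> \<otimes> u (k + (l - j)) \<otimes> inv (inv \<tau>)" for j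
  have W0: "W 0 = a [^] e"
    using \<tau> by (simp add: W_def close m_assoc) (simp add: m_assoc[symmetric])
  have Wl: "W l = inv \<tau> \<otimes> a [^] e \<otimes> inv (inv \<tau>)" by (simp add: W_def uk)
  have W_edge: "W j [^] y (l - j) = W (Suc j) [^] x (l - Suc j)" if "j < l" for j
  proof -
    have "Suc (l - Suc j) = l - j" using that by simp
    then have "u (k + (l - Suc j)) [^] x (l - Suc j) = u (k + (l - j)) [^] y (l - j)"
      using edge[of "l - Suc j"] that by simp
    then show ?thesis unfolding W_def using \<tau> uc by (simp only: int_pow_conjugate inv_closed)
  qed
  have W_ell: "\<exists>h \<in> carrier B. \<exists>f :: int. W j = h \<otimes> a [^] f \<otimes> inv h" if "j \<le> l" for j
  proof -
    obtain h and f :: int where h: "h \<in> carrier B" "u (k + (l - j)) = h \<otimes> a [^] f \<otimes> inv h"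
      using ell[of "k + (l - j)"] by auto
    have "W j = (inv \<tau> \<otimes> h) \<otimes> a [^] f \<otimes> inv (inv \<tau> \<otimes> h)"
      unfolding W_def h(2) using \<tau> h(1) by (simp add: m_assoc inv_mult_group)
    then show ?thesis using \<tau> h(1) by blast
  qed
  have W_not_all: "\<not> (inv \<tau> \<in> a_powers \<and> (\<forall>j \<le> l. W j \<in> a_powers))"
  proof
    interpret A: subgroup a_powers B by (rule subgroup_a_powers)
    assume *: "inv \<tau> \<in> a_powers \<and> (\<forall>j \<le> l. W j \<in> a_powers)"
    then have \<tau>A: "\<tau> \<in> a_powers" using A.m_inv_closed[of "inv \<tau>"] \<tau> by simp
    have "u (k + j) \<in> a_powers" if "j \<le> l" for j
    proof -
      have "u (k + j) = \<tau> \<otimes> W (l - j) \<otimes> inv \<tau>"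
        using \<tau> uc[of "k + j"] that by (simp add: W_def m_assoc) (simp add: m_assoc[symmetric])
      then show ?thesis using * \<tau>A by (simp add: A.m_closed A.m_inv_closed)
    qed
    then show False using not_all \<tau>A by blast
  qed
  obtain j E where j: "j < l" "m dvd E \<or> n dvd E"
    "E * (\<Prod>i=1..j. x (l - i)) = e * (\<Prod>i<Suc j. y (l - i))"
    using circle_walk[of l W e "inv \<tau>" "\<lambda>j. y (l - j)" "\<lambda>j. x (l - j)"]
      assms(1) W0 Wl \<tau> W_edge W_ell W_not_all by auto
  have "(\<Prod>i=1..j. x (l - i)) = (\<Prod>i\<in>{Suc (l - 1 - j)..<l}. x i)"
    using j(1) by (intro prod.reindex_bij_witness[of _ "\<lambda>i. l - i" "\<lambda>i. l - i"]) auto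
  moreover have "(\<Prod>i<Suc j. y (l - i)) = (\<Prod>i\<in>{Suc (l - 1 - j)..l}. y i)"
    using j(1) by (intro prod.reindex_bij_witness[of _ "\<lambda>i. l - i" "\<lambda>i. l - i"]) auto
  ultimately show "\<exists>j<l. \<exists>E. (m dvd E \<or> n dvd E) \<and>
      E * (\<Prod>i\<in>{Suc j..<l}. x i) = e * (\<Prod>i\<in>{Suc j..l}. y i)"
    using j by (intro exI[of _ "l - 1 - j"] conjI exI[of _ E]) auto
qed

end

section \<open>Divisibility extracted from the two walks\<close>

lemma coprime_int_iff_primes:
  "coprime (a :: int) b \<longleftrightarrow> (\<forall>p. prime p \<longrightarrow> p dvd a \<longrightarrow> \<not> p dvd b)"
proof
  assume "coprime a b"
  then show "\<forall>p. prime p \<longrightarrow> p dvd a \<longrightarrow> \<not> p dvd b"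
    by (meson coprime_common_divisor not_prime_unit)
next
  assume *: "\<forall>p. prime p \<longrightarrow> p dvd a \<longrightarrow> \<not> p dvd b"
  show "coprime a b"
  proof (rule ccontr)
    assume "\<not> coprime a b"
    then have "\<not> is_unit (gcd a b)" by (simp add: coprime_iff_gcd_eq_1)
    moreover have "gcd a b \<noteq> 0" using *[rule_format, of 2] by auto
    ultimately obtain p where "p dvd gcd a b" "prime p" using prime_divisor_exists by blast
    then show False using * by auto
  qed
qed

lemma prod_lessThan_split:
  fixes x :: "nat \<Rightarrow> int"
  assumes "j < l"
  shows "(\<Prod>i<l. x i) = (\<Prod>i<Suc j. x i) * (\<Prod>i\<in>{Suc j..<l}. x i)"
  using prod.atLeastLessThan_concat[of 0 "Suc j" l x] assms by (simp add: atLeast0LessThan)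

lemma prod_atLeast1_split:
  fixes y :: "nat \<Rightarrow> int"
  assumes "j \<le> l"
  shows "(\<Prod>i=1..l. y i) = (\<Prod>i=1..j. y i) * (\<Prod>i\<in>{Suc j..l}. y i)"
  using prod.atLeastLessThan_concat[of 1 "Suc j" "Suc l" y] assms
  by (simp add: atLeastLessThanSuc_atLeastAtMost)

text \<open>E divides eX and E' divides eY. If QX divides E or QY divides E', a common factor
  cancels. In the crossed case neither relation alone suffices, but their product shows that the
  square of Q divides the square of e. The same distinction gives \<open>i0\<close>: the product of
  the y_j up to it and the x_i after it divides the square of c.\<close>

lemma circle_arithmetic:
  fixes x y :: "nat \<Rightarrow> int" and Q e :: int
  assumes X: "X = (\<Prod>i<l. x i)" and Y: "Y = (\<Prod>i=1..l. y i)" and nonzero: "Q * X \<noteq> 0" "Q * Y \<noteq> 0"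
    and j: "j < l" "Q * X dvd E \<or> Q * Y dvd E" "E * (\<Prod>i=1..j. y i) = e * (\<Prod>i<Suc j. x i)"
    and j': "j' < l" "Q * X dvd E' \<or> Q * Y dvd E'"
      "E' * (\<Prod>i\<in>{Suc j'..<l}. x i) = e * (\<Prod>i\<in>{Suc j'..l}. y i)"
  shows "Q dvd e"
    and "e = Q * c \<Longrightarrow> \<exists>i0<l. \<forall>p :: int. prime p \<longrightarrow> \<not> p dvd c \<longrightarrow>
      (\<forall>i. i0 < i \<and> i < l \<longrightarrow> \<not> p dvd x i) \<and> (\<forall>j. 1 \<le> j \<and> j \<le> i0 \<longrightarrow> \<not> p dvd y j)"
proof -
  define x1 x2 where "x1 = (\<Prod>i<Suc j. x i)" and "x2 = (\<Prod>i\<in>{Suc j..<l}. x i)"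
  define y1 y2 where "y1 = (\<Prod>i=1..j. y i)" and "y2 = (\<Prod>i\<in>{Suc j..l}. y i)"
  define x1' x2' where "x1' = (\<Prod>i<Suc j'. x i)" and "x2' = (\<Prod>i\<in>{Suc j'..<l}. x i)"
  define y1' y2' where "y1' = (\<Prod>i=1..j'. y i)" and "y2' = (\<Prod>i\<in>{Suc j'..l}. y i)"
  have XY: "X = x1 * x2" "Y = y1 * y2" "X = x1' * x2'" "Y = y1' * y2'"
    unfolding X Y x1_def x2_def y1_def y2_def x1'_def x2'_def y1'_def y2'_def
    using prod_lessThan_split[of j l x] prod_atLeast1_split[of j l y]
      prod_lessThan_split[of j' l x] prod_atLeast1_split[of j' l y] j(1) j'(1) by auto
  have E: "E * y1 = e * x1" "E' * x2' = e * y2'"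
    using j(3) j'(3) by (simp_all add: x1_def y1_def x2'_def y2'_def)
  have nz: "Q \<noteq> 0" "x1 \<noteq> 0" "x2 \<noteq> 0" "y1 \<noteq> 0" "y2 \<noteq> 0" "x1' \<noteq> 0" "x2' \<noteq> 0" "y1' \<noteq> 0" "y2' \<noteq> 0"
    using nonzero XY by auto
  have "E dvd e * X" unfolding XY(1) using E(1) by (metis dvd_mult_right dvd_triv_left mult.assoc dvd_mult2)
  moreover have "E' dvd e * Y" unfolding XY(4) using E(2) by (metis dvd_triv_left dvd_mult mult.left_commute)
  ultimately have dvd: "Q * X dvd e * X \<or> Q * Y dvd e * X" "Q * X dvd e * Y \<or> Q * Y dvd e * Y"
    using j(2) j'(2) by (meson dvd_trans)+
  show "Q dvd e"
  proof (cases "Q * X dvd e * X \<or> Q * Y dvd e * Y")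
    case True
    then show ?thesis using nonzero by auto
  next
    case False
    then have "(Q * Y) * (Q * X) dvd (e * X) * (e * Y)" using dvd mult_dvd_mono by blast
    then have "Q ^ 2 * (X * Y) dvd e ^ 2 * (X * Y)" by (simp add: power2_eq_square ac_simps)
    then have "Q ^ 2 dvd e ^ 2" using nonzero by auto
    then show ?thesis by simp
  qed
  have witness: "\<exists>i0<l. \<forall>p :: int. prime p \<longrightarrow> \<not> p dvd c \<longrightarrow>
      (\<forall>i. i0 < i \<and> i < l \<longrightarrow> \<not> p dvd x i) \<and> (\<forall>j. 1 \<le> j \<and> j \<le> i0 \<longrightarrow> \<not> p dvd y j)"
    if "i0 < l" "(\<Prod>i=1..i0. y i) * (\<Prod>i\<in>{Suc i0..<l}. x i) dvd c ^ 2" for i0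
  proof (intro exI[of _ i0] conjI allI impI)
    fix p :: int and i assume p: "prime p" "\<not> p dvd c"
    have no: "\<not> p dvd (\<Prod>i=1..i0. y i) * (\<Prod>i\<in>{Suc i0..<l}. x i)"
      using that(2) p by (meson dvd_trans prime_dvd_power)
    show "\<not> p dvd x i" if "i0 < i \<and> i < l" using no that p(1) by (auto simp: prime_dvd_mult_iff prime_dvd_prod_int)
    show "\<not> p dvd y i" if "1 \<le> i \<and> i \<le> i0" using no that p(1) by (auto simp: prime_dvd_mult_iff prime_dvd_prod_int)
  qed (fact that(1))
  assume e: "e = Q * c"
  consider w where "E = Q * X * w" | w where "E' = Q * Y * w" | w w' where "E = Q * Y * w" "E' = Q * X * w'"
    using j(2) j'(2) by (auto elim!: dvdE)
  then show "\<exists>i0<l. \<forall>p :: int. prime p \<longrightarrow> \<not> p dvd c \<longrightarrow>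
      (\<forall>i. i0 < i \<and> i < l \<longrightarrow> \<not> p dvd x i) \<and> (\<forall>j. 1 \<le> j \<and> j \<le> i0 \<longrightarrow> \<not> p dvd y j)"
  proof cases
    case 1
    have "(Q * x1) * (x2 * w * y1) = (Q * x1) * c"
      using E(1) unfolding 1 e XY(1) by (simp add: ac_simps)
    then have "c = (y1 * x2) * w" using nz by (simp add: ac_simps)
    then have "y1 * x2 dvd c ^ 2" by (simp add: power2_eq_square)
    then show ?thesis by (intro witness[OF j(1)]) (simp add: y1_def x2_def)
  next
    case 2
    have "(Q * y2') * (y1' * w * x2') = (Q * y2') * c"
      using E(2) unfolding 2 e XY(4) by (simp add: ac_simps)
    then have "c = (y1' * x2') * w" using nz by (simp add: ac_simps)
    then have "y1' * x2' dvd c ^ 2" by (simp add: power2_eq_square)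
    then show ?thesis by (intro witness[OF j'(1)]) (simp add: y1'_def x2'_def)
  next
    case 3
    \<comment> \<open>In the crossed case the two walks are multiplied; the factors x1 and y2' then
      occur on both sides and cancel.\<close>
    have "E * y1 * (E' * x2') = e * x1 * (e * y2')" by (simp only: E)
    then have "(Q * Q * x1 * y2') * ((y1 * x2) * (y1' * x2' * w * w')) = (Q * Q * x1 * y2') * c ^ 2"
      unfolding 3 e power2_eq_square
      by (subst (asm) XY(4), subst (asm) XY(1)) (simp add: ac_simps)
    then have "c ^ 2 = (y1 * x2) * (y1' * x2' * w * w')" using nz by simp
    then have "y1 * x2 dvd c ^ 2" by simp
    then show ?thesis by (intro witness[OF j(1)]) (simp add: y1_def x2_def)
  qed
qed

lemma (in group) lolli_tuple_conjugate:
  assumes tuple: "lolli_tuple G k l q r x y u \<tau>" and g: "g \<in> carrier G"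
    and gen: "generate G (insert \<tau> (u ` {..k + l})) = carrier G"
  defines "c \<equiv> (\<lambda>h. g \<otimes> h \<otimes> inv g)"
  shows "lolli_tuple G k l q r x y (c \<circ> u) (c \<tau>)"
    and "generate G (insert (c \<tau>) ((c \<circ> u) ` {..k + l})) = carrier G"
proof -
  interpret c: group_hom G G c
    using conjugation_hom[OF g] by (simp add: c_def group_hom_def group_hom_axioms_def is_group)
  have uc: "u i \<in> carrier G" if "i \<le> k + l" for i using tuple that by (simp add: lolli_tuple_def)
  have \<tau>: "\<tau> \<in> carrier G" using tuple by (simp add: lolli_tuple_def)
  have arc: "c (u i) [^] q i = c (u (Suc i)) [^] r (Suc i)" if "i < k" for i
  proof -
    have eq: "u i [^] q i = u (Suc i) [^] r (Suc i)" using tuple that by (simp add: lolli_tuple_def)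
    show ?thesis using arg_cong[OF eq, of c] that uc[of i] uc[of "Suc i"] by (simp add: c.hom_int_pow)
  qed
  have circ: "c (u (k + j)) [^] x j = c (u (k + Suc j)) [^] y (Suc j)" if "j < l" for j
  proof -
    have eq: "u (k + j) [^] x j = u (k + Suc j) [^] y (Suc j)" using tuple that by (simp add: lolli_tuple_def)
    show ?thesis using arg_cong[OF eq, of c] that uc[of "k + j"] uc[of "k + Suc j"]
      by (simp add: c.hom_int_pow)
  qed
  have "u (k + l) = \<tau> \<otimes> u k \<otimes> inv \<tau>" using tuple by (simp add: lolli_tuple_def)
  then have "c (u (k + l)) = c \<tau> \<otimes> c (u k) \<otimes> inv c \<tau>" using \<tau> uc[of k] by simp
  then show "lolli_tuple G k l q r x y (c \<circ> u) (c \<tau>)"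
    using arc circ uc \<tau> by (simp add: lolli_tuple_def)
  have "c ` carrier G = carrier G"
  proof
    show "carrier G \<subseteq> c ` carrier G"
    proof
      fix h assume h: "h \<in> carrier G"
      then have "h = c (inv g \<otimes> h \<otimes> g)"
        using g by (simp add: c_def m_assoc) (simp add: m_assoc[symmetric])
      then show "h \<in> c ` carrier G" using g h by blast
    qed
  qed auto
  moreover have "generate G (c ` insert \<tau> (u ` {..k + l})) = c ` generate G (insert \<tau> (u ` {..k + l}))"
    using uc \<tau> by (intro c.generate_img) auto
  ultimately show "generate G (insert (c \<tau>) ((c \<circ> u) ` {..k + l})) = carrier G"
    using gen by (simp add: image_comp)
qed

context bs_group
begin

text \<open>Whatever factor of e0 is identified has no prime in common with both QX and QY. The walk
  exhibits as such factors the r_j with j < k, then either X or Y, or r_k together with the cofactor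
  c of the circle.\<close>

lemma normalized_tuple_imp_conditions:
  assumes "l \<ge> 1" and tuple: "lolli_tuple B k l q r x y u \<tau>"
    and gen: "generate B (insert \<tau> (u ` {..k + l})) = carrier B"
    and ell: "\<And>i. i \<le> k + l \<Longrightarrow> \<exists>h \<in> carrier B. \<exists>e :: int. u i = h \<otimes> a [^] e \<otimes> inv h"
    and u0: "u 0 = a [^] (e0 :: int)"
    and e0: "\<And>p. prime p \<Longrightarrow> p dvd m \<Longrightarrow> p dvd n \<Longrightarrow> \<not> p dvd e0"
    and last: "k \<ge> 1 \<Longrightarrow> \<not> is_unit (q (k - 1))"
    and Q: "Q = (\<Prod>i<k. q i)" and X: "X = (\<Prod>j<l. x j)" and Y: "Y = (\<Prod>j=1..l. y j)"
    and mn: "m = Q * X" "n = Q * Y"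
  shows "(\<forall>i j. i < j \<and> j < k \<longrightarrow> coprime (q i) (r j)) \<and>
    (coprime X (Q * Y) \<or> coprime Y (Q * X) \<or>
     (coprime Q (r k) \<and>
      (\<exists>i0<l. \<forall>p::int. prime p \<and> p dvd Q * X \<and> p dvd Q * Y \<longrightarrow>
         (\<forall>i. i0 < i \<and> i < l \<longrightarrow> \<not> p dvd x i) \<and>
         (\<forall>j. 1 \<le> j \<and> j \<le> i0 \<longrightarrow> \<not> p dvd y j))))"
proof -
  have uc: "u i \<in> carrier B" if "i \<le> k + l" for i using tuple that by (simp add: lolli_tuple_def)
  have nonzero: "Q * X \<noteq> 0" "Q * Y \<noteq> 0" using m_nonzero n_nonzero mn by auto
  have pQ: "\<not> p dvd e0" if "prime p" "p dvd Q" for p using e0 that mn by auto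
  have circle: "Q dvd e \<and> (\<forall>c. e = Q * c \<longrightarrow> c dvd e0 \<longrightarrow>
      (\<exists>i0<l. \<forall>p::int. prime p \<and> p dvd Q * X \<and> p dvd Q * Y \<longrightarrow>
         (\<forall>i. i0 < i \<and> i < l \<longrightarrow> \<not> p dvd x i) \<and>
         (\<forall>j. 1 \<le> j \<and> j \<le> i0 \<longrightarrow> \<not> p dvd y j)))"
    if arc: "\<And>i. i \<le> k \<Longrightarrow> u i \<in> a_powers" and uk: "u k = a [^] e" for e :: int
  proof -
    note both = circle_walk_both[OF assms(1) tuple gen ell arc uk]
    obtain j E where j: "j < l" "m dvd E \<or> n dvd E" "E * (\<Prod>i=1..j. y i) = e * (\<Prod>i<Suc j. x i)"
      using both(1) by blast
    obtain j' E' where j': "j' < l" "m dvd E' \<or> n dvd E'"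
      "E' * (\<Prod>i\<in>{Suc j'..<l}. x i) = e * (\<Prod>i\<in>{Suc j'..l}. y i)"
      using both(2) by blast
    note arith = circle_arithmetic[OF X Y nonzero j(1) j(2)[unfolded mn] j(3) j'(1) j'(2)[unfolded mn] j'(3)]
    show ?thesis
    proof (intro conjI allI impI)
      show "Q dvd e" by (rule arith(1))
      fix c assume c: "e = Q * c" "c dvd e0"
      have "\<not> p dvd c" if "prime p \<and> p dvd Q * X \<and> p dvd Q * Y" for p
        using e0[of p] that mn c(2) by (meson dvd_trans)
      then show "\<exists>i0<l. \<forall>p::int. prime p \<and> p dvd Q * X \<and> p dvd Q * Y \<longrightarrow>
          (\<forall>i. i0 < i \<and> i < l \<longrightarrow> \<not> p dvd x i) \<and> (\<forall>j. 1 \<le> j \<and> j \<le> i0 \<longrightarrow> \<not> p dvd y j)"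
        using arith(2)[OF c(1)] by meson
    qed
  qed
  show ?thesis
  proof (cases "k = 0")
    case True
    have "u i \<in> a_powers" if "i \<le> k" for i using that True u0 by (auto simp: a_powers_def)
    then show ?thesis using circle[of e0] u0 True Q by simp
  next
    case False
    then have k: "k \<ge> 1" by simp
    have Qsplit: "Q = (\<Prod>j<Suc i. q j) * (\<Prod>j\<in>{Suc i..<k}. q j)" if "i < k" for i
      unfolding Q using that by (rule prod_lessThan_split)
    have copQ: "coprime e0 Q" using pQ by (simp add: coprime_int_iff_primes) blast
    have arc: "\<exists>e :: int. u i = a [^] e \<and> e * (\<Prod>j=1..i. r j) = e0 * (\<Prod>j<i. q j)" if "i < k" for i
      using that
    proof (induction i)
      case 0
      then show ?case using u0 by auto
    next
      case (Suc i)
      then obtain e :: int where e: "u i = a [^] e" "e * (\<Prod>j=1..i. r j) = e0 * (\<Prod>j<i. q j)" by auto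
      obtain h and g :: int where h: "h \<in> carrier B" "u (Suc i) = h \<otimes> a [^] g \<otimes> inv h"
        using ell[of "Suc i"] Suc.prems by auto
      have E: "(e * q i) * (\<Prod>j=1..i. r j) = e0 * (\<Prod>j<Suc i. q j)"
        using e(2) by (simp add: algebra_simps)
      have "u i [^] q i = u (Suc i) [^] r (Suc i)" using tuple Suc.prems by (simp add: lolli_tuple_def)
      then have eq: "a [^] (e * q i) = h \<otimes> a [^] (g * r (Suc i)) \<otimes> inv h"
        using h by (simp add: e int_pow_pow int_pow_conjugate)
      \<comment> \<open>Otherwise Q would divide e0 q_0 ... q_i. Since Q is prime to e0, it would
        divide q_0 ... q_i, so the remaining factors, among them the nonunit q_(k-1), would be
        units.\<close>
      have "\<not> (m dvd e * q i \<or> n dvd e * q i)"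
      proof
        assume "m dvd e * q i \<or> n dvd e * q i"
        then have "Q dvd e * q i" by (auto simp: mn dest: dvd_mult_left)
        then have "Q dvd e0 * (\<Prod>j<Suc i. q j)" unfolding E[symmetric] by (rule dvd_mult2)
        then have "Q dvd (\<Prod>j<Suc i. q j)"
          using copQ by (simp add: coprime_dvd_mult_right_iff coprime_commute)
        then have "(\<Prod>j<Suc i. q j) * (\<Prod>j\<in>{Suc i..<k}. q j) dvd (\<Prod>j<Suc i. q j) * 1"
          using Qsplit[of i] Suc.prems by simp
        moreover have "(\<Prod>j<Suc i. q j) \<noteq> 0" using Qsplit[of i] Suc.prems nonzero by auto
        ultimately have "is_unit (\<Prod>j\<in>{Suc i..<k}. q j)"
          by (metis dvd_times_left_cancel_iff)
        moreover have "q (k - 1) dvd (\<Prod>j\<in>{Suc i..<k}. q j)"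
          using Suc.prems by (intro dvd_prodI) auto
        ultimately show False using last[OF k] by (meson dvd_trans)
      qed
      from a_pow_eq_conj[OF h(1) eq this] have "h \<in> a_powers" and g: "e * q i = g * r (Suc i)" by auto
      then obtain z :: int where "h = a [^] z" by (auto simp: a_powers_def)
      then have "u (Suc i) = a [^] g" unfolding h(2) by (simp flip: int_pow_neg int_pow_mult)
      moreover have "g * (\<Prod>j=1..Suc i. r j) = e0 * (\<Prod>j<Suc i. q j)"
        using E by (simp add: g algebra_simps)
      ultimately show ?case by blast
    qed
    define D where "D = (\<Prod>j=1..k - 1. r j)"
    obtain e :: int where e: "u (k - 1) = a [^] e" "e * D = e0 * (\<Prod>j<k - 1. q j)"
      using arc[of "k - 1"] k by (auto simp: D_def)
    define f where "f = e * q (k - 1)"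
    have fD: "f * D = e0 * Q"
    proof -
      have "Q = (\<Prod>j<k - 1. q j) * q (k - 1)" unfolding Q using prod.lessThan_Suc[of q "k - 1"] k by simp
      then show ?thesis using e(2) by (simp add: f_def algebra_simps)
    qed
    have "u (k - 1) [^] q (k - 1) = u k [^] r k"
      using tuple k by (auto simp: lolli_tuple_def dest!: spec[of _ "k - 1"])
    then have uk_pow: "a [^] f = u k [^] r k" using e(1) by (simp add: f_def int_pow_pow)
    have arc_coprime: "\<forall>i j. i < j \<and> j < k \<longrightarrow> coprime (q i) (r j)" if "D dvd e0"
    proof (intro allI impI)
      fix i j assume ij: "i < j \<and> j < k"
      have "q i dvd Q" unfolding Q using ij by (intro dvd_prodI) auto
      moreover have "r j dvd D" unfolding D_def using ij by (intro dvd_prodI) auto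
      ultimately show "coprime (q i) (r j)"
        unfolding coprime_int_iff_primes using pQ that by (meson dvd_trans)
    qed
    have Q0: "Q \<noteq> 0" using nonzero by auto
    obtain h and g :: int where h: "h \<in> carrier B" "u k = h \<otimes> a [^] g \<otimes> inv h"
      using ell[of k] by auto
    \<comment> \<open>Only the last arc edge can leave the subgroup generated by a. If it does not,
      the circle decides; if it does, QX or QY divides the exponent f of that edge.\<close>
    show ?thesis
    proof (cases "h \<in> a_powers")
      case True
      then obtain z :: int where "h = a [^] z" by (auto simp: a_powers_def)
      then have uk: "u k = a [^] g" unfolding h(2) by (simp flip: int_pow_neg int_pow_mult)
      then have f: "f = g * r k" using uk_pow by (simp add: int_pow_pow a_pow_inject)
      have "u i \<in> a_powers" if "i \<le> k" for i
        using arc[of i] uk that by (cases "i = k") (auto simp: a_powers_def)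
      from circle[OF this uk] obtain c where c: "g = Q * c" and cond: "c dvd e0 \<longrightarrow>
          (\<exists>i0<l. \<forall>p::int. prime p \<and> p dvd Q * X \<and> p dvd Q * Y \<longrightarrow>
           (\<forall>i. i0 < i \<and> i < l \<longrightarrow> \<not> p dvd x i) \<and> (\<forall>j. 1 \<le> j \<and> j \<le> i0 \<longrightarrow> \<not> p dvd y j))"
        by (metis dvdE)
      \<comment> \<open>Cancelling Q, which the circle forces to divide the exponent at w_0, turns
        c, r_k and D into divisors of e0 at once.\<close>
      have "Q * (c * r k * D) = Q * e0" using fD by (simp add: f c ac_simps)
      then have e0_eq: "e0 = c * r k * D" using Q0 by simp
      have "coprime Q (r k)"
        unfolding coprime_int_iff_primes
      proof (intro allI impI notI)
        fix p :: int assume p: "prime p" "p dvd Q" "p dvd r k"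
        then have "p dvd e0" unfolding e0_eq by (intro dvd_mult2 dvd_mult)
        then show False using pQ p by blast
      qed
      then show ?thesis using cond arc_coprime by (auto simp: e0_eq)
    next
      case False
      have "a [^] f = h \<otimes> a [^] (g * r k) \<otimes> inv h"
        using uk_pow h by (simp add: int_pow_pow int_pow_conjugate)
      then have dvd: "m dvd f \<or> n dvd f" using a_pow_eq_conj(1)[OF h(1)] False by blast
      then have "Q dvd f" by (auto simp: mn dest: dvd_mult_left)
      then obtain c where c: "f = Q * c" by blast
      have "Q * (c * D) = Q * e0" using fD by (simp add: c ac_simps)
      then have e0_eq: "e0 = c * D" using Q0 by simp
      have "X dvd c \<or> Y dvd c" using dvd Q0 by (simp add: mn c)
      then have "coprime X (Q * Y) \<or> coprime Y (Q * X)"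
      proof
        assume c: "X dvd c"
        have "coprime X (Q * Y)" unfolding coprime_int_iff_primes
        proof (intro allI impI notI)
          fix p assume p: "prime p" "p dvd X" "p dvd Q * Y"
          then have "p dvd e0" unfolding e0_eq using c by (meson dvd_mult2 dvd_trans)
          moreover have "p dvd Q * X" using p(2) by (rule dvd_mult)
          ultimately show False using e0[of p] p by (simp add: mn)
        qed
        then show ?thesis ..
      next
        assume c: "Y dvd c"
        have "coprime Y (Q * X)" unfolding coprime_int_iff_primes
        proof (intro allI impI notI)
          fix p assume p: "prime p" "p dvd Y" "p dvd Q * X"
          then have "p dvd e0" unfolding e0_eq using c by (meson dvd_mult2 dvd_trans)
          moreover have "p dvd Q * Y" using p(2) by (rule dvd_mult)
          ultimately show False using e0[of p] p by (simp add: mn)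
        qed
        then show ?thesis ..
      qed
      then show ?thesis using arc_coprime by (auto simp: e0_eq)
    qed
  qed
qed

end

section \<open>From the arithmetic conditions to an epimorphism\<close>

text \<open>S is a subgroup of the integers, hence consists of multiples of its least positive
  element, and that element has no prime divisor.\<close>

lemma one_mem_if_primes_avoided:
  fixes S :: "int set"
  assumes closed: "\<And>y z. y \<in> S \<Longrightarrow> z \<in> S \<Longrightarrow> y - z \<in> S"
    and primes: "\<And>p. prime p \<Longrightarrow> \<exists>z \<in> S. \<not> p dvd z"
  shows "1 \<in> S"
proof -
  obtain z where z: "z \<in> S" "\<not> 2 dvd z" using primes[of 2] by auto
  have zero: "0 \<in> S" using closed[OF z(1) z(1)] by simp
  have neg: "- y \<in> S" if "y \<in> S" for y using closed[OF zero that] by simp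
  have add: "y + w \<in> S" if "y \<in> S" "w \<in> S" for y w using closed[OF that(1) neg[OF that(2)]] by simp
  have mult_nat: "int k * y \<in> S" if "y \<in> S" for k y
    by (induction k) (use zero add that in \<open>auto simp: algebra_simps\<close>)
  have mult: "k * y \<in> S" if "y \<in> S" for k y
    using mult_nat[OF that, of "nat k"] neg[OF mult_nat[OF that, of "nat (- k)"]] by (cases "k \<ge> 0") auto
  define d where "d = (LEAST k. k > 0 \<and> int k \<in> S)"
  have "\<bar>z\<bar> \<in> S" using z neg by (auto simp: abs_if)
  then have "nat \<bar>z\<bar> > 0 \<and> int (nat \<bar>z\<bar>) \<in> S" using z by auto
  then have d: "d > 0" "int d \<in> S"
    unfolding d_def using LeastI[of "\<lambda>k. k > 0 \<and> int k \<in> S"] by blast+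
  have dvd: "int d dvd w" if w: "w \<in> S" for w
  proof -
    have "w mod int d = w - (w div int d) * int d" by (simp add: minus_div_mult_eq_mod)
    then have mem: "w mod int d \<in> S" using closed[OF w mult[OF d(2)]] by simp
    have "w mod int d < int d" "w mod int d \<ge> 0" using d by auto
    then have "\<not> (nat (w mod int d) > 0 \<and> int (nat (w mod int d)) \<in> S)"
      unfolding d_def by (intro not_less_Least) (auto simp: d_def[symmetric])
    then show ?thesis using mem \<open>w mod int d \<ge> 0\<close> by (auto simp: dvd_eq_mod_eq_0)
  qed
  have "d = 1"
  proof (rule ccontr)
    assume "d \<noteq> 1"
    then obtain p where "prime p" "p dvd int d"
      using d(1) prime_divisor_exists[of "int d"] by auto
    then show False using primes[of p] dvd by (meson dvd_trans)
  qed
  then show ?thesis using d(2) by simp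
qed

text \<open>Common factors with Y are split off repeatedly. Applied to r_k, the part r'' can be
  absorbed into a power of X or Y, which conjugation by a power of t provides.\<close>

lemma coprime_part_decomposition:
  fixes r Y :: int
  assumes "r \<noteq> 0"
  shows "\<exists>r' r'' N. r = r' * r'' \<and> r'' dvd Y ^ N \<and> coprime r' Y"
  using assms
proof (induction "nat \<bar>r\<bar>" arbitrary: r rule: less_induct)
  case less
  show ?case
  proof (cases "coprime r Y")
    case True
    then show ?thesis by (intro exI[of _ r] exI[of _ 1] exI[of _ 0]) auto
  next
    case False
    define g where "g = gcd r Y"
    have g: "g dvd r" "g dvd Y" "g \<noteq> 1" "g > 0"
      using False less.prems by (auto simp: g_def coprime_iff_gcd_eq_1)
    then obtain s where s: "r = g * s" by blast
    then have "s \<noteq> 0" using less.prems by auto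
    moreover from this have "nat \<bar>s\<bar> < nat \<bar>r\<bar>" using g by (simp add: s abs_mult)
    ultimately obtain r' r'' N where IH: "s = r' * r''" "r'' dvd Y ^ N" "coprime r' Y"
      using less.hyps by blast
    have "r = r' * (g * r'')" using s IH by simp
    moreover have "g * r'' dvd Y ^ Suc N" using g IH by (simp add: mult_dvd_mono)
    ultimately show ?thesis using IH(3) by blast
  qed
qed

text \<open>Take the first i with p dividing q_i: the earlier q_j are prime to p by minimality, the
  later r_j because they are coprime to q_i. If there is none, i = k - 1 leaves no r_j in the
  product.\<close>

lemma exists_prime_free_arc_product:
  fixes q r :: "nat \<Rightarrow> int"
  assumes "k \<ge> 1" "prime p" and cop: "\<forall>i j. i < j \<and> j < k \<longrightarrow> coprime (q i) (r j)"
  shows "\<exists>i<k. \<not> p dvd (\<Prod>j<i. q j) * (\<Prod>j\<in>{i<..k - 1}. r j)"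
proof -
  define P where "P i \<longleftrightarrow> p dvd q i \<or> i = k - 1" for i
  define i where "i = (LEAST i. P i)"
  have Pk: "P (k - 1)" by (simp add: P_def)
  then have Pi: "P i" and i: "i \<le> k - 1" unfolding i_def by (rule LeastI, rule Least_le)
  have "\<not> p dvd q j" if "j < i" for j using not_less_Least[of j P] that by (auto simp: i_def P_def)
  moreover have "\<not> p dvd r j" if j: "j \<in> {i<..k - 1}" for j
  proof -
    have "p dvd q i" using Pi j by (auto simp: P_def)
    moreover have "coprime (q i) (r j)" using cop j assms(1) by auto
    ultimately show ?thesis using assms(2) by (meson coprime_common_divisor not_prime_unit)
  qed
  ultimately have "\<not> p dvd (\<Prod>j<i. q j) * (\<Prod>j\<in>{i<..k - 1}. r j)"
    using assms(2) by (auto simp: prime_dvd_mult_iff prime_dvd_prod_int)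
  then show ?thesis using i assms(1) by (intro exI[of _ i]) auto
qed

section \<open>Generating tuples\<close>

context bs_group
begin

text \<open>Each conjugation by t trades one factor X for one factor Y; a single factor Q is enough
  for all of them.\<close>

lemma stable_conj_scaled:
  assumes mn: "m = Q * X" "n = Q * Y"
  shows "t [^] (N :: nat) \<otimes> a [^] (Q * X ^ N * z) \<otimes> inv (t [^] N) = a [^] (Q * Y ^ N * z)"
proof (induction N arbitrary: z)
  case (Suc N)
  have step: "t \<otimes> a [^] (Q * X * z) \<otimes> inv t = a [^] (Q * Y * z)" for z
  proof -
    have "t \<otimes> a [^] (m * z) \<otimes> inv t = a [^] (n * z)"
      using tp_a_pow[of True z] by (simp add: tp_def md_def m_assoc)
    then show ?thesis by (simp only: mn[symmetric])
  qed
  have "t [^] Suc N \<otimes> a [^] (Q * X ^ Suc N * z) \<otimes> inv (t [^] Suc N) =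
      t [^] N \<otimes> (t \<otimes> a [^] (Q * X * (X ^ N * z)) \<otimes> inv t) \<otimes> inv (t [^] N)"
    by (simp add: inv_mult_group m_assoc mult.assoc)
  also have "\<dots> = t [^] N \<otimes> a [^] (Q * X ^ N * (Y * z)) \<otimes> inv (t [^] N)"
    unfolding step by (simp add: ac_simps)
  also have "\<dots> = a [^] (Q * Y ^ N * (Y * z))" by (rule Suc.IH)
  finally show ?case by (simp add: ac_simps)
qed simp

text \<open>
  All vertex generators go to conjugates of powers of \<open>a\<close> by powers of \<open>t\<close>: one conjugator for
  \<open>v\<^sub>0, \<dots>, v\<^bsub>k-1\<^esub>\<close>, and \<open>t\<close> is inserted at the edge from \<open>w\<^bsub>i0\<^esub>\<close> to \<open>w\<^bsub>i0+1\<^esub>\<close>.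
\<close>

lemma lolli_tuple_construction:
  fixes w s c :: int and z :: int
  assumes "l \<ge> 1" and i0: "i0 < l"
    and Q: "Q = (\<Prod>i<k. q i)" and X: "X = (\<Prod>j<l. x j)" and Y: "Y = (\<Prod>j=1..l. y j)"
    and mn: "m = Q * X" "n = Q * Y"
    and c: "c = (\<Prod>j\<in>{Suc i0..<l}. x j) * (\<Prod>j=1..i0. y j)"
    and conj: "k \<ge> 1 \<Longrightarrow> t [^] z \<otimes> a [^] (Q * w) \<otimes> inv (t [^] z) = a [^] (Q * c * s * r k)"
    and primes: "\<And>p. prime p \<Longrightarrow>
      (\<exists>i<k. \<not> p dvd (\<Prod>j<i. q j) * (\<Prod>j\<in>{i<..k - 1}. r j) * w) \<or>
      \<not> p dvd Q * c * s \<or> \<not> p dvd Q * X * s \<or> \<not> p dvd Q * Y * s"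
  shows "\<exists>u \<tau>. lolli_tuple B k l q r x y u \<tau> \<and> generate B (insert \<tau> (u ` {..k + l})) = carrier B"
proof -
  define E where "E i = (\<Prod>j<i. q j) * (\<Prod>j\<in>{i<..k - 1}. r j)" for i
  \<comment> \<open>Each branch solves the edge equations on one side of the edge \<open>i0\<close>.
    The constant factors give the ends w_0 and w_l the same exponent Q c, as the closing relation
    demands, and give the two sides of the edge \<open>i0\<close> the exponents QX and QY.\<close>
  define f where "f j = (if j \<le> i0
    then Q * (\<Prod>i\<in>{Suc i0..<l}. x i) * ((\<Prod>i<j. x i) * (\<Prod>i\<in>{j<..i0}. y i))
    else Q * (\<Prod>i=1..i0. y i) * ((\<Prod>i\<in>{Suc i0..<j}. x i) * (\<Prod>i\<in>{j<..l}. y i)))" for j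
  \<comment> \<open>The edge \<open>i0\<close> requires that conjugation by \<tau> turn a^(QY) into
    a^(QX), which is what the inverse of t does.\<close>
  define \<tau> where "\<tau> = inv t"
  define \<kappa> where "\<kappa> = t [^] z"
  define u where "u i = (if i < k then \<kappa> \<otimes> a [^] (E i * w) \<otimes> inv \<kappa>
    else if i \<le> k + i0 then a [^] (f (i - k) * s)
    else \<tau> \<otimes> a [^] (f (i - k) * s) \<otimes> inv \<tau>)" for i
  have \<tau>: "\<tau> \<in> carrier B" and \<kappa>: "\<kappa> \<in> carrier B" by (simp_all add: \<tau>_def \<kappa>_def)
  have uc: "u i \<in> carrier B" for i using \<tau> \<kappa> by (simp add: u_def)
  have f0: "f 0 = Q * c" and fl: "f l = Q * c"
  proof -
    have "{0<..i0} = {1..i0}" "{l<..l} = {}" by auto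
    then show "f 0 = Q * c" "f l = Q * c" using i0 by (simp_all add: f_def c)
  qed
  have f_i0: "f i0 * x i0 = Q * X"
    unfolding X prod_lessThan_split[OF i0] by (simp add: f_def)
  have f_Suc: "f (Suc i0) * y (Suc i0) = Q * Y"
  proof -
    have "{Suc i0..l} = insert (Suc i0) {Suc i0<..l}" using i0 by auto
    then show ?thesis unfolding Y prod_atLeast1_split[OF less_imp_le[OF i0]] by (simp add: f_def)
  qed
  have f_step: "f j * x j = f (Suc j) * y (Suc j)" if "j < l" "j \<noteq> i0" for j
  proof (cases "j < i0")
    case True
    then show ?thesis using prod_path_step[OF True, of x y] by (simp add: f_def mult.assoc)
  next
    case False
    then have j: "Suc i0 \<le> j" using that by simp
    show ?thesis using prod_path_step_from[OF j that(1), of x y] j by (simp add: f_def mult.assoc)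
  qed
  have t_conj: "\<tau> \<otimes> a [^] (Q * Y * z) \<otimes> inv \<tau> = a [^] (Q * X * z)" for z
    using conj_inverse[OF gens_closed(2) _ _ stable_conj_scaled[OF mn, of 1 z, simplified]]
    by (simp add: \<tau>_def)
  have tuple: "lolli_tuple B k l q r x y u \<tau>"
    unfolding lolli_tuple_def
  proof (intro conjI allI impI uc \<tau>)
    fix i assume i: "i < k"
    show "u i [^] q i = u (Suc i) [^] r (Suc i)"
    proof (cases "Suc i < k")
      case True
      then have "E i * q i = E (Suc i) * r (Suc i)"
        unfolding E_def by (intro prod_path_step) simp
      then have eq: "E i * w * q i = E (Suc i) * w * r (Suc i)"
        by (metis mult.assoc mult.commute)
      show ?thesis using i True \<kappa> by (simp add: u_def int_pow_conjugate int_pow_pow eq)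
    next
      case False
      then have k: "k = Suc i" using i by simp
      have "E i * q i = Q" by (simp add: E_def Q k)
      then have "u i [^] q i = \<kappa> \<otimes> a [^] (Q * w) \<otimes> inv \<kappa>"
        using i \<kappa> by (simp add: u_def int_pow_conjugate int_pow_pow) (metis mult.assoc mult.commute)
      also have "\<dots> = a [^] (Q * c * s * r k)" using conj by (simp add: \<kappa>_def k)
      finally show ?thesis by (simp add: u_def k f0 int_pow_pow)
    qed
  next
    fix j assume j: "j < l"
    consider "j < i0" | "j = i0" | "j > i0" by linarith
    then show "u (k + j) [^] x j = u (k + Suc j) [^] y (Suc j)"
    proof cases
      case 1
      then have eq: "f j * s * x j = f (Suc j) * s * y (Suc j)"
        using f_step[OF j] by (metis less_irrefl mult.assoc mult.commute)
      show ?thesis using 1 by (simp add: u_def int_pow_pow eq)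
    next
      case 2
      have "a [^] (f j * s * x j) = \<tau> \<otimes> a [^] (f (Suc j) * s * y (Suc j)) \<otimes> inv \<tau>"
        using t_conj[of s] f_i0 f_Suc unfolding 2 by (simp add: ac_simps)
      then show ?thesis using 2 \<tau> by (simp add: u_def int_pow_conjugate int_pow_pow)
    next
      case 3
      then have eq: "f j * s * x j = f (Suc j) * s * y (Suc j)"
        using f_step[OF j] by (metis less_irrefl mult.assoc mult.commute)
      show ?thesis using 3 \<tau> by (simp add: u_def int_pow_conjugate int_pow_pow eq)
    qed
  next
    show "u (k + l) = \<tau> \<otimes> u k \<otimes> inv \<tau>" using i0 by (simp add: u_def f0 fl)
  qed
  define K where "K = generate B (insert \<tau> (u ` {..k + l}))"
  interpret K: subgroup K B
    unfolding K_def using uc \<tau> by (intro generate_is_subgroup) auto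
  have uK: "u i \<in> K" if "i \<le> k + l" for i
    using that by (auto simp: K_def intro: generate.incl)
  have \<tau>K: "\<tau> \<in> K" by (auto simp: K_def intro: generate.incl)
  then have tK: "t \<in> K" using K.m_inv_closed[of \<tau>] by (simp add: \<tau>_def)
  then have \<kappa>K: "\<kappa> \<in> K" unfolding \<kappa>_def using subgroup_int_pow_closed[OF K.subgroup_axioms] by blast
  have unconj: "g \<in> K" if "h \<in> K" "h \<otimes> g \<otimes> inv h \<in> K" "g \<in> carrier B" for g h
  proof -
    have "inv h \<otimes> (h \<otimes> g \<otimes> inv h) \<otimes> inv (inv h) = g"
      using conj_inverse[OF K.mem_carrier[OF that(1)] that(3) _ HOL.refl] that by simp
    then show ?thesis using that by (metis K.m_closed K.m_inv_closed)
  qed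
  \<comment> \<open>As t lies in the image, conjugations can be undone, and surjectivity reduces to
    1 belonging to this subgroup of the integers.\<close>
  define S where "S = {e :: int. a [^] e \<in> K}"
  have arcS: "E i * w \<in> S" if "i < k" for i
    using uK[of i] that unconj[OF \<kappa>K, of "a [^] (E i * w)"] by (simp add: S_def u_def)
  have circS: "f j * s \<in> S" if "j \<le> l" for j
    using uK[of "k + j"] that unconj[OF \<tau>K, of "a [^] (f j * s)"] by (simp add: S_def u_def split: if_splits)
  have "1 \<in> S"
  proof (rule one_mem_if_primes_avoided)
    fix e e' assume "e \<in> S" "e' \<in> S"
    then show "e - e' \<in> S" by (simp add: S_def int_pow_diff)
  next
    fix p :: int assume "prime p"
    from primes[OF this] consider i where "i < k" "\<not> p dvd E i * w"
      | "\<not> p dvd Q * c * s" | "\<not> p dvd Q * X * s" | "\<not> p dvd Q * Y * s"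
      by (auto simp: E_def)
    then show "\<exists>e \<in> S. \<not> p dvd e"
    proof cases
      case 1
      then show ?thesis using arcS by blast
    next
      case 2
      then show ?thesis using circS[of 0] by (auto simp: f0)
    next
      case 3
      then have "\<not> p dvd f i0 * s" unfolding f_i0[symmetric] by (metis dvd_mult2 mult.assoc mult.commute)
      then show ?thesis using circS[of i0] i0 by auto
    next
      case 4
      then have "\<not> p dvd f (Suc i0) * s" unfolding f_Suc[symmetric] by (metis dvd_mult2 mult.assoc mult.commute)
      then show ?thesis using circS[of "Suc i0"] i0 by auto
    qed
  qed
  then have "a \<in> K" by (simp add: S_def)
  then have "generate B {a, t} \<subseteq> K" using tK by (intro generate_subgroup_incl K.subgroup_axioms) auto
  then have "K = carrier B" using generate_gens K.subset by auto
  then show ?thesis using tuple by (auto simp: K_def)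
qed

text \<open>\<open>(Z1, Z2)\<close> is \<open>(X, Y)\<close> for the first condition and \<open>(Y, X)\<close> for the second.\<close>

lemma lolli_tuple_coprime_case:
  fixes Z1 Z2 :: int
  assumes "l \<ge> 1" and i0: "i0 < l" and "k \<ge> 1"
    and Q: "Q = (\<Prod>i<k. q i)" and X: "X = (\<Prod>j<l. x j)" and Y: "Y = (\<Prod>j=1..l. y j)"
    and mn: "m = Q * X" "n = Q * Y"
    and c: "c = (\<Prod>j\<in>{Suc i0..<l}. x j) * (\<Prod>j=1..i0. y j)"
    and arc: "\<forall>i j. i < j \<and> j < k \<longrightarrow> coprime (q i) (r j)"
    and attach: "\<And>p. prime p \<Longrightarrow> p dvd Q \<Longrightarrow> p dvd r k \<Longrightarrow> p dvd Z1 \<or> p dvd Z2"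
    and "r k \<noteq> 0"
    and cop: "coprime Z1 (Q * Z2)" and cZ: "c dvd Z1" and Z2: "Z2 = X \<or> Z2 = Y"
    and conj: "\<And>N. \<exists>z :: int. \<forall>v. t [^] z \<otimes> a [^] (Q * Z1 ^ N * v) \<otimes> inv (t [^] z) = a [^] (Q * Z2 ^ N * v)"
  shows "\<exists>u \<tau>. lolli_tuple B k l q r x y u \<tau> \<and> generate B (insert \<tau> (u ` {..k + l})) = carrier B"
proof -
  obtain r' r'' N where r: "r k = r' * r''" "r'' dvd Z2 ^ N" "coprime r' Z2"
    using coprime_part_decomposition[OF \<open>r k \<noteq> 0\<close>] by blast
  obtain s where s: "Z2 ^ N = r'' * s" using r(2) by blast
  obtain z :: int where z: "\<And>v. t [^] z \<otimes> a [^] (Q * Z1 ^ N * v) \<otimes> inv (t [^] z) = a [^] (Q * Z2 ^ N * v)"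
    using conj by blast
  \<comment> \<open>At the last arc edge a^(Q w) must be conjugate to a^(Q c s r_k). Here s
    completes r'' to a power of Z2, so s r_k is r' times that power, and the conjugation trading Z1
    for Z2 dictates w.\<close>
  define w where "w = Z1 ^ N * (r' * c)"
  show ?thesis
  proof (rule lolli_tuple_construction[OF assms(1) i0 Q X Y mn c])
    have "t [^] z \<otimes> a [^] (Q * w) \<otimes> inv (t [^] z) = a [^] (Q * Z2 ^ N * (r' * c))"
      using z[of "r' * c"] by (simp add: w_def mult.assoc)
    also have "Q * Z2 ^ N * (r' * c) = Q * c * s * r k" by (simp add: s r(1) ac_simps)
    finally show "t [^] z \<otimes> a [^] (Q * w) \<otimes> inv (t [^] z) = a [^] (Q * c * s * r k)" .
  next
    fix p :: int assume p: "prime p"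
    obtain i where i: "i < k" "\<not> p dvd (\<Prod>j<i. q j) * (\<Prod>j\<in>{i<..k - 1}. r j)"
      using exists_prime_free_arc_product[OF \<open>k \<ge> 1\<close> p arc] by blast
    show "(\<exists>i<k. \<not> p dvd (\<Prod>j<i. q j) * (\<Prod>j\<in>{i<..k - 1}. r j) * w) \<or>
      \<not> p dvd Q * c * s \<or> \<not> p dvd Q * X * s \<or> \<not> p dvd Q * Y * s"
    proof (cases "p dvd w")
      case False
      then show ?thesis using i p by (auto simp: prime_dvd_mult_iff)
    next
      case True
      \<comment> \<open>The factor c needs no case of its own because it divides Z1. In both cases p
        turns out to divide none of Q, Z2 and s, so the exponent Q Z2 s at the edge
        \<open>i0\<close> is prime to p.\<close>
      then have "p dvd Z1 \<or> p dvd r'"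
        using p cZ by (auto simp: w_def prime_dvd_mult_iff dest: prime_dvd_power dvd_trans)
      then have "\<not> p dvd Q \<and> \<not> p dvd Z2"
      proof
        assume "p dvd Z1"
        then show ?thesis using cop p by (auto simp: coprime_int_iff_primes prime_dvd_mult_iff)
      next
        assume p': "p dvd r'"
        then have "\<not> p dvd Z2" using r(3) p by (auto simp: coprime_int_iff_primes)
        moreover have "\<not> p dvd Q"
        proof
          assume pQ: "p dvd Q"
          then have "p dvd Z1" using attach[OF p] p' \<open>\<not> p dvd Z2\<close> by (auto simp: r(1))
          then show False using cop p pQ by (auto simp: coprime_int_iff_primes)
        qed
        ultimately show ?thesis by blast
      qed
      moreover from this have "\<not> p dvd s"
        using p s by (metis dvd_mult prime_dvd_power)
      ultimately have "\<not> p dvd Q * Z2 * s" using p by (simp add: prime_dvd_mult_iff)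
      then show ?thesis using Z2 by auto
    qed
  qed
qed

lemma conditions_imp_tuple:
  assumes "l \<ge> 1" and labels: "\<forall>i<k. q i \<noteq> 0 \<and> r (Suc i) \<noteq> 0"
    and Q: "Q = (\<Prod>i<k. q i)" and X: "X = (\<Prod>j<l. x j)" and Y: "Y = (\<Prod>j=1..l. y j)"
    and mn: "m = Q * X" "n = Q * Y"
    and attach: "\<And>p. k \<ge> 1 \<Longrightarrow> prime p \<Longrightarrow> p dvd Q \<Longrightarrow> p dvd r k \<Longrightarrow> p dvd X \<or> p dvd Y"
    and arc: "\<forall>i j. i < j \<and> j < k \<longrightarrow> coprime (q i) (r j)"
    and conditions: "coprime X (Q * Y) \<or> coprime Y (Q * X) \<or>
     (coprime Q (r k) \<and>
      (\<exists>i0<l. \<forall>p::int. prime p \<and> p dvd Q * X \<and> p dvd Q * Y \<longrightarrow>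
         (\<forall>i. i0 < i \<and> i < l \<longrightarrow> \<not> p dvd x i) \<and>
         (\<forall>j. 1 \<le> j \<and> j \<le> i0 \<longrightarrow> \<not> p dvd y j)))"
  shows "\<exists>u \<tau>. lolli_tuple B k l q r x y u \<tau> \<and> generate B (insert \<tau> (u ` {..k + l})) = carrier B"
proof -
  have third: ?thesis if "coprime Q (r k)" and "i0 < l" and i0: "\<forall>p::int. prime p \<and> p dvd Q * X \<and> p dvd Q * Y \<longrightarrow>
         (\<forall>i. i0 < i \<and> i < l \<longrightarrow> \<not> p dvd x i) \<and> (\<forall>j. 1 \<le> j \<and> j \<le> i0 \<longrightarrow> \<not> p dvd y j)" for i0
  proof -
    define c where "c = (\<Prod>j\<in>{Suc i0..<l}. x j) * (\<Prod>j=1..i0. y j)"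
    show ?thesis
    proof (rule lolli_tuple_construction[OF assms(1) \<open>i0 < l\<close> Q X Y mn c_def, of 0 "c * r k" 1])
      show "t [^] (0 :: int) \<otimes> a [^] (Q * (c * r k)) \<otimes> inv (t [^] (0 :: int)) = a [^] (Q * c * 1 * r k)"
        by (simp add: mult.assoc)
    next
      fix p :: int assume p: "prime p"
      show "(\<exists>i<k. \<not> p dvd (\<Prod>j<i. q j) * (\<Prod>j\<in>{i<..k - 1}. r j) * (c * r k)) \<or>
        \<not> p dvd Q * c * 1 \<or> \<not> p dvd Q * X * 1 \<or> \<not> p dvd Q * Y * 1"
      proof (rule ccontr)
        assume no: "\<not> ?thesis"
        then have "p dvd Q * X" "p dvd Q * Y" "p dvd Q * c" by auto
        then have pc: "\<not> p dvd c" using i0 p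
          by (auto simp: c_def prime_dvd_mult_iff prime_dvd_prod_int)
        then have pQ: "p dvd Q" using \<open>p dvd Q * c\<close> p by (simp add: prime_dvd_mult_iff)
        then have "k \<ge> 1" using p by (cases k) (auto simp: Q)
        then obtain i where "i < k" "\<not> p dvd (\<Prod>j<i. q j) * (\<Prod>j\<in>{i<..k - 1}. r j)"
          using exists_prime_free_arc_product[OF _ p arc] by blast
        moreover have "\<not> p dvd r k" using that(1) pQ p by (auto simp: coprime_int_iff_primes)
        ultimately show False using no pc p by (auto simp: prime_dvd_mult_iff)
      qed
    qed
  qed
  show ?thesis
  proof (cases "k = 0")
    case True
    \<comment> \<open>On a circle both coprimality conditions say that X and Y are coprime, and then
      the third one holds vacuously with \<open>i0\<close> = 0.\<close>
    then have Q1: "Q = 1" by (simp add: Q)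
    show ?thesis
    proof (cases "coprime X Y")
      case True
      then have "\<not> (prime p \<and> p dvd Q * X \<and> p dvd Q * Y)" for p
        by (auto simp: Q1 coprime_int_iff_primes)
      then show ?thesis using third[of 0] assms(1) Q1 by auto
    next
      case False
      then show ?thesis using conditions third by (auto simp: Q1 coprime_commute)
    qed
  next
    case False
    then have k: "k \<ge> 1" by simp
    then have rk: "r k \<noteq> 0" using labels[rule_format, of "k - 1"] by simp
    consider "coprime X (Q * Y)" | "coprime Y (Q * X)" | "coprime Q (r k)"
      "\<exists>i0<l. \<forall>p::int. prime p \<and> p dvd Q * X \<and> p dvd Q * Y \<longrightarrow>
         (\<forall>i. i0 < i \<and> i < l \<longrightarrow> \<not> p dvd x i) \<and> (\<forall>j. 1 \<le> j \<and> j \<le> i0 \<longrightarrow> \<not> p dvd y j)"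
      using conditions by blast
    then show ?thesis
    proof cases
      case 1
      \<comment> \<open>Inserting t at the first edge makes c the product x_1 ... x_(l-1), a divisor
        of X.\<close>
      have "X = x 0 * (\<Prod>j\<in>{Suc 0..<l}. x j)"
        unfolding X using prod_lessThan_split[of 0 l x] assms(1) by simp
      moreover have "\<exists>z :: int. \<forall>v. t [^] z \<otimes> a [^] (Q * X ^ N * v) \<otimes> inv (t [^] z) = a [^] (Q * Y ^ N * v)"
        for N
        using stable_conj_scaled[OF mn, of N] by (intro exI[of _ "int N"]) (simp add: int_pow_int)
      ultimately show ?thesis
        using 1 attach[OF k] assms(1) rk
        by (intro lolli_tuple_coprime_case[OF assms(1) _ k Q X Y mn HOL.refl arc, of 0 X Y]) auto
    next
      case 2
      \<comment> \<open>Inserting t at the last edge makes c the product y_1 ... y_(l-1), a divisor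
        of Y; conjugation by t now runs backwards.\<close>
      have "Y = (\<Prod>j=1..l - 1. y j) * y l"
        unfolding Y using prod_atLeast1_split[of "l - 1" l y] assms(1) by simp
      moreover have "\<exists>z :: int. \<forall>v. t [^] z \<otimes> a [^] (Q * Y ^ N * v) \<otimes> inv (t [^] z) = a [^] (Q * X ^ N * v)"
        for N
        using conj_inverse[OF _ _ _ stable_conj_scaled[OF mn, of N]]
        by (intro exI[of _ "- int N"]) (simp add: int_pow_neg int_pow_int)
      ultimately show ?thesis
        using 2 attach[OF k] assms(1) rk
        by (intro lolli_tuple_coprime_case[OF assms(1) _ k Q X Y mn HOL.refl arc, of "l - 1" Y X]) auto
    next
      case 3
      then show ?thesis using third by blast
    qed
  qed
qed

end

theorem theorem6p6:
  fixes G :: "('g, 'c) monoid_scheme"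
    and k l :: nat
    and q r x y :: "nat \<Rightarrow> int"
    and Q X Y :: int
  assumes "group G" and "two_generated G"
    and "l \<ge> 1"
    and "\<forall>i<k. q i \<noteq> 0 \<and> r (Suc i) \<noteq> 0"
    and "\<forall>j<l. x j \<noteq> 0 \<and> y (Suc j) \<noteq> 0"
    and "represents (lollipop k l) (lolli_rev k l) (lolli_label q r x y) G"
    and "reduced_graph (lollipop k l) (lolli_label q r x y)"
    and "k = 0 \<Longrightarrow> \<forall>P. is_plateau (lollipop k l) (lolli_rev k l) (lolli_label q r x y) P
           \<longrightarrow> 0 \<in> verts P"
    and "Q = (\<Prod>i<k. q i)" and "X = (\<Prod>j<l. x j)" and "Y = (\<Prod>j=1..l. y j)"
  shows "(\<exists>\<phi>. \<phi> \<in> epi G (BS (Q * X) (Q * Y))) \<longleftrightarrow>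
    (\<forall>i j. i < j \<and> j < k \<longrightarrow> coprime (q i) (r j)) \<and>
    (coprime X (Q * Y) \<or>
     coprime Y (Q * X) \<or>
     (coprime Q (r k) \<and>
      (\<exists>i0<l. \<forall>p::int. prime p \<and> p dvd Q * X \<and> p dvd Q * Y \<longrightarrow>
         (\<forall>i. i0 < i \<and> i < l \<longrightarrow> \<not> p dvd x i) \<and>
         (\<forall>j. 1 \<le> j \<and> j \<le> i0 \<longrightarrow> \<not> p dvd y j))))"
proof -
  have "X \<noteq> 0" "Q \<noteq> 0" unfolding assms(9,10) using assms(4,5) by (simp_all add: prod_zero_iff)
  moreover have "Y \<noteq> 0"
  proof -
    have "y j \<noteq> 0" if "j \<in> {1..l}" for j using assms(5)[rule_format, of "j - 1"] that by (cases j) auto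
    then show ?thesis by (simp add: assms(11))
  qed
  ultimately have nonzero: "Q * X \<noteq> 0" "Q * Y \<noteq> 0" by auto
  define B where "B = BS (Q * X) (Q * Y)"
  have "group B" unfolding B_def BS_def by (rule group_presented_group)
  interpret bs_group B "Q * X" "Q * Y"
    by (intro bs_group.intro bs_group_axioms.intro \<open>group B\<close> nonzero B_def)
  note G = assms(1,2,3,6)
  \<comment> \<open>Arc edges join different vertices, so reducedness excludes labels 1 and -1 on
    them.\<close>
  have q_unit: "\<not> is_unit (q i)" if "i < k" for i
  proof
    assume "is_unit (q i)"
    then have "\<bar>lolli_label q r x y (Arc i, True)\<bar> = 1" by simp
    then have "tail (lollipop k l) (Arc i, True) = head (lollipop k l) (Arc i, True)"
      using assms(7) that unfolding reduced_graph_def by (metis lolli_arcs_iff(1) lollipop_simps(2))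
    then show False by simp
  qed
  show ?thesis
    unfolding B_def[symmetric] lolli_epi_iff[OF assms(1) \<open>group B\<close> assms(3,6)]
  proof
    assume "\<exists>u \<tau>. lolli_tuple B k l q r x y u \<tau> \<and> generate B (insert \<tau> (u ` {..k + l})) = carrier B"
    then obtain u \<tau> where tuple: "lolli_tuple B k l q r x y u \<tau>"
      and gen: "generate B (insert \<tau> (u ` {..k + l})) = carrier B" by blast
    show "(\<forall>i j. i < j \<and> j < k \<longrightarrow> coprime (q i) (r j)) \<and>
    (coprime X (Q * Y) \<or>
     coprime Y (Q * X) \<or>
     (coprime Q (r k) \<and>
      (\<exists>i0<l. \<forall>p::int. prime p \<and> p dvd Q * X \<and> p dvd Q * Y \<longrightarrow>
         (\<forall>i. i0 < i \<and> i < l \<longrightarrow> \<not> p dvd x i) \<and>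
         (\<forall>j. 1 \<le> j \<and> j \<le> i0 \<longrightarrow> \<not> p dvd y j))))"
    proof (cases "\<exists>p. prime p \<and> p dvd Q * X \<and> p dvd Q * Y")
      \<comment> \<open>A prime divisor of q_0 would divide Q and hence both QX and QY, so there is
        no arc and Q = 1.\<close>
      case False
      have "k = 0"
      proof (rule ccontr)
        assume "k \<noteq> 0"
        then obtain p where "prime p" "p dvd q 0"
          using prime_divisor_exists[of "q 0"] q_unit[of 0] assms(4) by auto
        moreover have "q 0 dvd Q" unfolding assms(9) using \<open>k \<noteq> 0\<close> by (intro dvd_prodI) auto
        ultimately show False using False by (meson dvd_mult2 dvd_trans)
      qed
      then have "Q = 1" by (simp add: assms(9))
      then have "coprime X (Q * Y)" using False by (auto simp: coprime_int_iff_primes)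
      then show ?thesis using \<open>k = 0\<close> by simp
    next
      case True
      then have units: "\<not> is_unit (Q * X)" "\<not> is_unit (Q * Y)"
        by (meson dvd_trans not_prime_unit)+
      note ell = lolli_tuple_elliptic[OF tuple assms(4,5) gen units]
      have "\<forall>i. \<exists>h e. i \<le> k + l \<longrightarrow> h \<in> carrier B \<and> u i = h \<otimes>\<^bsub>B\<^esub> a [^]\<^bsub>B\<^esub> (e :: int) \<otimes>\<^bsub>B\<^esub> inv\<^bsub>B\<^esub> h"
        using ell by blast
      then obtain h and e :: "nat \<Rightarrow> int" where he: "\<And>i. i \<le> k + l \<Longrightarrow>
          h i \<in> carrier B \<and> u i = h i \<otimes>\<^bsub>B\<^esub> a [^]\<^bsub>B\<^esub> e i \<otimes>\<^bsub>B\<^esub> inv\<^bsub>B\<^esub> h i"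
        by metis
      have e0: "\<not> p dvd e 0" if p: "prime p" "p dvd Q * X" "p dvd Q * Y" for p
      proof (cases "k = 0")
        case True
        then show ?thesis
          using circle_exponent_coprime[of l q r x y u \<tau> p h e] assms(3,8) tuple gen p he by auto
      next
        case False
        then obtain p1 where "prime p1" "p1 dvd q 0"
          using prime_divisor_exists[of "q 0"] q_unit[of 0] assms(4) by auto
        then show ?thesis
          using exponent_origin_coprime[OF G tuple gen _ p _ _ _, of p1 "h 0" "e 0"] False he[of 0] by auto
      qed
      \<comment> \<open>Conjugating the whole tuple turns v_0 into a^(e 0) and preserves generation,
        so the fact about \<open>e 0\<close> applies unchanged.\<close>
      define c where "c = (\<lambda>g. inv\<^bsub>B\<^esub> h 0 \<otimes>\<^bsub>B\<^esub> g \<otimes>\<^bsub>B\<^esub> inv\<^bsub>B\<^esub> (inv\<^bsub>B\<^esub> h 0))"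
      have h0c: "h 0 \<in> carrier B" and u0: "u 0 = h 0 \<otimes>\<^bsub>B\<^esub> a [^]\<^bsub>B\<^esub> e 0 \<otimes>\<^bsub>B\<^esub> inv\<^bsub>B\<^esub> h 0"
        using he[OF le0] by blast+
      have h0: "inv\<^bsub>B\<^esub> h 0 \<in> carrier B" using h0c by simp
      note conj = lolli_tuple_conjugate[OF tuple h0 gen, folded c_def]
      have "c (u 0) = a [^]\<^bsub>B\<^esub> e 0"
        unfolding c_def u0 using h0c by (intro conj_inverse) simp_all
      then have cu0: "(c \<circ> u) 0 = a [^]\<^bsub>B\<^esub> e 0" by (simp only: o_apply)
      have last: "\<not> is_unit (q (k - 1))" if "k \<ge> 1" using q_unit[of "k - 1"] that by simp
      show ?thesis
        by (rule normalized_tuple_imp_conditions[OF assms(3) conj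
            lolli_tuple_elliptic[OF conj(1) assms(4,5) conj(2) units] cu0 e0 last assms(9-11) HOL.refl HOL.refl])
    qed
  next
    assume conds: "(\<forall>i j. i < j \<and> j < k \<longrightarrow> coprime (q i) (r j)) \<and>
    (coprime X (Q * Y) \<or>
     coprime Y (Q * X) \<or>
     (coprime Q (r k) \<and>
      (\<exists>i0<l. \<forall>p::int. prime p \<and> p dvd Q * X \<and> p dvd Q * Y \<longrightarrow>
         (\<forall>i. i0 < i \<and> i < l \<longrightarrow> \<not> p dvd x i) \<and>
         (\<forall>j. 1 \<le> j \<and> j \<le> i0 \<longrightarrow> \<not> p dvd y j))))"
    \<comment> \<open>The converse uses two-generation here and nowhere else.\<close>
    have "p dvd X \<or> p dvd Y" if "prime p" "p dvd Q" "p dvd r k" for p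
      using prime_dvd_arc_and_attachment[OF G that(1) _ that(3)] that(2) by (simp add: assms(9-11))
    then show "\<exists>u \<tau>. lolli_tuple B k l q r x y u \<tau> \<and> generate B (insert \<tau> (u ` {..k + l})) = carrier B"
      using conditions_imp_tuple[OF assms(3,4,9,10,11) HOL.refl HOL.refl] conds by blast
  qed
qed

end
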